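(* For any $\lambda>0$ and any $M>0$, the functional $$J_{h,\lambda}(V^h)=\sum_{p,q=1}^{Z_h-1}h^2\int_{-b}^{b}\left|L^h(V^h)(x_p,y_q,z)\right|^2\mu_\lambda(z)\,dz$$ has its Fréchet derivative $J_{h,\lambda}'(V^h)\in H^{2,h}_{2N,0}$ at any point $V^h\in\overline{B(M)}$. In addition, there exist numbers $\lambda_1=\lambda_1(\Omega,\theta,N,M)>1$ and $C_2=C_2(\Omega_h,\theta,N,M)>0$, depending only on the listed parameters, such that for all $\lambda\ge\lambda_1$ the functional $J_{h,\lambda}$ is strictly convex on $\overline{B(M)}$. More precisely, for all $\lambda\ge\lambda_1$ and all $V^h,\,V^h+r^h\in\overline{B(M)}$, $$J_{h,\lambda}(V^h+r^h)-J_{h,\lambda}(V^h)-J_{h,\lambda}'(V^h)(r^h)\ \ge\ C_2\,e^{2\lambda(b-\theta)^2}\,\|r^h\|^2_{H^{2,h}_{2N}}.$$ Moreover $\lambda_1$ can be taken with $\lambda_1\ge\lambda_0$, where $\lambda_0=\lambda_0(\Omega,\theta)>1$ is a threshold such that, for some $C>0$ independent of $\lambda$ and $u^h$, for all $\lambda\ge\lambda_0$ and all $u^h\in H^{2,h}_{2N,0}$, $$\sum_{p,q}h^2\!\int_{-b}^{b}\!(\Delta^hu^h_{p,q})^2\mu_\lambda dz\ \ge\ C\sum_{p,q}h^2\!\int_{-b}^{b}\!\Big[(\partial_z^2u^h_{p,q})^2+\lambda(\partial_zu^h_{p,q})^2+\lambda^3\big((\partial_x^hu^h_{p,q})^2+(\partial_y^hu^h_{p,q})^2+(u^h_{p,q})^2\big)\Big]\mu_\lambda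 dz,$$ the sums being over $1\le p,q\le Z_h-1$.
   Context: Fixed parameters: $R,b>0$, $d>b$, $a_1<a_2$, $k>0$, an integer $N\ge1$, $\theta>b$, and $h_0>0$. $\Omega=(-R,R)\times(-R,R)\times(-b,b)$. Dependence of constants on the fixed $k,d,a_1,a_2,h_0$ is not listed. Carleman weight: $\mu_\lambda(z)=\exp(2\lambda(z-\theta)^2)$, $z\in[-b,b]$. Grid: $x_p=-R+ph$, $y_q=-R+qh$, $0\le p,q\le Z_h$, $h=2R/Z_h\ge h_0$ ($Z_h\ge2$). A semi-discrete function $w^h=\{w^h_{p,q}(z)\}_{p,q=0}^{Z_h}$ assigns to each node a function of $z\in[-b,b]$, $w^h_{p,q}(z)=w(x_p,y_q,z)$; $\Omega_h$ is the corresponding set of points $(x_p,y_q,z)$ and $\Gamma_h$ is the part $z=-b$. Complex $N$-vector-valued functions are identified with real $2N$-vector-valued ones. At interior nodes $1\le p,q\le Z_h-1$: $\partial_x^hw_{p,q}=(w_{p+1,q}-w_{p-1,q})/(2h)$, $w_{xx}^h=h^{-2}(w_{p+1,q}-2w_{p,q}+w_{p-1,q})$, similarly in $y$; $\nabla^hw=(\partial_x^hw,\partial_y^hw,\partial_zw)$, $\Delta^hw=w_{zz}+w^h_{xx}+w^h_{yy}$. $H^{2,h}_{2N}$: semi-discrete functions with $\|w^h\|^2_{H^{2,h}_{2N}}=\sum_{p,q=1}^{Z_h-1}\sum_{m=0}^{2}h^2\int_{-b}^{b}|\partial_z^mw^h_{p,q}(z)|^2dz<\infty$, with scalar product $(\cdot,\cdot)$.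 Discrete Neumann condition ($\nabla^hw\cdot n=0$ on $\partial\Omega_h\setminus\Gamma_h$): $w_{0,q}=w_{1,q}$, $w_{Z_h,q}=w_{Z_h-1,q}$, $w_{p,0}=w_{p,1}$, $w_{p,Z_h}=w_{p,Z_h-1}$ and $\partial_zw_{p,q}(b)=0$ for $1\le p,q\le Z_h-1$. $H^{2,h}_{2N,0}$: the $w^h\in H^{2,h}_{2N}$ satisfying the discrete Neumann condition and $w^h_{p,q}(-b)=\partial_zw^h_{p,q}(-b)=0$. Nonlinearity: $\{\Psi_n\}_{n\ge0}$ is the orthonormal basis of $L^2(a_1,a_2)$ obtained by Gram–Schmidt from $\{\alpha^ne^\alpha\}_{n\ge0}$; $S_N=(s_{mn})_{m,n=0}^{N-1}$, $s_{mn}=\int_{a_1}^{a_2}\Psi_n'\Psi_m\,d\alpha$ (upper triangular with unit diagonal, hence invertible). With $\mathbf x_\alpha=(\alpha,0,-d)$, $$\tilde{\mathbf x}_\alpha=\frac{\mathrm ik(\mathbf x-\mathbf x_\alpha)}{|\mathbf x-\mathbf x_\alpha|}-\frac{\mathbf x-\mathbf x_\alpha}{|\mathbf x-\mathbf x_\alpha|^2},\qquad \hat{\mathbf x}_\alpha=\partial_\alpha\tilde{\mathbf x}_\alpha .$$ For $V=(v_0,\dots,v_{N-1})^T$, $K(\nabla V)=S_N^{-1}f(\nabla V)$, where for $0\le m\le N-1$ $$f_m(\nabla V)=2\sum_{n,l=0}^{N-1}\nabla v_n\cdot\nabla v_l\int_{a_1}^{a_2}\Psi_m\Psi_n\Psi_l'\,d\alpha+2\sum_{n=0}^{N-1}\int_{a_1}^{a_2}\Psi_m\Psi_n'\,\nabla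 v_n\cdot\tilde{\mathbf x}_\alpha\,d\alpha+2\sum_{n=0}^{N-1}\int_{a_1}^{a_2}\Psi_m\Psi_n\,\hat{\mathbf x}_\alpha\cdot\nabla v_n\,d\alpha$$ (dot products bilinear, no conjugation). $L^h(V^h)=\Delta^hV^h+K(\nabla^hV^h)$, evaluated at interior nodes. Given boundary data $\psi_0^h,\psi_1^h$ on $\Gamma_h$, $B(M)$ is the set of $V^h\in H^{2,h}_{2N}$ with $\|V^h\|_{H^{2,h}_{2N}}<M$, $V^h|_{\Gamma_h}=\psi_0^h$, $\partial_zV^h|_{\Gamma_h}=\psi_1^h$, and satisfying the discrete Neumann condition; $\overline{B(M)}$ is its closure. The Fréchet derivative at $V^h$ is the element $J'_{h,\lambda}(V^h)\in H^{2,h}_{2N,0}$ with $J_{h,\lambda}(V^h+r)=J_{h,\lambda}(V^h)+(J'_{h,\lambda}(V^h),r)+o(\|r\|)$ for $r\in H^{2,h}_{2N,0}$, and $J'_{h,\lambda}(V^h)(r)=(J'_{h,\lambda}(V^h),r)$. *)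

theory Defs
  imports "HOL-Analysis.Analysis" "Jordan_Normal_Form.Gauss_Jordan_Elimination"
begin

text \<open>
  A scalar semi-discrete function assigns to a node \<open>(p,q)\<close> a function of \<open>z\<close>; a vector-valued one
  has components \<open>V n\<close>, of which only those with \<open>n < N\<close> are ever looked at. The identification of
  complex \<open>N\<close>-vectors with real \<open>2N\<close>-vectors is made by the real inner product of type \<open>complex\<close>.
\<close>

type_synonym sdf = "nat \<Rightarrow> nat \<Rightarrow> real \<Rightarrow> complex"
type_synonym sdvec = "nat \<Rightarrow> sdf"

definition sd_add :: "sdvec \<Rightarrow> sdvec \<Rightarrow> sdvec" where
  "sd_add V W = (\<lambda>n p q z. V n p q z + W n p q z)"

definition sd_diff :: "sdvec \<Rightarrow> sdvec \<Rightarrow> sdvec" where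
  "sd_diff V W = (\<lambda>n p q z. V n p q z - W n p q z)"

definition sd_segment :: "sdvec \<Rightarrow> sdvec \<Rightarrow> real \<Rightarrow> sdvec" where
  "sd_segment V W t = (\<lambda>n p q z. (1 - t) *\<^sub>R V n p q z + t *\<^sub>R W n p q z)"

definition mesh :: "real \<Rightarrow> nat \<Rightarrow> real" where
  "mesh R Z = 2 * R / real Z"

definition node :: "real \<Rightarrow> nat \<Rightarrow> nat \<Rightarrow> real" where
  "node R Z p = - R + real p * mesh R Z"

definition admissible_grid :: "real \<Rightarrow> real \<Rightarrow> nat \<Rightarrow> bool" where
  "admissible_grid R h0 Z \<longleftrightarrow> Z \<ge> 2 \<and> mesh R Z \<ge> h0"

definition grid_sum :: "real \<Rightarrow> nat \<Rightarrow> (nat \<Rightarrow> nat \<Rightarrow> real) \<Rightarrow> real" where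
  "grid_sum R Z F = (\<Sum>p\<in>{1..Z-1}. \<Sum>q\<in>{1..Z-1}. (mesh R Z)^2 * F p q)"

text \<open>
  Functions in \<open>H\<^sup>2(-b,b)\<close> are taken as their \<open>C\<^sup>1\<close> representatives on \<open>[-b,b]\<close>: the first derivative is
  the classical one (one-sided at the end points), it is absolutely continuous, and the second
  derivative is its density, which is unique up to a null set; hence the choice in \<open>dzz\<close> affects
  no integral.
\<close>

definition has_ac_deriv :: "real \<Rightarrow> (real \<Rightarrow> complex) \<Rightarrow> (real \<Rightarrow> complex) \<Rightarrow> bool" where
  "has_ac_deriv b f g \<longleftrightarrow> g absolutely_integrable_on {-b..b} \<and>
     (\<forall>z\<in>{-b..b}. f z = f (-b) + integral {-b..z} g)"

definition dz :: "real \<Rightarrow> (real \<Rightarrow> complex) \<Rightarrow> real \<Rightarrow> complex" where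
  "dz b f z = vector_derivative f (at z within {-b..b})"

definition dzz :: "real \<Rightarrow> (real \<Rightarrow> complex) \<Rightarrow> real \<Rightarrow> complex" where
  "dzz b f = (SOME g. has_ac_deriv b (dz b f) g)"

definition H2_interval :: "real \<Rightarrow> (real \<Rightarrow> complex) \<Rightarrow> bool" where
  "H2_interval b f \<longleftrightarrow> (\<forall>z\<in>{-b..b}. f differentiable (at z within {-b..b})) \<and>
     (\<exists>g. has_ac_deriv b (dz b f) g) \<and> (\<lambda>z. (cmod (dzz b f z))^2) integrable_on {-b..b}"

definition H2h :: "real \<Rightarrow> nat \<Rightarrow> nat \<Rightarrow> sdvec set" where
  "H2h b Z N = {w. \<forall>n<N. \<forall>p\<in>{1..Z-1}. \<forall>q\<in>{1..Z-1}. H2_interval b (w n p q)}"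

definition ip_H2h :: "real \<Rightarrow> real \<Rightarrow> nat \<Rightarrow> nat \<Rightarrow> sdvec \<Rightarrow> sdvec \<Rightarrow> real" where
  "ip_H2h R b Z N u v = grid_sum R Z (\<lambda>p q. integral {-b..b} (\<lambda>z. \<Sum>n<N.
     inner (u n p q z) (v n p q z) +
     inner (dz b (u n p q) z) (dz b (v n p q) z) +
     inner (dzz b (u n p q) z) (dzz b (v n p q) z)))"

definition norm_H2h :: "real \<Rightarrow> real \<Rightarrow> nat \<Rightarrow> nat \<Rightarrow> sdvec \<Rightarrow> real" where
  "norm_H2h R b Z N w = sqrt (ip_H2h R b Z N w w)"

definition lateral_neumann :: "real \<Rightarrow> nat \<Rightarrow> nat \<Rightarrow> sdvec \<Rightarrow> bool" where
  "lateral_neumann b Z N w \<longleftrightarrow> (\<forall>n<N. \<forall>i\<in>{1..Z-1}. \<forall>z\<in>{-b..b}.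
     w n 0 i z = w n 1 i z \<and> w n Z i z = w n (Z - 1) i z \<and>
     w n i 0 z = w n i 1 z \<and> w n i Z z = w n i (Z - 1) z)"

definition discrete_neumann :: "real \<Rightarrow> nat \<Rightarrow> nat \<Rightarrow> sdvec \<Rightarrow> bool" where
  "discrete_neumann b Z N w \<longleftrightarrow> lateral_neumann b Z N w \<and>
     (\<forall>n<N. \<forall>p\<in>{1..Z-1}. \<forall>q\<in>{1..Z-1}. dz b (w n p q) b = 0)"

definition cauchy_data ::
  "real \<Rightarrow> nat \<Rightarrow> nat \<Rightarrow> (nat \<Rightarrow> nat \<Rightarrow> nat \<Rightarrow> complex) \<Rightarrow> (nat \<Rightarrow> nat \<Rightarrow> nat \<Rightarrow> complex) \<Rightarrow> sdvec \<Rightarrow> bool" where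
  "cauchy_data b Z N \<psi>0 \<psi>1 w \<longleftrightarrow> (\<forall>n<N. \<forall>p\<in>{1..Z-1}. \<forall>q\<in>{1..Z-1}.
     w n p q (-b) = \<psi>0 n p q \<and> dz b (w n p q) (-b) = \<psi>1 n p q)"

definition H2h_0 :: "real \<Rightarrow> nat \<Rightarrow> nat \<Rightarrow> sdvec set" where
  "H2h_0 b Z N = {w \<in> H2h b Z N. discrete_neumann b Z N w \<and>
     cauchy_data b Z N (\<lambda>n p q. 0) (\<lambda>n p q. 0) w}"

definition B_set ::
  "real \<Rightarrow> real \<Rightarrow> nat \<Rightarrow> nat \<Rightarrow> (nat \<Rightarrow> nat \<Rightarrow> nat \<Rightarrow> complex) \<Rightarrow> (nat \<Rightarrow> nat \<Rightarrow> nat \<Rightarrow> complex) \<Rightarrow> real \<Rightarrow> sdvec set"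
where
  "B_set R b Z N \<psi>0 \<psi>1 M = {V \<in> H2h b Z N. norm_H2h R b Z N V < M \<and>
     cauchy_data b Z N \<psi>0 \<psi>1 V \<and> discrete_neumann b Z N V}"

text \<open>
  The norm does not see the values at the lateral boundary nodes; these are recovered from the
  interior ones by the relations \<open>lateral_neumann\<close>. Without requiring these relations, a limit in the
  norm would have arbitrary boundary values.
\<close>

definition closure_B ::
  "real \<Rightarrow> real \<Rightarrow> nat \<Rightarrow> nat \<Rightarrow> (nat \<Rightarrow> nat \<Rightarrow> nat \<Rightarrow> complex) \<Rightarrow> (nat \<Rightarrow> nat \<Rightarrow> nat \<Rightarrow> complex) \<Rightarrow> real \<Rightarrow> sdvec set"
where
  "closure_B R b Z N \<psi>0 \<psi>1 M = {V \<in> H2h b Z N. lateral_neumann b Z N V \<and>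
     (\<forall>\<epsilon>>0. \<exists>W\<in>B_set R b Z N \<psi>0 \<psi>1 M. norm_H2h R b Z N (sd_diff V W) < \<epsilon>)}"

definition dxh :: "real \<Rightarrow> nat \<Rightarrow> sdf \<Rightarrow> sdf" where
  "dxh R Z w p q z = (w (p+1) q z - w (p-1) q z) / of_real (2 * mesh R Z)"

definition dyh :: "real \<Rightarrow> nat \<Rightarrow> sdf \<Rightarrow> sdf" where
  "dyh R Z w p q z = (w p (q+1) z - w p (q-1) z) / of_real (2 * mesh R Z)"

definition dxxh :: "real \<Rightarrow> nat \<Rightarrow> sdf \<Rightarrow> sdf" where
  "dxxh R Z w p q z = (w (p+1) q z - 2 * w p q z + w (p-1) q z) / of_real ((mesh R Z)^2)"

definition dyyh :: "real \<Rightarrow> nat \<Rightarrow> sdf \<Rightarrow> sdf" where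
  "dyyh R Z w p q z = (w p (q+1) z - 2 * w p q z + w p (q-1) z) / of_real ((mesh R Z)^2)"

definition laplace_h :: "real \<Rightarrow> real \<Rightarrow> nat \<Rightarrow> sdf \<Rightarrow> sdf" where
  "laplace_h R b Z w p q z = dzz b (w p q) z + dxxh R Z w p q z + dyyh R Z w p q z"

definition grad_h :: "real \<Rightarrow> real \<Rightarrow> nat \<Rightarrow> sdf \<Rightarrow> nat \<Rightarrow> nat \<Rightarrow> real \<Rightarrow> complex^3" where
  "grad_h R b Z w p q z = vector [dxh R Z w p q z, dyh R Z w p q z, dz b (w p q) z]"

definition bdot :: "complex^3 \<Rightarrow> complex^3 \<Rightarrow> complex" where
  "bdot u v = (\<Sum>i\<in>UNIV. vec_nth u i * vec_nth v i)"

definition ip_L2 :: "real \<Rightarrow> real \<Rightarrow> (real \<Rightarrow> real) \<Rightarrow> (real \<Rightarrow> real) \<Rightarrow> real" where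
  "ip_L2 a1 a2 f g = integral {a1..a2} (\<lambda>\<alpha>. f \<alpha> * g \<alpha>)"

text \<open>Gram--Schmidt orthonormalisation of \<open>\<alpha>\<^sup>n e\<^sup>\<alpha>\<close>.\<close>

fun Psi :: "real \<Rightarrow> real \<Rightarrow> nat \<Rightarrow> real \<Rightarrow> real" where
  "Psi a1 a2 n =
     (let \<phi> = (\<lambda>\<alpha>. \<alpha> ^ n * exp \<alpha>);
          u = (\<lambda>\<alpha>. \<phi> \<alpha> - (\<Sum>i<n. ip_L2 a1 a2 \<phi> (Psi a1 a2 i) * Psi a1 a2 i \<alpha>))
      in (\<lambda>\<alpha>. u \<alpha> / sqrt (ip_L2 a1 a2 u u)))"

declare Psi.simps [simp del]

definition S_mat :: "real \<Rightarrow> real \<Rightarrow> nat \<Rightarrow> real mat" where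
  "S_mat a1 a2 N = Matrix.mat N N (\<lambda>(m, n).
     integral {a1..a2} (\<lambda>\<alpha>. deriv (Psi a1 a2 n) \<alpha> * Psi a1 a2 m \<alpha>))"

definition S_inv :: "real \<Rightarrow> real \<Rightarrow> nat \<Rightarrow> real mat" where
  "S_inv a1 a2 N = the (mat_inverse (S_mat a1 a2 N))"

definition x_tilde :: "real \<Rightarrow> real \<Rightarrow> real^3 \<Rightarrow> real \<Rightarrow> complex^3" where
  "x_tilde k d x \<alpha> = (let y = x - vector [\<alpha>, 0, -d] in
     \<chi> i. \<i> * of_real (k * vec_nth y i / norm y) - of_real (vec_nth y i / (norm y)^2))"

definition x_hat :: "real \<Rightarrow> real \<Rightarrow> real^3 \<Rightarrow> real \<Rightarrow> complex^3" where
  "x_hat k d x \<alpha> = vector_derivative (x_tilde k d x) (at \<alpha>)"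

definition f_nonlin ::
  "real \<Rightarrow> real \<Rightarrow> real \<Rightarrow> real \<Rightarrow> nat \<Rightarrow> real^3 \<Rightarrow> (nat \<Rightarrow> complex^3) \<Rightarrow> nat \<Rightarrow> complex" where
  "f_nonlin d a1 a2 k N x G m =
     2 * (\<Sum>n<N. \<Sum>l<N. bdot (G n) (G l) *
            of_real (integral {a1..a2} (\<lambda>\<alpha>. Psi a1 a2 m \<alpha> * Psi a1 a2 n \<alpha> * deriv (Psi a1 a2 l) \<alpha>))) +
     2 * (\<Sum>n<N. integral {a1..a2} (\<lambda>\<alpha>.
            of_real (Psi a1 a2 m \<alpha> * deriv (Psi a1 a2 n) \<alpha>) * bdot (G n) (x_tilde k d x \<alpha>))) +
     2 * (\<Sum>n<N. integral {a1..a2} (\<lambda>\<alpha>.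
            of_real (Psi a1 a2 m \<alpha> * Psi a1 a2 n \<alpha>) * bdot (x_hat k d x \<alpha>) (G n)))"

definition K_nonlin ::
  "real \<Rightarrow> real \<Rightarrow> real \<Rightarrow> real \<Rightarrow> nat \<Rightarrow> real^3 \<Rightarrow> (nat \<Rightarrow> complex^3) \<Rightarrow> nat \<Rightarrow> complex" where
  "K_nonlin d a1 a2 k N x G m =
     (\<Sum>n<N. of_real (S_inv a1 a2 N $$ (m, n)) * f_nonlin d a1 a2 k N x G n)"

definition L_h ::
  "real \<Rightarrow> real \<Rightarrow> real \<Rightarrow> real \<Rightarrow> real \<Rightarrow> real \<Rightarrow> nat \<Rightarrow> nat \<Rightarrow> sdvec \<Rightarrow> sdvec" where
  "L_h R b d a1 a2 k Z N V n p q z = laplace_h R b Z (V n) p q z +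
     K_nonlin d a1 a2 k N (vector [node R Z p, node R Z q, z]) (\<lambda>l. grad_h R b Z (V l) p q z) n"

definition carleman_weight :: "real \<Rightarrow> real \<Rightarrow> real \<Rightarrow> real" where
  "carleman_weight \<theta> lam z = exp (2 * lam * (z - \<theta>)^2)"

definition J_functional ::
  "real \<Rightarrow> real \<Rightarrow> real \<Rightarrow> real \<Rightarrow> real \<Rightarrow> real \<Rightarrow> real \<Rightarrow> nat \<Rightarrow> nat \<Rightarrow> real \<Rightarrow> sdvec \<Rightarrow> real" where
  "J_functional R b d a1 a2 k \<theta> Z N lam V = grid_sum R Z (\<lambda>p q. integral {-b..b} (\<lambda>z.
     (\<Sum>n<N. (cmod (L_h R b d a1 a2 k Z N V n p q z))^2) * carleman_weight \<theta> lam z))"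

text \<open>Differentiability along \<open>H2h_0\<close>, with the derivative represented by an element of \<open>H2h_0\<close>.\<close>

definition has_frechet_deriv ::
  "real \<Rightarrow> real \<Rightarrow> nat \<Rightarrow> nat \<Rightarrow> (sdvec \<Rightarrow> real) \<Rightarrow> sdvec \<Rightarrow> sdvec \<Rightarrow> bool" where
  "has_frechet_deriv R b Z N F V g \<longleftrightarrow> g \<in> H2h_0 b Z N \<and>
     (\<forall>\<epsilon>>0. \<exists>\<delta>>0. \<forall>r\<in>H2h_0 b Z N. norm_H2h R b Z N r < \<delta> \<longrightarrow>
        \<bar>F (sd_add V r) - F V - ip_H2h R b Z N g r\<bar> \<le> \<epsilon> * norm_H2h R b Z N r)"

text \<open>As everywhere, \<open>R, b, \<theta>, h0\<close> are fixed; the constant \<open>C\<close> serves all admissible grids.\<close>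

definition carleman_threshold :: "real \<Rightarrow> real \<Rightarrow> real \<Rightarrow> real \<Rightarrow> real \<Rightarrow> bool" where
  "carleman_threshold R b h0 \<theta> lam0 \<longleftrightarrow> lam0 > 1 \<and>
     (\<exists>C>0. \<forall>Z N. admissible_grid R h0 Z \<and> N \<ge> 1 \<longrightarrow>
       (\<forall>lam\<ge>lam0. \<forall>u\<in>H2h_0 b Z N.
          grid_sum R Z (\<lambda>p q. integral {-b..b} (\<lambda>z.
            (\<Sum>n<N. (cmod (laplace_h R b Z (u n) p q z))^2) * carleman_weight \<theta> lam z))
          \<ge> C * grid_sum R Z (\<lambda>p q. integral {-b..b} (\<lambda>z.
            (\<Sum>n<N. (cmod (dzz b (u n p q) z))^2 + lam * (cmod (dz b (u n p q) z))^2
               + lam^3 * ((cmod (dxh R Z (u n) p q z))^2 + (cmod (dyh R Z (u n) p q z))^2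
                          + (cmod (u n p q z))^2)) * carleman_weight \<theta> lam z))))"

end

theory Submission
  imports Defs
begin

text \<open>
  At an interior node the operator has the form \<open>L(V) = V'' + P(z, V, V')\<close>, where a prime is the derivative
  in \<open>z\<close> and \<open>P\<close> is a polynomial of degree two, without constant term, in the values and the first
  \<open>z\<close>-derivatives of all components at all interior nodes: the difference quotients in \<open>x\<close> and \<open>y\<close> only
  combine finitely many nodes, and the lateral nodes are eliminated by the discrete Neumann condition.
  Everything is therefore proved for a finite family of functions of one variable and such an operator
  (locale \<open>quadratic_operator\<close>), and then transferred to grids (locale \<open>grid_operator\<close>).

  Since \<open>P\<close> is quadratic, \<open>L(V + r) = L(V) + L'(V)r + Q(r)\<close> holds exactly, with \<open>Q\<close> a quadratic form in
  \<open>(r, r')\<close>, and so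
  \<open>J(V + r) - J(V) - 2 \<integral> \<langle>L(V), L'(V)r\<rangle>\<mu> = \<integral> (2\<langle>L(V), Q(r)\<rangle> + |L'(V)r + Q(r)|\<^sup>2)\<mu>\<close>
  (\<open>functional_expansion\<close>). The right-hand side is of the order of the squared norm of \<open>r\<close> by the Sobolev bound in
  one variable (\<open>remainder_quadratic_bound\<close>), so the linear term is the derivative. It is represented by an
  element of the space by solving a linear two-point boundary value problem of fourth order at every
  node (\<open>H2_bc_riesz_representation\<close>), which replaces an appeal to completeness of the space.

  Convexity is a lower bound for the right-hand side. The increment \<open>r\<close> and its derivative vanish at \<open>z = -b\<close>, and the
  weight decreases at a logarithmic rate of at least \<open>4\<kappa>\<close> with \<open>\<kappa> = \<lambda>(\<theta> - b)\<close>. Hence a function \<open>w\<close> vanishing at \<open>-b\<close> satisfies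
  \<open>sup |w|\<^sup>2\<mu> \<le> (\<integral> |w'|\<^sup>2\<mu>) / (2\<kappa>)\<close> (\<open>weighted_first_order_estimate\<close>). Applied to \<open>r'\<close> and to \<open>r\<close>, it
  bounds all lower-order terms by a multiple of \<open>Y/\<lambda>\<close>, where \<open>Y = \<integral> |r''|\<^sup>2\<mu>\<close>. If \<open>V\<close> and \<open>V + r\<close>
  stay in a ball, the coefficients of these terms are bounded; the second derivative of \<open>V\<close>, which is only
  square integrable, enters through the integral of \<open>|L(V)|\<close> alone, multiplied by a supremum of lower-order terms. The
  right-hand side is thus at least \<open>Y/2 - O(Y/\<lambda>) \<ge> Y/4\<close> for large \<open>\<lambda>\<close> (\<open>remainder_coercive\<close>), and \<open>Y\<close>
  dominates the squared norm of \<open>r\<close> multiplied by the minimum of the weight. The Carleman estimate for the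
  discrete Laplacian is the same argument with \<open>Q = 0\<close>. All thresholds may depend on the
  grid, because only finitely many grids have mesh size at least \<open>h0\<close>.
\<close>

section \<open>Primitives of integrable functions\<close>

text \<open>This is \<open>has_ac_deriv\<close> for an arbitrary interval and arbitrary Euclidean values. The increment form with
  \<open>has_integral\<close> makes primitives closed under linear operations without side conditions on integrability.\<close>

definition primitive_on :: "real \<Rightarrow> real \<Rightarrow> (real \<Rightarrow> 'a::euclidean_space) \<Rightarrow> (real \<Rightarrow> 'a) \<Rightarrow> bool" where
  "primitive_on a b F f \<longleftrightarrow> f absolutely_integrable_on {a..b} \<and>
     (\<forall>z\<in>{a..b}. (f has_integral (F z - F a)) {a..z})"

lemma primitive_on_absolutely_integrable: "primitive_on a b F f \<Longrightarrow> f absolutely_integrable_on {a..b}"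
  by (simp add: primitive_on_def)

lemma primitive_on_integrable:
  assumes "primitive_on a b F f"
  shows "f integrable_on {a..b}"
  using assms by (simp add: absolutely_integrable_on_def primitive_on_def)

lemma primitive_on_eval:
  assumes "primitive_on a b F f" "z \<in> {a..b}"
  shows "F z = F a + integral {a..z} f"
  using assms by (metis add.commute diff_add_cancel integral_unique primitive_on_def)

lemma primitive_on_continuous:
  assumes "primitive_on a b F f"
  shows "continuous_on {a..b} F"
proof -
  have "continuous_on {a..b} (\<lambda>z. F a + integral {a..z} f)"
    by (intro continuous_intros indefinite_integral_continuous_1 primitive_on_integrable[OF assms])
  then show ?thesis
    by (rule continuous_on_eq) (rule primitive_on_eval[OF assms, symmetric])
qed

lemma primitive_on_diff_eq:
  assumes "primitive_on a b F f" "a \<le> x" "x \<le> y" "y \<le> b"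
  shows "F y - F x = integral {x..y} f"
proof -
  have "f integrable_on {a..y}"
    by (rule integrable_subinterval_real[OF primitive_on_integrable[OF assms(1)]]) (use assms in auto)
  from Henstock_Kurzweil_Integration.integral_combine[OF assms(2,3) this]
  have "integral {a..x} f + integral {x..y} f = integral {a..y} f" .
  moreover have "integral {a..x} f = F x - F a" "integral {a..y} f = F y - F a"
    using assms by (auto simp: primitive_on_def intro!: integral_unique)
  ultimately show ?thesis by (simp add: algebra_simps)
qed

lemma absolutely_integrable_imp_integrable_subinterval:
  fixes f :: "real \<Rightarrow> 'a::euclidean_space"
  assumes "f absolutely_integrable_on {a..b}" "a \<le> x" "y \<le> b"
  shows "f integrable_on {x..y}"
  by (rule integrable_subinterval_real[of f a b])
     (use assms in \<open>auto simp: absolutely_integrable_on_def\<close>)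

lemma absolutely_integrable_bounded_bilinear:
  fixes p :: "'a::euclidean_space \<Rightarrow> 'b::euclidean_space \<Rightarrow> 'c::euclidean_space"
  assumes "bounded_bilinear p" and F: "continuous_on {a..b} F" and g: "g absolutely_integrable_on {a..b}"
  shows "(\<lambda>z. p (F z) (g z)) absolutely_integrable_on {a..b::real}"
proof (rule absolutely_integrable_bounded_measurable_product[where h=p and f=F and g=g])
  show "bilinear p"
    using assms(1) bilinear_conv_bounded_bilinear by blast
  show "F \<in> borel_measurable (lebesgue_on {a..b})"
    by (rule continuous_imp_measurable_on_sets_lebesgue[OF F]) auto
  show "bounded (F ` {a..b})"
    by (intro compact_imp_bounded compact_continuous_image F) auto
qed (use g in auto)

text \<open>Halving the interval reduces an additive estimate to short intervals.\<close>

text \<open>Both sides are additive under concatenation of intervals, so bisection reduces the estimate to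
  intervals shorter than \<open>\<delta>\<close>.\<close>

lemma additive_bound_from_short_intervals:
  fixes D :: "real \<Rightarrow> 'a::real_normed_vector" and \<nu> :: "real \<Rightarrow> real"
  assumes "\<delta> > 0"
    and short: "\<And>x y. a \<le> x \<Longrightarrow> x \<le> y \<Longrightarrow> y \<le> b \<Longrightarrow> y - x < \<delta> \<Longrightarrow> norm (D y - D x) \<le> \<nu> y - \<nu> x"
    and "a \<le> x" "x \<le> y" "y \<le> b"
  shows "norm (D y - D x) \<le> \<nu> y - \<nu> x"
proof -
  have step: "\<forall>x y. a \<le> x \<longrightarrow> x \<le> y \<longrightarrow> y \<le> b \<longrightarrow> y - x < 2 ^ n * \<delta> \<longrightarrow>
      norm (D y - D x) \<le> \<nu> y - \<nu> x" for n :: nat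
  proof (induction n)
    case 0
    then show ?case using short by auto
  next
    case (Suc n)
    show ?case
    proof (intro allI impI)
      fix x y assume xy: "a \<le> x" "x \<le> y" "y \<le> b" "y - x < 2 ^ Suc n * \<delta>"
      define m where "m = (x + y) / 2"
      have m: "x \<le> m" "m \<le> y" "m - x < 2 ^ n * \<delta>" "y - m < 2 ^ n * \<delta>"
        using xy by (auto simp: m_def field_simps)
      have "norm (D m - D x) \<le> \<nu> m - \<nu> x"
        using Suc.IH xy m by auto
      moreover have "norm (D y - D m) \<le> \<nu> y - \<nu> m"
        using Suc.IH xy m by auto
      moreover have "norm (D y - D x) \<le> norm (D m - D x) + norm (D y - D m)"
        by norm
      ultimately show "norm (D y - D x) \<le> \<nu> y - \<nu> x" by linarith
    qed
  qed
  obtain n :: nat where "(y - x) / \<delta> < 2 ^ n"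
    using real_arch_pow[of 2] by auto
  then have "y - x < 2 ^ n * \<delta>"
    using assms(1) by (simp add: field_simps)
  then show ?thesis using step assms by blast
qed

text \<open>Integration by parts for absolutely continuous functions. The difference \<open>D\<close> between the product and the
  primitive of the candidate density has increments bounded by \<open>\<epsilon>\<close> times the integral of the norms of the
  densities on short intervals, by uniform continuity of the two factors; hence \<open>D\<close> is constant.\<close>

lemma primitive_on_product_rule:
  fixes p :: "'a::euclidean_space \<Rightarrow> 'b::euclidean_space \<Rightarrow> 'c::euclidean_space"
  assumes p: "bounded_bilinear p" and F: "primitive_on a b F f" and H: "primitive_on a b H h"
  shows "primitive_on a b (\<lambda>z. p (F z) (H z)) (\<lambda>z. p (f z) (H z) + p (F z) (h z))"
proof -
  interpret p: bounded_bilinear p by fact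
  obtain K where K: "K > 0" "\<And>x y. norm (p x y) \<le> norm x * norm y * K"
    using p.pos_bounded by blast
  define W where "W = (\<lambda>z. p (f z) (H z) + p (F z) (h z))"
  have cF: "continuous_on {a..b} F" and cH: "continuous_on {a..b} H"
    using primitive_on_continuous F H by blast+
  have f: "f absolutely_integrable_on {a..b}" and h: "h absolutely_integrable_on {a..b}"
    using F H by (auto simp: primitive_on_def)
  have aW: "W absolutely_integrable_on {a..b}"
    unfolding W_def
    by (intro set_integral_add absolutely_integrable_bounded_bilinear[OF p] h cF
        absolutely_integrable_bounded_bilinear[OF bounded_bilinear.flip[OF p]] f cH)
  have iW: "W integrable_on {x..y}" if "a \<le> x" "y \<le> b" for x y
    using absolutely_integrable_imp_integrable_subinterval[OF aW that] .
  define n where "n = (\<lambda>z. norm (f z) + norm (h z))"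
  have "n integrable_on {a..b}"
    unfolding n_def using f h by (intro integrable_add) (auto simp: absolutely_integrable_on_def)
  then have inn: "n integrable_on {x..y}" if "a \<le> x" "y \<le> b" for x y
    by (rule integrable_subinterval_real) (use that in auto)
  define D where "D = (\<lambda>z. p (F z) (H z) - integral {a..z} W)"
  have D_eq: "D z = D a" if z: "z \<in> {a..b}" for z
  proof -
    have "norm (D z - D a) \<le> \<epsilon> * integral {a..z} n" if "\<epsilon> > 0" for \<epsilon>
    proof -
      have "uniformly_continuous_on {a..b} F" "uniformly_continuous_on {a..b} H"
        using cF cH compact_uniformly_continuous by auto
      moreover have "\<epsilon> / K > 0" using that K(1) by simp
      ultimately obtain \<delta>1 \<delta>2 where d: "\<delta>1 > 0" "\<delta>2 > 0"
        and d1: "\<And>x y. x \<in> {a..b} \<Longrightarrow> y \<in> {a..b} \<Longrightarrow> dist y x < \<delta>1 \<Longrightarrow> dist (F y) (F x) < \<epsilon> / K"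
        and d2: "\<And>x y. x \<in> {a..b} \<Longrightarrow> y \<in> {a..b} \<Longrightarrow> dist y x < \<delta>2 \<Longrightarrow> dist (H y) (H x) < \<epsilon> / K"
        unfolding uniformly_continuous_on_def by metis
      have "norm (D z - D a) \<le> \<epsilon> * integral {a..z} n - \<epsilon> * integral {a..a} n"
      proof (rule additive_bound_from_short_intervals[of "min \<delta>1 \<delta>2" a b])
        fix x y assume xy: "a \<le> x" "x \<le> y" "y \<le> b" "y - x < min \<delta>1 \<delta>2"
        have ifx: "f integrable_on {x..y}" "h integrable_on {x..y}"
          using absolutely_integrable_imp_integrable_subinterval f h xy by blast+
        have 1: "((\<lambda>t. p (f t) (H y)) has_integral p (F y - F x) (H y)) {x..y}"
          using has_integral_linear[OF integrable_integral[OF ifx(1)] p.bounded_linear_left[of "H y"]]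
            primitive_on_diff_eq[OF F xy(1-3)] by (simp add: o_def)
        have 2: "((\<lambda>t. p (F x) (h t)) has_integral p (F x) (H y - H x)) {x..y}"
          using has_integral_linear[OF integrable_integral[OF ifx(2)] p.bounded_linear_right[of "F x"]]
            primitive_on_diff_eq[OF H xy(1-3)] by (simp add: o_def)
        have ic: "integral {a..y} W = integral {a..x} W + integral {x..y} W"
          "integral {a..y} n = integral {a..x} n + integral {x..y} n"
            by (rule Henstock_Kurzweil_Integration.integral_combine[symmetric]; use xy iW[of a y] inn[of a y] in simp)+
        have "((\<lambda>t. p (f t) (H y) + p (F x) (h t) - W t) has_integral
             p (F y - F x) (H y) + p (F x) (H y - H x) - integral {x..y} W) {x..y}"
          by (intro has_integral_diff has_integral_add 1 2 integrable_integral iW xy)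
        moreover have "p (F y - F x) (H y) + p (F x) (H y - H x) - integral {x..y} W = D y - D x"
          unfolding D_def ic by (simp add: p.diff_left p.diff_right)
        ultimately have 3: "((\<lambda>t. p (f t) (H y) + p (F x) (h t) - W t) has_integral D y - D x) {x..y}"
          by simp
        have "norm (integral {x..y} (\<lambda>t. p (f t) (H y) + p (F x) (h t) - W t)) \<le> integral {x..y} (\<lambda>t. \<epsilon> * n t)"
        proof (rule integral_norm_bound_integral)
          show "(\<lambda>t. p (f t) (H y) + p (F x) (h t) - W t) integrable_on {x..y}"
            using 3 by blast
          show "(\<lambda>t. \<epsilon> * n t) integrable_on {x..y}"
            using inn[of x y] xy by (simp add: integrable_on_mult_right)
          fix t assume t: "t \<in> {x..y}"
          have "p (f t) (H y) + p (F x) (h t) - W t = p (f t) (H y - H t) + p (F x - F t) (h t)"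
            unfolding W_def by (simp add: p.diff_left p.diff_right)
          also have "norm \<dots> \<le> norm (f t) * norm (H y - H t) * K + norm (F x - F t) * norm (h t) * K"
            by (rule norm_triangle_mono[OF K(2) K(2)])
          also have "\<dots> \<le> norm (f t) * (\<epsilon> / K) * K + (\<epsilon> / K) * norm (h t) * K"
          proof (intro add_mono mult_right_mono mult_left_mono)
            show "norm (H y - H t) \<le> \<epsilon> / K"
              using d2[of t y] t xy by (auto simp: dist_norm)
            show "norm (F x - F t) \<le> \<epsilon> / K"
              using d1[of t x] t xy by (auto simp: dist_norm)
          qed (use K in auto)
          also have "\<dots> = \<epsilon> * n t"
            using K(1) by (simp add: n_def field_simps)
          finally show "norm (p (f t) (H y) + p (F x) (h t) - W t) \<le> \<epsilon> * n t" .
        qed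
        then show "norm (D y - D x) \<le> \<epsilon> * integral {a..y} n - \<epsilon> * integral {a..x} n"
          unfolding ic integral_unique[OF 3] by (simp add: algebra_simps)
      qed (use d z in auto)
      then show ?thesis by simp
    qed
    note * = this
    have I0: "integral {a..z} n \<ge> 0"
      by (rule Henstock_Kurzweil_Integration.integral_nonneg) (use inn z in \<open>auto simp: n_def\<close>)
    have "norm (D z - D a) \<le> 0 + e" if "e > 0" for e
    proof -
      have "norm (D z - D a) \<le> e / (integral {a..z} n + 1) * integral {a..z} n"
        by (rule *) (use that I0 in auto)
      also have "\<dots> \<le> e"
        using that I0 by (simp add: divide_simps mult_left_mono)
      finally show ?thesis by simp
    qed
    then have "norm (D z - D a) \<le> 0"
      by (rule field_le_epsilon)
    then show ?thesis by simp
  qed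
  show ?thesis
    unfolding primitive_on_def
  proof (intro conjI ballI)
    show "(\<lambda>z. p (f z) (H z) + p (F z) (h z)) absolutely_integrable_on {a..b}"
      using aW unfolding W_def .
    fix z assume "z \<in> {a..b}"
    then have D: "D z = D a" and "z \<le> b" by (auto intro: D_eq)
    have "(W has_integral integral {a..z} W) {a..z}"
      by (rule integrable_integral[OF iW[OF order_refl \<open>z \<le> b\<close>]])
    with D show "((\<lambda>z. p (f z) (H z) + p (F z) (h z)) has_integral p (F z) (H z) - p (F a) (H a)) {a..z}"
      unfolding D_def W_def by (simp add: algebra_simps)
  qed
qed

text \<open>By Lebesgue's differentiation theorem the difference of two densities of the same function is almost everywhere
  the limit of its averages over short intervals, which are all zero. This makes the arbitrary choice of the second
  derivative in \<open>dzz\<close> harmless.\<close>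

lemma primitive_on_unique_ae:
  fixes f g :: "real \<Rightarrow> 'a::euclidean_space"
  assumes f: "primitive_on a b F f" and g: "primitive_on a b F g"
  shows "negligible {z \<in> {a..b}. f z \<noteq> g z}"
proof -
  define k where "k = (\<lambda>z. if z \<in> {a..b} then f z - g z else 0)"
  have "(\<lambda>z. f z - g z) integrable_on {a..b}"
    using primitive_on_integrable[OF f] primitive_on_integrable[OF g] by (rule integrable_diff)
  then have kU: "k integrable_on UNIV"
    unfolding k_def by (subst integrable_restrict_UNIV)
  have ki: "k integrable_on cbox u v" for u v
    by (rule integrable_on_subcbox[OF kU]) simp
  have k0: "integral {u..v} k = 0" if "a \<le> u" "u \<le> v" "v \<le> b" for u v
  proof -
    have "integral {u..v} k = integral {u..v} (\<lambda>z. f z - g z)"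
      by (rule integral_cong) (use that in \<open>auto simp: k_def\<close>)
    also have "\<dots> = integral {u..v} f - integral {u..v} g"
      by (intro integral_diff integrable_subinterval_real[OF primitive_on_integrable[OF f]]
          integrable_subinterval_real[OF primitive_on_integrable[OF g]]) (use that in auto)
    also have "\<dots> = 0"
      using primitive_on_diff_eq[OF f that] primitive_on_diff_eq[OF g that] by simp
    finally show ?thesis .
  qed
  obtain N where N: "negligible N"
    "\<And>x e. \<lbrakk>x \<notin> N; 0 < e\<rbrakk> \<Longrightarrow> \<exists>d>0. \<forall>h. 0 < h \<and> h < d \<longrightarrow>
        norm (integral (cbox x (x + h *\<^sub>R One)) k /\<^sub>R h ^ DIM(real) - k x) < e"
    using integrable_ccontinuous_explicit[OF ki] by metis
  have "k x = 0" if x: "x \<in> {a..<b}" "x \<notin> N" for x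
  proof (rule ccontr)
    assume "k x \<noteq> 0"
    then obtain d where d: "d > 0" "\<And>h. 0 < h \<Longrightarrow> h < d \<Longrightarrow>
        norm (integral (cbox x (x + h *\<^sub>R One)) k /\<^sub>R h ^ DIM(real) - k x) < norm (k x)"
      using N(2)[of x "norm (k x)"] x by auto
    define h where "h = min (d / 2) (b - x)"
    have "0 < h" "h < d" "x + h \<le> b"
      using d(1) x by (auto simp: h_def)
    then show False
      using d(2)[of h] k0[of x "x + h"] x by auto
  qed
  then have "{z \<in> {a..b}. f z \<noteq> g z} \<subseteq> insert b N"
    unfolding k_def by fastforce
  then show ?thesis
    using N(1) negligible_insert negligible_subset by blast
qed

section \<open>Square-integrable functions\<close>

definition sq_integrable :: "real \<Rightarrow> real \<Rightarrow> (real \<Rightarrow> complex) \<Rightarrow> bool" where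
  "sq_integrable a b f \<longleftrightarrow> f absolutely_integrable_on {a..b} \<and> (\<lambda>z. (cmod (f z))\<^sup>2) integrable_on {a..b}"

text \<open>On a bounded interval a bound on the square suffices, as \<open>|f| \<le> 1 + |f|\<^sup>2\<close>.\<close>

lemma sq_integrableI_bound:
  assumes "f \<in> borel_measurable (lebesgue_on {a..b})" "g integrable_on {a..b}"
    and "\<And>z. z \<in> {a..b} \<Longrightarrow> (cmod (f z))\<^sup>2 \<le> g z"
  shows "sq_integrable a b f"
  unfolding sq_integrable_def
proof
  have m: "cmod (f z) \<le> 1 + g z" if "z \<in> {a..b}" for z
  proof -
    have "2 * cmod (f z) \<le> 1 + (cmod (f z))\<^sup>2"
      using sum_squares_bound[of 1 "cmod (f z)"] by simp
    then show ?thesis using assms(3)[OF that] norm_ge_zero[of "f z"] by linarith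
  qed
  show "f absolutely_integrable_on {a..b}"
    by (rule measurable_bounded_by_integrable_imp_absolutely_integrable[OF assms(1) _ _ m])
       (auto intro!: integrable_add assms)
  show "(\<lambda>z. (cmod (f z))\<^sup>2) integrable_on {a..b}"
    by (rule measurable_bounded_by_integrable_imp_integrable[OF _ assms(2)])
       (use assms in \<open>auto intro!: borel_measurable_power borel_measurable_norm\<close>)
qed

lemma sq_integrable_measurable:
  "sq_integrable a b f \<Longrightarrow> f \<in> borel_measurable (lebesgue_on {a..b})"
  by (auto simp: sq_integrable_def intro: absolutely_integrable_imp_borel_measurable)

lemma sq_integrable_continuous:
  assumes "continuous_on {a..b} f"
  shows "sq_integrable a b f"
  unfolding sq_integrable_def
  by (intro conjI absolutely_integrable_continuous_real integrable_continuous_real continuous_intros assms)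

lemma sq_integrable_0 [simp]: "sq_integrable a b (\<lambda>z. 0)"
  by (intro sq_integrable_continuous continuous_intros)

lemma sq_integrable_add:
  assumes "sq_integrable a b f" "sq_integrable a b g"
  shows "sq_integrable a b (\<lambda>z. f z + g z)"
proof (rule sq_integrableI_bound)
  show "(\<lambda>z. f z + g z) \<in> borel_measurable (lebesgue_on {a..b})"
    by (intro borel_measurable_add sq_integrable_measurable assms)
  show "(\<lambda>z. 2 * (cmod (f z))\<^sup>2 + 2 * (cmod (g z))\<^sup>2) integrable_on {a..b}"
    using assms by (auto simp: sq_integrable_def intro!: integrable_add integrable_on_mult_right)
  fix z
  have "(cmod (f z + g z))\<^sup>2 \<le> (cmod (f z) + cmod (g z))\<^sup>2"
    by (simp add: norm_triangle_ineq power_mono)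
  also have "\<dots> \<le> 2 * (cmod (f z))\<^sup>2 + 2 * (cmod (g z))\<^sup>2"
    using sum_squares_bound[of "cmod (f z)" "cmod (g z)"] by (simp add: power2_sum)
  finally show "(cmod (f z + g z))\<^sup>2 \<le> 2 * (cmod (f z))\<^sup>2 + 2 * (cmod (g z))\<^sup>2" .
qed

lemma sq_integrable_mult_continuous:
  assumes c: "continuous_on {a..b} c" and f: "sq_integrable a b f"
  shows "sq_integrable a b (\<lambda>z. c z * f z)"
proof -
  have "bounded (c ` {a..b})"
    by (intro compact_imp_bounded compact_continuous_image c) auto
  then obtain B where B: "\<And>z. z \<in> {a..b} \<Longrightarrow> cmod (c z) \<le> B"
    by (metis bounded_iff imageI)
  show ?thesis
  proof (rule sq_integrableI_bound)
    show "(\<lambda>z. c z * f z) \<in> borel_measurable (lebesgue_on {a..b})"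
      by (intro borel_measurable_times sq_integrable_measurable f
          continuous_imp_measurable_on_sets_lebesgue[OF c]) auto
    show "(\<lambda>z. B\<^sup>2 * (cmod (f z))\<^sup>2) integrable_on {a..b}"
      using f by (auto simp: sq_integrable_def intro!: integrable_on_mult_right)
    show "(cmod (c z * f z))\<^sup>2 \<le> B\<^sup>2 * (cmod (f z))\<^sup>2" if "z \<in> {a..b}" for z
      unfolding norm_mult power_mult_distrib by (intro mult_right_mono power_mono B that) auto
  qed
qed

lemma sq_integrable_sum:
  assumes "finite I" "\<And>i. i \<in> I \<Longrightarrow> sq_integrable a b (f i)"
  shows "sq_integrable a b (\<lambda>z. \<Sum>i\<in>I. f i z)"
  using assms by (induction) (auto intro: sq_integrable_add)

lemma sq_integrable_minus:
  assumes "sq_integrable a b f"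
  shows "sq_integrable a b (\<lambda>z. - f z)"
  using sq_integrable_mult_continuous[OF continuous_on_const assms, of "-1"] by simp

lemma sq_integrable_diff:
  assumes "sq_integrable a b f" "sq_integrable a b g"
  shows "sq_integrable a b (\<lambda>z. f z - g z)"
  using sq_integrable_add[OF assms(1) sq_integrable_minus[OF assms(2)]] by simp

lemma sq_integrable_bilinear:
  fixes p :: "complex \<Rightarrow> complex \<Rightarrow> 'c::euclidean_space"
  assumes p: "bounded_bilinear p" and "sq_integrable a b f" "sq_integrable a b g"
  shows "(\<lambda>z. p (f z) (g z)) absolutely_integrable_on {a..b}"
proof -
  interpret p: bounded_bilinear p by fact
  obtain K where K: "K > 0" "\<And>x y. norm (p x y) \<le> norm x * norm y * K"
    using p.pos_bounded by blast
  show ?thesis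
  proof (rule measurable_bounded_by_integrable_imp_absolutely_integrable[where g = "\<lambda>z. K * ((cmod (f z))\<^sup>2 + (cmod (g z))\<^sup>2)"])
    show "(\<lambda>z. p (f z) (g z)) \<in> borel_measurable (lebesgue_on {a..b})"
      by (rule borel_measurable_bilinear)
         (use p assms in \<open>auto simp: bilinear_conv_bounded_bilinear intro: sq_integrable_measurable\<close>)
    show "(\<lambda>z. K * ((cmod (f z))\<^sup>2 + (cmod (g z))\<^sup>2)) integrable_on {a..b}"
      using assms by (intro integrable_on_mult_right integrable_add) (auto simp: sq_integrable_def)
    fix z
    have "norm (p (f z) (g z)) \<le> cmod (f z) * cmod (g z) * K" by (rule K)
    also have "\<dots> \<le> ((cmod (f z))\<^sup>2 + (cmod (g z))\<^sup>2) * K"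
    proof (rule mult_right_mono)
      have "2 * cmod (f z) * cmod (g z) \<le> (cmod (f z))\<^sup>2 + (cmod (g z))\<^sup>2"
        by (rule sum_squares_bound)
      moreover have "0 \<le> cmod (f z) * cmod (g z)" by simp
      ultimately show "cmod (f z) * cmod (g z) \<le> (cmod (f z))\<^sup>2 + (cmod (g z))\<^sup>2" by linarith
    qed (use K in auto)
    finally show "norm (p (f z) (g z)) \<le> K * ((cmod (f z))\<^sup>2 + (cmod (g z))\<^sup>2)"
      by (simp add: mult.commute)
  qed auto
qed

lemma sq_integrable_inner:
  assumes "sq_integrable a b f" "sq_integrable a b g"
  shows "(\<lambda>z. inner (f z) (g z)) absolutely_integrable_on {a..b}"
  by (rule sq_integrable_bilinear[OF bounded_bilinear_inner assms])

lemma weighted_integrable: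
  fixes f :: "real \<Rightarrow> real"
  assumes "f absolutely_integrable_on {a..b}" "continuous_on {a..b} \<mu>"
  shows "(\<lambda>z. f z * \<mu> z) integrable_on {a..b}"
  using absolutely_integrable_bounded_bilinear[OF bounded_bilinear_mult assms(2,1)]
  by (simp add: absolutely_integrable_on_def mult.commute)

lemma sq_integrable_weighted_square:
  assumes "sq_integrable a b f" "continuous_on {a..b} \<mu>"
  shows "(\<lambda>z. (cmod (f z))\<^sup>2 * \<mu> z) integrable_on {a..b}"
  by (intro weighted_integrable assms nonnegative_absolutely_integrable_1)
     (use assms(1) in \<open>auto simp: sq_integrable_def\<close>)

lemma sq_integrable_weighted_inner:
  assumes "sq_integrable a b f" "sq_integrable a b g" "continuous_on {a..b} \<mu>"
  shows "(\<lambda>z. 2 * inner (f z) (g z) * \<mu> z) integrable_on {a..b}"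
  using integrable_on_mult_right[OF weighted_integrable[OF sq_integrable_inner[OF assms(1,2)] assms(3)], of 2]
  by (simp add: mult.assoc)

lemma sq_integrable_spike:
  assumes "sq_integrable a b f" "negligible {z \<in> {a..b}. g z \<noteq> f z}"
  shows "sq_integrable a b g"
  unfolding sq_integrable_def
proof
  show "g absolutely_integrable_on {a..b}"
    by (rule absolutely_integrable_spike[OF _ assms(2), where f=f]) (use assms(1) in \<open>auto simp: sq_integrable_def\<close>)
  show "(\<lambda>z. (cmod (g z))\<^sup>2) integrable_on {a..b}"
    by (rule integrable_spike[OF _ assms(2), of "\<lambda>z. (cmod (f z))\<^sup>2"]) (use assms(1) in \<open>auto simp: sq_integrable_def\<close>)
qed

section \<open>The space of twice differentiable functions of the continuous variable\<close>

lemma has_ac_deriv_iff_primitive_on: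
  assumes "b > 0"
  shows "has_ac_deriv b f g \<longleftrightarrow> primitive_on (-b) b f g"
proof
  assume h: "has_ac_deriv b f g"
  then have g: "g absolutely_integrable_on {-b..b}" by (simp add: has_ac_deriv_def)
  show "primitive_on (-b) b f g"
    unfolding primitive_on_def
  proof (intro conjI ballI g)
    fix z assume z: "z \<in> {-b..b}"
    then have "f z - f (-b) = integral {-b..z} g"
      using h unfolding has_ac_deriv_def by (metis add_diff_cancel_left')
    then show "(g has_integral f z - f (- b)) {- b..z}"
      using absolutely_integrable_imp_integrable_subinterval[OF g, of "-b" z] z
      by (simp add: integrable_integral)
  qed
next
  assume "primitive_on (-b) b f g"
  then show "has_ac_deriv b f g"
    unfolding has_ac_deriv_def using primitive_on_eval primitive_on_absolutely_integrable by blast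
qed

text \<open>Membership guarantees that a density of the first derivative exists, so the choice made by \<open>dzz\<close> is one.\<close>

lemma H2_interval_primitive_dzz:
  assumes "b > 0" "H2_interval b f"
  shows "primitive_on (-b) b (dz b f) (dzz b f)"
proof -
  have "has_ac_deriv b (dz b f) (dzz b f)"
    using assms(2) unfolding H2_interval_def dzz_def by (metis someI_ex)
  then show ?thesis using has_ac_deriv_iff_primitive_on[OF assms(1)] by blast
qed

lemma H2_interval_sq_integrable_dzz:
  assumes "b > 0" "H2_interval b f"
  shows "sq_integrable (-b) b (dzz b f)"
  using primitive_on_absolutely_integrable[OF H2_interval_primitive_dzz[OF assms]] assms(2)
  by (simp add: sq_integrable_def H2_interval_def)

lemma H2_interval_continuous_dz:
  assumes "b > 0" "H2_interval b f"
  shows "continuous_on {-b..b} (dz b f)"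
  by (rule primitive_on_continuous[OF H2_interval_primitive_dzz[OF assms]])

lemma H2_interval_primitive_dz:
  assumes "b > 0" "H2_interval b f"
  shows "primitive_on (-b) b f (dz b f)"
  unfolding primitive_on_def
proof (intro conjI ballI)
  show "dz b f absolutely_integrable_on {-b..b}"
    by (intro absolutely_integrable_continuous_real H2_interval_continuous_dz assms)
  fix z assume z: "z \<in> {-b..b}"
  show "(dz b f has_integral f z - f (- b)) {- b..z}"
  proof (rule fundamental_theorem_of_calculus)
    fix x assume x: "x \<in> {-b..z}"
    have "f differentiable (at x within {-b..b})"
      using assms x z by (auto simp: H2_interval_def)
    then have "(f has_vector_derivative dz b f x) (at x within {-b..b})"
      unfolding dz_def by (simp add: vector_derivative_works)
    then show "(f has_vector_derivative dz b f x) (at x within {-b..z})"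
      by (rule has_vector_derivative_within_subset) (use z in auto)
  qed (use z in auto)
qed

lemma H2_interval_continuous:
  assumes "b > 0" "H2_interval b f"
  shows "continuous_on {-b..b} f"
  by (rule primitive_on_continuous[OF H2_interval_primitive_dz[OF assms]])

lemma primitive_on_has_vector_derivative:
  fixes f :: "real \<Rightarrow> 'a::euclidean_space"
  assumes f: "primitive_on a b f v" and v: "continuous_on {a..b} v" and z: "z \<in> {a..b}"
  shows "(f has_vector_derivative v z) (at z within {a..b})"
proof -
  have "((\<lambda>u. integral {a..u} v) has_vector_derivative v z) (at z within {a..b})"
    by (rule integral_has_vector_derivative[OF v z])
  then have "((\<lambda>u. f a + integral {a..u} v) has_vector_derivative 0 + v z) (at z within {a..b})"
    by (intro has_vector_derivative_add has_vector_derivative_const)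
  then show ?thesis
    using has_vector_derivative_transform[OF z, of f "\<lambda>u. f a + integral {a..u} v"] primitive_on_eval[OF f]
    by (metis add.left_neutral)
qed

text \<open>The converse of the two primitive properties above: it recognises members of the space and computes their
  derivatives, the second one up to a null set.\<close>

lemma H2_intervalI:
  assumes b: "b > 0" and f: "primitive_on (-b) b f v" and v: "primitive_on (-b) b v s"
    and s: "sq_integrable (-b) b s"
  shows "H2_interval b f" "\<And>z. z \<in> {-b..b} \<Longrightarrow> dz b f z = v z"
    "negligible {z \<in> {-b..b}. dzz b f z \<noteq> s z}"
proof -
  have cv: "continuous_on {-b..b} v" by (rule primitive_on_continuous[OF v])
  have vd: "(f has_vector_derivative v z) (at z within {-b..b})" if "z \<in> {-b..b}" for z
    by (rule primitive_on_has_vector_derivative[OF f cv that])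
  show dz: "dz b f z = v z" if "z \<in> {-b..b}" for z
    unfolding dz_def
    by (rule vector_derivative_within_closed_interval[OF _ that vd[OF that]]) (use b in auto)
  have pz: "primitive_on (-b) b (dz b f) s"
    unfolding primitive_on_def
  proof (intro conjI ballI primitive_on_absolutely_integrable[OF v])
    fix z assume z: "z \<in> {-b..b}"
    have "-b \<in> {-b..b}" using b by simp
    show "(s has_integral dz b f z - dz b f (- b)) {- b..z}"
      unfolding dz[OF z] dz[OF \<open>-b \<in> {-b..b}\<close>] using v z unfolding primitive_on_def by blast
  qed
  have ex: "\<exists>g. has_ac_deriv b (dz b f) g"
    using has_ac_deriv_iff_primitive_on[OF b, THEN iffD2, OF pz] by blast
  then have pzz: "primitive_on (-b) b (dz b f) (dzz b f)"
    unfolding dzz_def by (rule has_ac_deriv_iff_primitive_on[OF b, THEN iffD1, OF someI_ex])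
  show ae: "negligible {z \<in> {-b..b}. dzz b f z \<noteq> s z}"
    by (rule primitive_on_unique_ae[OF pzz pz])
  have "sq_integrable (-b) b (dzz b f)"
    by (rule sq_integrable_spike[OF s ae])
  moreover have "\<forall>z\<in>{-b..b}. f differentiable (at z within {-b..b})"
    using vd differentiableI_vector by blast
  ultimately show "H2_interval b f"
    using ex by (simp add: H2_interval_def sq_integrable_def)
qed

abbreviation sq_int :: "real \<Rightarrow> (real \<Rightarrow> complex) \<Rightarrow> real" where
  "sq_int b f \<equiv> integral {-b..b} (\<lambda>z. (cmod (f z))\<^sup>2)"

abbreviation weighted_sq :: "real \<Rightarrow> (real \<Rightarrow> real) \<Rightarrow> (real \<Rightarrow> complex) \<Rightarrow> real" where
  "weighted_sq b \<mu> f \<equiv> integral {-b..b} (\<lambda>z. (cmod (f z))\<^sup>2 * \<mu> z)"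

lemmas integral_ge_0 = Henstock_Kurzweil_Integration.integral_nonneg

lemma primitive_on_add:
  assumes "primitive_on a b F f" "primitive_on a b G g"
  shows "primitive_on a b (\<lambda>z. F z + G z) (\<lambda>z. f z + g z)"
  unfolding primitive_on_def
proof (intro conjI ballI)
  show "(\<lambda>z. f z + g z) absolutely_integrable_on {a..b}"
    by (intro set_integral_add primitive_on_absolutely_integrable[OF assms(1)]
        primitive_on_absolutely_integrable[OF assms(2)])
  fix z assume "z \<in> {a..b}"
  then have "((\<lambda>z. f z + g z) has_integral (F z - F a) + (G z - G a)) {a..z}"
    using assms by (intro has_integral_add) (auto simp: primitive_on_def)
  then show "((\<lambda>z. f z + g z) has_integral F z + G z - (F a + G a)) {a..z}"
    by (simp add: algebra_simps)
qed

lemma primitive_on_linear: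
  fixes T :: "'a::euclidean_space \<Rightarrow> 'b::euclidean_space"
  assumes "primitive_on a b F f" and T: "bounded_linear T"
  shows "primitive_on a b (\<lambda>z. T (F z)) (\<lambda>z. T (f z))"
  unfolding primitive_on_def
proof (intro conjI ballI)
  show "(\<lambda>z. T (f z)) absolutely_integrable_on {a..b}"
    using absolutely_integrable_linear[OF primitive_on_absolutely_integrable[OF assms(1)] T]
    by (simp add: o_def)
  fix z assume "z \<in> {a..b}"
  then have "((T \<circ> f) has_integral T (F z - F a)) {a..z}"
    using assms by (intro has_integral_linear) (auto simp: primitive_on_def)
  then show "((\<lambda>z. T (f z)) has_integral T (F z) - T (F a)) {a..z}"
    by (simp add: o_def linear_simps[OF T])
qed

lemma primitive_on_cmult:
  fixes F f :: "real \<Rightarrow> complex"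
  assumes "primitive_on a b F f"
  shows "primitive_on a b (\<lambda>z. c * F z) (\<lambda>z. c * f z)"
  by (rule primitive_on_linear[OF assms bounded_linear_mult_right])

lemma primitive_on_const: "primitive_on a b (\<lambda>z. c) (\<lambda>z. 0)"
  by (simp add: primitive_on_def)

lemma H2_interval_add:
  assumes b: "b > 0" and f: "H2_interval b f" and g: "H2_interval b g"
  shows "H2_interval b (\<lambda>z. f z + g z)"
    "\<And>z. z \<in> {-b..b} \<Longrightarrow> dz b (\<lambda>z. f z + g z) z = dz b f z + dz b g z"
    "negligible {z \<in> {-b..b}. dzz b (\<lambda>z. f z + g z) z \<noteq> dzz b f z + dzz b g z}"
  by (rule H2_intervalI[OF b primitive_on_add primitive_on_add sq_integrable_add];
      (rule H2_interval_primitive_dz H2_interval_primitive_dzz H2_interval_sq_integrable_dzz; rule b f g | assumption))+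

lemma H2_interval_cmult:
  assumes b: "b > 0" and f: "H2_interval b f"
  shows "H2_interval b (\<lambda>z. c * f z)"
    "\<And>z. z \<in> {-b..b} \<Longrightarrow> dz b (\<lambda>z. c * f z) z = c * dz b f z"
    "negligible {z \<in> {-b..b}. dzz b (\<lambda>z. c * f z) z \<noteq> c * dzz b f z}"
  by (rule H2_intervalI[OF b primitive_on_cmult[OF H2_interval_primitive_dz[OF b f]]
      primitive_on_cmult[OF H2_interval_primitive_dzz[OF b f]]
      sq_integrable_mult_continuous[OF continuous_on_const H2_interval_sq_integrable_dzz[OF b f]]]; assumption)+

lemma primitive_on_norm_square:
  fixes F f :: "real \<Rightarrow> complex"
  assumes "primitive_on a b F f"
  shows "primitive_on a b (\<lambda>z. (cmod (F z))\<^sup>2) (\<lambda>z. 2 * inner (f z) (F z))"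
proof -
  have "primitive_on a b (\<lambda>z. inner (F z) (F z)) (\<lambda>z. inner (f z) (F z) + inner (F z) (f z))"
    by (rule primitive_on_product_rule[OF bounded_bilinear_inner assms assms])
  moreover have "inner (f z) (F z) + inner (F z) (f z) = 2 * inner (f z) (F z)" for z
    using inner_commute[of "F z" "f z"] by simp
  ultimately show ?thesis
    by (simp add: power2_norm_eq_inner)
qed

lemma two_inner_le_weighted:
  fixes x y :: "'a::real_inner"
  assumes "c > 0"
  shows "2 * inner x y \<le> (norm x)\<^sup>2 / c + c * (norm y)\<^sup>2"
proof -
  have "2 * inner x y \<le> 2 * (norm x * norm y)"
    using Cauchy_Schwarz_ineq2[of x y] by simp
  also have "\<dots> = 2 * (norm x / sqrt c) * (sqrt c * norm y)"
    using assms by simp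
  also have "\<dots> \<le> (norm x / sqrt c)\<^sup>2 + (sqrt c * norm y)\<^sup>2"
    by (rule sum_squares_bound)
  also have "\<dots> = (norm x)\<^sup>2 / c + c * (norm y)\<^sup>2"
    using assms by (simp add: power_divide power_mult_distrib)
  finally show ?thesis .
qed

text \<open>By the product rule \<open>|F|\<^sup>2\<close> varies on the interval by at most \<open>\<integral> (|F|\<^sup>2 + |f|\<^sup>2)\<close>; averaging the resulting lower bound for
  \<open>|F|\<^sup>2\<close> over the interval bounds its value at any point.\<close>

lemma sobolev_sup_bound:
  assumes ab: "a < b" and F: "primitive_on a b F f" and f: "sq_integrable a b f" and z: "z \<in> {a..b}"
  shows "(cmod (F z))\<^sup>2 \<le> (1 + 1 / (b - a)) * integral {a..b} (\<lambda>z. (cmod (F z))\<^sup>2 + (cmod (f z))\<^sup>2)"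
proof -
  define N where "N = (\<lambda>z. (cmod (F z))\<^sup>2)"
  define E where "E = (\<lambda>z. (cmod (F z))\<^sup>2 + (cmod (f z))\<^sup>2)"
  define S where "S = integral {a..b} E"
  have cF: "continuous_on {a..b} F" by (rule primitive_on_continuous[OF F])
  have iN: "N integrable_on {a..b}"
    unfolding N_def by (intro integrable_continuous_real continuous_intros cF)
  have iE: "E integrable_on {a..b}"
    unfolding E_def using iN f by (intro integrable_add) (auto simp: N_def sq_integrable_def)
  have pN: "primitive_on a b N (\<lambda>z. 2 * inner (f z) (F z))"
    unfolding N_def by (rule primitive_on_norm_square[OF F])
  have bd: "\<bar>N y - N x\<bar> \<le> S" if "a \<le> x" "x \<le> y" "y \<le> b" for x y
  proof -
    have "N y - N x = integral {x..y} (\<lambda>z. 2 * inner (f z) (F z))"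
      by (rule primitive_on_diff_eq[OF pN that])
    also have "norm \<dots> \<le> integral {x..y} E"
    proof (rule integral_norm_bound_integral)
      show "(\<lambda>z. 2 * inner (f z) (F z)) integrable_on {x..y}"
        by (rule absolutely_integrable_imp_integrable_subinterval[OF primitive_on_absolutely_integrable[OF pN]])
           (use that in auto)
      show "E integrable_on {x..y}"
        by (rule integrable_subinterval_real[OF iE]) (use that in auto)
      fix z
      show "norm (2 * inner (f z) (F z)) \<le> E z"
        using two_inner_le_weighted[of 1 "f z" "F z"] two_inner_le_weighted[of 1 "- f z" "F z"]
        by (simp add: E_def abs_le_iff)
    qed
    also have "\<dots> \<le> S"
      unfolding S_def
      by (rule integral_subset_le) (use that iE integrable_subinterval_real[OF iE, of x y] in \<open>auto simp: E_def\<close>)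
    finally show ?thesis by simp
  qed
  have le: "N z - S \<le> N y" if "y \<in> {a..b}" for y
    using bd[of y z] bd[of z y] that z by (cases "y \<le> z") (auto simp: abs_le_iff)
  have "integral {a..b} (\<lambda>y. N z - S) \<le> integral {a..b} N"
    by (rule integral_le) (use iN le in auto)
  then have 1: "(b - a) * (N z - S) \<le> integral {a..b} N"
    using ab by simp
  have 2: "integral {a..b} N \<le> S"
    unfolding S_def by (rule integral_le) (use iN iE in \<open>auto simp: N_def E_def\<close>)
  have "N z - S \<le> S / (b - a)"
    using 1 2 ab by (simp add: pos_le_divide_eq mult.commute)
  then have "N z \<le> (1 + 1 / (b - a)) * S"
    by (simp add: algebra_simps)
  then show ?thesis by (simp add: N_def S_def E_def)
qed

section \<open>A weighted estimate for first-order derivatives\<close>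

lemma carleman_weight_pos [simp]: "carleman_weight \<theta> lam z > 0"
  by (simp add: carleman_weight_def)

lemma continuous_on_carleman_weight: "continuous_on S (carleman_weight \<theta> lam)"
  unfolding carleman_weight_def by (intro continuous_intros)

lemma primitive_onI_C1:
  fixes F f :: "real \<Rightarrow> 'a::euclidean_space"
  assumes "\<And>z. z \<in> {a..b} \<Longrightarrow> (F has_vector_derivative f z) (at z within {a..b})"
    and "continuous_on {a..b} f"
  shows "primitive_on a b F f"
  unfolding primitive_on_def
proof (intro conjI ballI absolutely_integrable_continuous_real assms(2))
  fix z assume z: "z \<in> {a..b}"
  show "(f has_integral F z - F a) {a..z}"
    by (rule fundamental_theorem_of_calculus)
       (use z in \<open>auto intro: has_vector_derivative_within_subset[OF assms(1)]\<close>)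
qed

lemma carleman_weight_primitive:
  "primitive_on a b (carleman_weight \<theta> lam) (\<lambda>z. 4 * lam * (z - \<theta>) * carleman_weight \<theta> lam z)"
proof (rule primitive_onI_C1)
  show "continuous_on {a..b} (\<lambda>z. 4 * lam * (z - \<theta>) * carleman_weight \<theta> lam z)"
    by (intro continuous_intros continuous_on_carleman_weight)
  fix x
  have "(carleman_weight \<theta> lam has_real_derivative 4 * lam * (x - \<theta>) * carleman_weight \<theta> lam x) (at x within {a..b})"
    unfolding carleman_weight_def by (auto intro!: derivative_eq_intros simp: power2_eq_square)
  then show "(carleman_weight \<theta> lam has_vector_derivative 4 * lam * (x - \<theta>) * carleman_weight \<theta> lam x) (at x within {a..b})"
    by (simp add: has_real_derivative_iff_has_vector_derivative)
qed

text \<open>As \<open>\<theta>\<close> lies to the right of the interval, the weight is smallest at the right end point.\<close>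

lemma carleman_weight_lower_bound:
  assumes "lam > 0" "\<theta> > b" "z \<le> b"
  shows "exp (2 * lam * (b - \<theta>)\<^sup>2) \<le> carleman_weight \<theta> lam z"
proof -
  have "(b - \<theta>)\<^sup>2 \<le> (z - \<theta>)\<^sup>2"
    using assms by (simp add: abs_le_square_iff[symmetric])
  then show ?thesis using assms by (simp add: carleman_weight_def mult_left_mono)
qed

text \<open>The analytic core. Integrating the derivative of \<open>|W|\<^sup>2\<mu>\<close> from \<open>-b\<close>, where \<open>W\<close> vanishes, gives
  \<open>\<integral> (2\<langle>w, W\<rangle>\<mu> + |W|\<^sup>2\<mu>')\<close>. Since \<open>\<mu>' \<le> -4\<kappa>\<mu>\<close>, Young's inequality absorbs the first term into half of the second,
  and what remains controls both the supremum and the weighted integral of \<open>|W|\<^sup>2\<close>.\<close>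

lemma weighted_first_order_estimate:
  assumes b: "b > 0" and \<theta>: "\<theta> > b" and lam: "lam > 0"
    and W: "primitive_on (-b) b W w" and w: "sq_integrable (-b) b w" and W0: "W (-b) = 0"
  defines "\<mu> \<equiv> carleman_weight \<theta> lam" and "\<kappa> \<equiv> lam * (\<theta> - b)"
  shows "z \<in> {-b..b} \<Longrightarrow> (cmod (W z))\<^sup>2 * \<mu> z \<le> weighted_sq b \<mu> w / (2 * \<kappa>)"
    and "weighted_sq b \<mu> W \<le> weighted_sq b \<mu> w / (4 * \<kappa>\<^sup>2)"
proof -
  have \<kappa>: "\<kappa> > 0" using lam \<theta> by (simp add: \<kappa>_def)
  have c\<mu>: "continuous_on {-b..b} \<mu>" unfolding \<mu>_def by (rule continuous_on_carleman_weight)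
  have cW: "continuous_on {-b..b} W" by (rule primitive_on_continuous[OF W])
  define X where "X = (\<lambda>z. (cmod (W z))\<^sup>2 * \<mu> z)"
  define Y where "Y = (\<lambda>z. (cmod (w z))\<^sup>2 * \<mu> z)"
  have iX: "X integrable_on {-b..b}"
    unfolding X_def by (intro integrable_continuous_real continuous_intros cW c\<mu>)
  have "(\<lambda>z. \<mu> z * (cmod (w z))\<^sup>2) absolutely_integrable_on {-b..b}"
    by (rule absolutely_integrable_bounded_bilinear[OF bounded_bilinear_mult c\<mu> nonnegative_absolutely_integrable_1])
       (use w in \<open>auto simp: sq_integrable_def\<close>)
  then have iY: "Y integrable_on {-b..b}"
    unfolding Y_def by (simp add: absolutely_integrable_on_def mult.commute)
  define g where "g = (\<lambda>z. 2 * inner (w z) (W z) * \<mu> z + (cmod (W z))\<^sup>2 * (4 * lam * (z - \<theta>) * \<mu> z))"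
  have p: "primitive_on (-b) b X g"
    unfolding X_def g_def \<mu>_def
    by (rule primitive_on_product_rule[OF bounded_bilinear_mult primitive_on_norm_square[OF W] carleman_weight_primitive])
  have key: "X z + 2 * \<kappa> * integral {-b..z} X \<le> integral {-b..b} Y / (2 * \<kappa>)" if z: "z \<in> {-b..b}" for z
  proof -
    have iz: "X integrable_on {-b..z}" "Y integrable_on {-b..z}"
      using iX iY z by (auto elim!: integrable_subinterval_real)
    have "X z = integral {-b..z} g"
      using primitive_on_diff_eq[OF p, of "-b" z] z W0 by (simp add: X_def)
    also have "\<dots> \<le> integral {-b..z} (\<lambda>z. Y z / (2 * \<kappa>) - 2 * \<kappa> * X z)"
    proof (rule integral_le)
      show "g integrable_on {-b..z}"
        by (rule absolutely_integrable_imp_integrable_subinterval[OF primitive_on_absolutely_integrable[OF p]])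
           (use z in auto)
      show "(\<lambda>z. Y z / (2 * \<kappa>) - 2 * \<kappa> * X z) integrable_on {-b..z}"
        by (intro integrable_diff integrable_on_divide integrable_on_mult_right iz)
      fix x assume x: "x \<in> {-b..z}"
      have "lam * (\<theta> - b) \<le> lam * (\<theta> - x)"
        using x z lam by (intro mult_left_mono) auto
      then have "4 * lam * (x - \<theta>) \<le> - 4 * \<kappa>"
        by (simp add: \<kappa>_def algebra_simps)
      then have "(cmod (W x))\<^sup>2 * (4 * lam * (x - \<theta>) * \<mu> x) \<le> (cmod (W x))\<^sup>2 * (- 4 * \<kappa> * \<mu> x)"
        by (intro mult_left_mono mult_right_mono) (auto simp: \<mu>_def less_imp_le)
      moreover have "2 * inner (w x) (W x) * \<mu> x \<le> ((cmod (w x))\<^sup>2 / (2 * \<kappa>) + 2 * \<kappa> * (cmod (W x))\<^sup>2) * \<mu> x"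
        by (intro mult_right_mono two_inner_le_weighted) (use \<kappa> in \<open>auto simp: \<mu>_def less_imp_le\<close>)
      ultimately show "g x \<le> Y x / (2 * \<kappa>) - 2 * \<kappa> * X x"
        by (simp add: g_def X_def Y_def algebra_simps)
    qed
    also have "\<dots> = integral {-b..z} Y / (2 * \<kappa>) - 2 * \<kappa> * integral {-b..z} X"
      by (subst integral_diff) (auto intro!: integrable_on_divide integrable_on_mult_right iz)
    also have "integral {-b..z} Y / (2 * \<kappa>) \<le> integral {-b..b} Y / (2 * \<kappa>)"
      by (intro divide_right_mono integral_subset_le iz iY)
         (use z \<kappa> in \<open>auto simp: Y_def \<mu>_def less_imp_le\<close>)
    finally show ?thesis by simp
  qed
  have X0: "X z \<ge> 0" for z by (simp add: X_def \<mu>_def less_imp_le)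
  show "(cmod (W z))\<^sup>2 * \<mu> z \<le> weighted_sq b \<mu> w / (2 * \<kappa>)" if z: "z \<in> {-b..b}"
  proof -
    have "integral {-b..z} X \<ge> 0"
      by (rule integral_ge_0)
         (use X0 integrable_subinterval_real[OF iX, of "-b" z] z in auto)
    then have "0 \<le> 2 * \<kappa> * integral {-b..z} X" using \<kappa> by simp
    then have "X z \<le> integral {-b..b} Y / (2 * \<kappa>)" using key[OF z] by linarith
    then show ?thesis by (simp add: X_def Y_def)
  qed
  have "2 * \<kappa> * integral {-b..b} X \<le> integral {-b..b} Y / (2 * \<kappa>)"
    using key[of b] X0[of b] b by auto
  then show "weighted_sq b \<mu> W \<le> weighted_sq b \<mu> w / (4 * \<kappa>\<^sup>2)"
    using \<kappa> by (simp add: X_def Y_def field_simps power2_eq_square)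
qed

section \<open>Riesz representation for one grid node\<close>

lemma primitive_on_lincomb:
  fixes F G f g :: "real \<Rightarrow> complex"
  assumes "primitive_on a b F f" "primitive_on a b G g"
  shows "primitive_on a b (\<lambda>z. c * F z + d * G z) (\<lambda>z. c * f z + d * g z)"
  by (intro primitive_on_add primitive_on_cmult assms)

text \<open>Variation of constants: \<open>y\<close> is the exponential \<open>E\<close> times a primitive \<open>w\<close> of \<open>\<phi>\<close> divided by \<open>E\<close>. The inhomogeneity is only
  integrable, so the equation is meant in integrated form.\<close>

lemma linear_ode_solution:
  fixes \<phi> :: "real \<Rightarrow> complex"
  assumes \<phi>: "\<phi> absolutely_integrable_on {a..b}" and ab: "a \<le> b"
  shows "\<exists>y. y a = c \<and> primitive_on a b y (\<lambda>z. \<rho> * y z + \<phi> z)"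
proof -
  define E where "E = (\<lambda>z::real. exp (\<rho> * of_real (z - a)))"
  define E' where "E' = (\<lambda>z::real. exp (- \<rho> * of_real (z - a)))"
  define w where "w = (\<lambda>z. c + integral {a..z} (\<lambda>t. E' t * \<phi> t))"
  have E'0: "continuous_on {a..b} E'" unfolding E'_def by (intro continuous_intros)
  have int: "(\<lambda>t. E' t * \<phi> t) absolutely_integrable_on {a..b}"
    by (rule absolutely_integrable_bounded_bilinear[OF bounded_bilinear_mult E'0 \<phi>])
  have w: "primitive_on a b w (\<lambda>t. E' t * \<phi> t)"
    unfolding primitive_on_def
  proof (intro conjI ballI int)
    fix z assume "z \<in> {a..b}"
    then have "(\<lambda>t. E' t * \<phi> t) integrable_on {a..z}"
      by (intro absolutely_integrable_imp_integrable_subinterval[OF int]) auto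
    then show "((\<lambda>t. E' t * \<phi> t) has_integral w z - w a) {a..z}"
      by (simp add: w_def integrable_integral)
  qed
  have E: "primitive_on a b E (\<lambda>z. \<rho> * E z)"
  proof (rule primitive_onI_C1)
    show "continuous_on {a..b} (\<lambda>z. \<rho> * E z)" unfolding E_def by (intro continuous_intros)
    fix z
    have "((\<lambda>x. exp (\<rho> * (x - of_real a))) has_field_derivative \<rho> * exp (\<rho> * (of_real z - of_real a))) (at (of_real z))"
      by (auto intro!: derivative_eq_intros)
    from has_vector_derivative_real_field[OF this]
    show "(E has_vector_derivative \<rho> * E z) (at z within {a..b})"
      by (simp add: E_def)
  qed
  have "primitive_on a b (\<lambda>z. E z * w z) (\<lambda>z. \<rho> * E z * w z + E z * (E' z * \<phi> z))"
    by (rule primitive_on_product_rule[OF bounded_bilinear_mult E w])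
  moreover have "E z * E' z = 1" for z
    by (simp add: E_def E'_def flip: exp_add)
  then have "E z * (E' z * \<phi> z) = \<phi> z" for z
    by (metis mult.assoc mult_1)
  ultimately have "primitive_on a b (\<lambda>z. E z * w z) (\<lambda>z. \<rho> * (E z * w z) + \<phi> z)"
    by (simp only: mult.assoc)
  moreover have "E a * w a = c" by (simp add: E_def w_def)
  ultimately show ?thesis by (intro exI[of _ "\<lambda>z. E z * w z"] conjI)
qed

text \<open>First-order form of the Euler equation of
  \<open>\<integral> (\<langle>g, r\<rangle> + \<langle>g', r'\<rangle> + \<langle>g'', r''\<rangle>) = \<integral> (\<langle>F, r''\<rangle> + \<langle>B, r'\<rangle> + \<langle>C, r\<rangle>)\<close>:
  here \<open>v = g'\<close> and \<open>g'' = F - P\<close>, while \<open>P\<close> and \<open>Q\<close> arise from integrating the lower-order terms by parts. The functions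
  \<open>F\<close>, \<open>B\<close>, \<open>C\<close> may be merely integrable.\<close>

definition riesz_system where
  "riesz_system b F C B g v Q P \<longleftrightarrow> primitive_on (-b) b g v \<and> primitive_on (-b) b v (\<lambda>z. F z - P z)
     \<and> primitive_on (-b) b Q (\<lambda>z. C z - g z) \<and> primitive_on (-b) b P (\<lambda>z. B z - v z - (Q z :: complex))"

text \<open>The characteristic polynomial of the system is \<open>\<rho>\<^sup>4 - \<rho>\<^sup>2 + 1\<close>, with roots \<open>\<plusminus>w\<close> and \<open>\<plusminus>1/w\<close> for \<open>w = exp(\<i>\<pi>/6)\<close>, and an
  eigenvector for the root \<open>\<rho>\<close> is \<open>(g, v, Q, P) = (1, \<rho>, -1/\<rho>, -\<rho>\<^sup>2)\<close>. In the eigenbasis the system decouples into four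
  scalar equations; \<open>k1\<close> to \<open>k4\<close> are the coordinates of the vector \<open>(0, F, C, B)\<close>, and the same formulas give the coordinates of
  the initial vector \<open>(0, 0, q, p)\<close>.\<close>

lemma riesz_system_initial_value:
  fixes F B C :: "real \<Rightarrow> complex"
  assumes b: "b > 0" and F: "F absolutely_integrable_on {-b..b}" and C: "C absolutely_integrable_on {-b..b}"
    and B: "B absolutely_integrable_on {-b..b}"
  shows "\<exists>g v Q P. riesz_system b F C B g v Q P \<and> g (-b) = 0 \<and> v (-b) = 0 \<and> Q (-b) = q \<and> P (-b) = p"
proof -
  define w wi where "w = Complex (sqrt 3 / 2) (1 / 2)" and "wi = Complex (sqrt 3 / 2) (- 1 / 2)"
  have w1: "w * wi = 1" and w2: "w * w + wi * wi = 1" and w3: "w * w - wi * wi \<noteq> 0"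
    by (auto simp: w_def wi_def complex_eq_iff)
  define t where "t = 1 / (w * w - wi * wi)"
  have t: "t * (w * w - wi * wi) = 1" using w3 by (simp add: t_def)
  define k1 k2 k3 k4 where
    "k1 = (\<lambda>F C B. (- t * B + t * (w * F + wi * C)) / 2)" and
    "k2 = (\<lambda>F C B. (- t * B - t * (w * F + wi * C)) / 2)" and
    "k3 = (\<lambda>F C B. (t * B - t * (w * C + wi * F)) / 2)" and
    "k4 = (\<lambda>F C B. (t * B + t * (w * C + wi * F)) / 2)"
  note k = k1_def k2_def k3_def k4_def
  \<comment> \<open>The four identities say that the eigenvectors, weighted by \<open>k1\<close> to \<open>k4\<close>, add up to \<open>(0, F, C, B)\<close>.\<close>
  have K0: "k1 F C B + k2 F C B + k3 F C B + k4 F C B = 0" for F C B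
    by (simp add: k field_simps)
  have K1: "w * (k1 F C B - k2 F C B) + wi * (k3 F C B - k4 F C B) = F" for F C B
  proof -
    have "w * (k1 F C B - k2 F C B) + wi * (k3 F C B - k4 F C B) = t * (w * w - wi * wi) * F"
      by (simp add: k field_simps)
    then show ?thesis by (simp add: t)
  qed
  have K2: "- wi * (k1 F C B - k2 F C B) - w * (k3 F C B - k4 F C B) = C" for F C B
  proof -
    have "- wi * (k1 F C B - k2 F C B) - w * (k3 F C B - k4 F C B) = t * (w * w - wi * wi) * C"
      by (simp add: k field_simps)
    then show ?thesis by (simp add: t)
  qed
  have K3: "- (w * w) * (k1 F C B + k2 F C B) - wi * wi * (k3 F C B + k4 F C B) = B" for F C B
  proof -
    have "- (w * w) * (k1 F C B + k2 F C B) - wi * wi * (k3 F C B + k4 F C B) = t * (w * w - wi * wi) * B"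
      by (simp add: k field_simps)
    then show ?thesis by (simp add: t)
  qed
  have bb: "-b \<le> b" using b by simp
  have ai: "(\<lambda>z. x1 * F z + x2 * C z + x3 * B z) absolutely_integrable_on {-b..b}" for x1 x2 x3
    using F C B by (intro set_integral_add set_integrable_mult_right) auto
  have "k1 F C B = t * w / 2 * F + t * wi / 2 * C + - t / 2 * B" for F C B
    by (simp add: k field_simps)
  then have "(\<lambda>z. k1 (F z) (C z) (B z)) absolutely_integrable_on {-b..b}"
    by (simp only: ai)
  then obtain y1 where y1: "y1 (-b) = k1 0 q p" "primitive_on (-b) b y1 (\<lambda>z. w * y1 z + k1 (F z) (C z) (B z))"
    using linear_ode_solution[OF _ bb] by blast
  have "k2 F C B = - t * w / 2 * F + - t * wi / 2 * C + - t / 2 * B" for F C B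
    by (simp add: k field_simps)
  then have "(\<lambda>z. k2 (F z) (C z) (B z)) absolutely_integrable_on {-b..b}"
    by (simp only: ai)
  then obtain y2 where y2: "y2 (-b) = k2 0 q p" "primitive_on (-b) b y2 (\<lambda>z. - w * y2 z + k2 (F z) (C z) (B z))"
    using linear_ode_solution[OF _ bb] by blast
  have "k3 F C B = - t * wi / 2 * F + - t * w / 2 * C + t / 2 * B" for F C B
    by (simp add: k field_simps)
  then have "(\<lambda>z. k3 (F z) (C z) (B z)) absolutely_integrable_on {-b..b}"
    by (simp only: ai)
  then obtain y3 where y3: "y3 (-b) = k3 0 q p" "primitive_on (-b) b y3 (\<lambda>z. wi * y3 z + k3 (F z) (C z) (B z))"
    using linear_ode_solution[OF _ bb] by blast
  have "k4 F C B = t * wi / 2 * F + t * w / 2 * C + t / 2 * B" for F C B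
    by (simp add: k field_simps)
  then have "(\<lambda>z. k4 (F z) (C z) (B z)) absolutely_integrable_on {-b..b}"
    by (simp only: ai)
  then obtain y4 where y4: "y4 (-b) = k4 0 q p" "primitive_on (-b) b y4 (\<lambda>z. - wi * y4 z + k4 (F z) (C z) (B z))"
    using linear_ode_solution[OF _ bb] by blast
  have "w * w * w = w * (w * w + wi * wi) - w * wi * wi"
    "wi * wi * wi = wi * (w * w + wi * wi) - w * wi * w"
    by (simp_all add: algebra_simps)
  then have w_cube: "w * w * w = w - wi" and wi_cube: "wi * wi * wi = wi - w"
    unfolding w1 w2 by simp_all
  \<comment> \<open>Algebraic content of the four components of the system, for a combination of eigenvectors with coordinates \<open>e1\<close> to \<open>e4\<close>.\<close>
  have L0: "(1 * (w * e1 + a1) + 1 * (- w * e2 + a2)) + (1 * (wi * e3 + a3) + 1 * (- wi * e4 + a4)) =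
      (w * e1 + - w * e2) + (wi * e3 + - wi * e4)"
    if "a1 + a2 + a3 + a4 = 0" for a1 a2 a3 a4 e1 e2 e3 e4
  proof -
    have "(1 * (w * e1 + a1) + 1 * (- w * e2 + a2)) + (1 * (wi * e3 + a3) + 1 * (- wi * e4 + a4)) =
      (w * e1 + - w * e2) + (wi * e3 + - wi * e4) + (a1 + a2 + a3 + a4)"
      by (simp add: algebra_simps)
    then show ?thesis by (simp add: that)
  qed
  have L1: "(w * (w * e1 + a1) + (- w) * (- w * e2 + a2)) + (wi * (wi * e3 + a3) + (- wi) * (- wi * e4 + a4)) =
      f - ((- (w * w) * e1 + - (w * w) * e2) + (- (wi * wi) * e3 + - (wi * wi) * e4))"
    if "w * (a1 - a2) + wi * (a3 - a4) = f" for a1 a2 a3 a4 e1 e2 e3 e4 f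
    unfolding that[symmetric] by (simp add: algebra_simps)
  have L2: "((-wi) * (w * e1 + a1) + wi * (- w * e2 + a2)) + ((-w) * (wi * e3 + a3) + w * (- wi * e4 + a4)) =
      f - ((1 * e1 + 1 * e2) + (1 * e3 + 1 * e4))"
    if "- wi * (a1 - a2) - w * (a3 - a4) = f" for a1 a2 a3 a4 e1 e2 e3 e4 f
  proof -
    have "((-wi) * (w * e1 + a1) + wi * (- w * e2 + a2)) + ((-w) * (wi * e3 + a3) + w * (- wi * e4 + a4)) =
      f - (w * wi) * ((1 * e1 + 1 * e2) + (1 * e3 + 1 * e4))"
      unfolding that[symmetric] by (simp add: algebra_simps)
    then show ?thesis by (simp add: w1)
  qed
  have L3: "(- (w * w) * (w * e1 + a1) + - (w * w) * (- w * e2 + a2)) +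
      (- (wi * wi) * (wi * e3 + a3) + - (wi * wi) * (- wi * e4 + a4)) =
      f - ((w * e1 + - w * e2) + (wi * e3 + - wi * e4)) - ((- wi * e1 + wi * e2) + (- w * e3 + w * e4))"
    if "- (w * w) * (a1 + a2) - wi * wi * (a3 + a4) = f" for a1 a2 a3 a4 e1 e2 e3 e4 f
  proof -
    have "(- (w * w) * (w * e1 + a1) + - (w * w) * (- w * e2 + a2)) +
      (- (wi * wi) * (wi * e3 + a3) + - (wi * wi) * (- wi * e4 + a4)) =
      f - (w * w * w) * (e1 - e2) - (wi * wi * wi) * (e3 - e4)"
      unfolding that[symmetric] by (simp add: algebra_simps)
    then show ?thesis unfolding w_cube wi_cube by (simp add: algebra_simps)
  qed
  define comb where "comb = (\<lambda>c1 c2 c3 c4 z. (c1 * y1 z + c2 * y2 z) + (c3 * y3 z + c4 * y4 z))"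
  have comb: "primitive_on (-b) b (comb c1 c2 c3 c4) (\<lambda>z.
      (c1 * (w * y1 z + k1 (F z) (C z) (B z)) + c2 * (- w * y2 z + k2 (F z) (C z) (B z))) +
      (c3 * (wi * y3 z + k3 (F z) (C z) (B z)) + c4 * (- wi * y4 z + k4 (F z) (C z) (B z))))" for c1 c2 c3 c4
    unfolding comb_def by (intro primitive_on_add primitive_on_lincomb y1 y2 y3 y4)
  \<comment> \<open>The coefficients are the entries of the eigenvectors for \<open>w\<close>, \<open>-w\<close>, \<open>1/w\<close> and \<open>-1/w\<close>.\<close>
  define g v Q P where "g = comb 1 1 1 1" and "v = comb w (-w) wi (-wi)"
    and "Q = comb (-wi) wi (-w) w" and "P = comb (- (w * w)) (- (w * w)) (- (wi * wi)) (- (wi * wi))"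
  have "primitive_on (-b) b g v"
  proof -
    have "(1 * (w * y1 z + k1 (F z) (C z) (B z)) + 1 * (- w * y2 z + k2 (F z) (C z) (B z))) +
      (1 * (wi * y3 z + k3 (F z) (C z) (B z)) + 1 * (- wi * y4 z + k4 (F z) (C z) (B z))) = v z" for z
      unfolding v_def comb_def by (rule L0[OF K0])
    then show ?thesis using comb[of 1 1 1 1] unfolding g_def by simp
  qed
  moreover have "primitive_on (-b) b v (\<lambda>z. F z - P z)"
  proof -
    have "(w * (w * y1 z + k1 (F z) (C z) (B z)) + (- w) * (- w * y2 z + k2 (F z) (C z) (B z))) +
      (wi * (wi * y3 z + k3 (F z) (C z) (B z)) + (- wi) * (- wi * y4 z + k4 (F z) (C z) (B z))) = F z - P z" for z
      unfolding P_def comb_def by (rule L1[OF K1])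
    then show ?thesis using comb[of w "-w" wi "-wi"] unfolding v_def by simp
  qed
  moreover have "primitive_on (-b) b Q (\<lambda>z. C z - g z)"
  proof -
    have "((-wi) * (w * y1 z + k1 (F z) (C z) (B z)) + wi * (- w * y2 z + k2 (F z) (C z) (B z))) +
      ((-w) * (wi * y3 z + k3 (F z) (C z) (B z)) + w * (- wi * y4 z + k4 (F z) (C z) (B z))) = C z - g z" for z
      unfolding g_def comb_def by (rule L2[OF K2])
    then show ?thesis using comb[of "-wi" wi "-w" w] unfolding Q_def by simp
  qed
  moreover have "primitive_on (-b) b P (\<lambda>z. B z - v z - Q z)"
  proof -
    have "(- (w * w) * (w * y1 z + k1 (F z) (C z) (B z)) + - (w * w) * (- w * y2 z + k2 (F z) (C z) (B z))) +
      (- (wi * wi) * (wi * y3 z + k3 (F z) (C z) (B z)) + - (wi * wi) * (- wi * y4 z + k4 (F z) (C z) (B z))) = B z - v z - Q z" for z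
      unfolding v_def Q_def comb_def by (rule L3[OF K3])
    then show ?thesis using comb[of "- (w * w)" "- (w * w)" "- (wi * wi)" "- (wi * wi)"] unfolding P_def by simp
  qed
  moreover have "g (-b) = 0"
    using K0[of 0 q p] by (simp add: g_def comb_def y1 y2 y3 y4 add.assoc)
  moreover have "v (-b) = 0"
    using K1[of 0 q p] by (simp add: v_def comb_def y1 y2 y3 y4 right_diff_distrib)
  moreover have "Q (-b) = q"
    using K2[of 0 q p] by (simp add: Q_def comb_def y1 y2 y3 y4 algebra_simps)
  moreover have "P (-b) = p"
  proof -
    have "P (-b) = - (w * w) * (k1 0 q p + k2 0 q p) - wi * wi * (k3 0 q p + k4 0 q p)"
      by (simp add: P_def comb_def y1 y2 y3 y4 algebra_simps)
    then show ?thesis by (simp only: K3)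
  qed
  ultimately show ?thesis unfolding riesz_system_def by blast
qed

text \<open>Integrate \<open>\<langle>P, r'\<rangle>\<close> and \<open>\<langle>Q, r\<rangle>\<close> by parts. The boundary terms vanish because \<open>r'\<close> is zero at both ends, \<open>r\<close> at the left end and
  \<open>Q\<close> at the right end.\<close>

lemma riesz_system_weak_form:
  assumes b: "b > 0" and s: "riesz_system b F C B g v Q P" and Qb: "Q b = 0"
    and F: "sq_integrable (-b) b F"
    and r: "primitive_on (-b) b r r1" and r1: "primitive_on (-b) b r1 r2" and r2: "sq_integrable (-b) b r2"
    and bc: "r (-b) = 0" "r1 (-b) = 0" "r1 b = 0"
  shows "integral {-b..b} (\<lambda>z. inner (g z) (r z) + inner (v z) (r1 z) + inner (F z - P z) (r2 z)) =
    integral {-b..b} (\<lambda>z. inner (F z) (r2 z) + inner (B z) (r1 z) + inner (C z) (r z))"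
proof -
  have P: "primitive_on (-b) b P (\<lambda>z. B z - v z - Q z)" and Q: "primitive_on (-b) b Q (\<lambda>z. C z - g z)"
    and v: "primitive_on (-b) b v (\<lambda>z. F z - P z)" and g: "primitive_on (-b) b g v"
    using s by (auto simp: riesz_system_def)
  have bb: "b \<in> {-b..b}" using b by simp
  have 1: "((\<lambda>z. inner (B z - v z - Q z) (r1 z) + inner (P z) (r2 z)) has_integral 0) {-b..b}"
    using primitive_on_product_rule[OF bounded_bilinear_inner P r1] bb bc unfolding primitive_on_def by fastforce
  have 2: "((\<lambda>z. inner (C z - g z) (r z) + inner (Q z) (r1 z)) has_integral 0) {-b..b}"
    using primitive_on_product_rule[OF bounded_bilinear_inner Q r] bb bc Qb unfolding primitive_on_def by fastforce
  have sq: "sq_integrable (-b) b (\<lambda>z. F z - P z)"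
    by (intro sq_integrable_diff F sq_integrable_continuous primitive_on_continuous[OF P])
  have c: "continuous_on {-b..b} r" "continuous_on {-b..b} r1" "continuous_on {-b..b} g" "continuous_on {-b..b} v"
    using primitive_on_continuous r r1 g v by blast+
  have 3: "(\<lambda>z. inner (g z) (r z) + inner (v z) (r1 z) + inner (F z - P z) (r2 z)) integrable_on {-b..b}"
    by (intro integrable_add absolutely_integrable_imp_integrable_subinterval[OF sq_integrable_inner[OF sq r2]]
        order_refl) (intro integrable_continuous_real continuous_intros c)+
  have "((\<lambda>z. (inner (g z) (r z) + inner (v z) (r1 z) + inner (F z - P z) (r2 z)) +
      ((inner (B z - v z - Q z) (r1 z) + inner (P z) (r2 z)) + (inner (C z - g z) (r z) + inner (Q z) (r1 z))))
      has_integral integral {-b..b} (\<lambda>z. inner (g z) (r z) + inner (v z) (r1 z) + inner (F z - P z) (r2 z)) + (0 + 0)) {-b..b}"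
    by (intro has_integral_add 1 2 integrable_integral 3)
  then have "((\<lambda>z. inner (F z) (r2 z) + inner (B z) (r1 z) + inner (C z) (r z))
      has_integral integral {-b..b} (\<lambda>z. inner (g z) (r z) + inner (v z) (r1 z) + inner (F z - P z) (r2 z))) {-b..b}"
    by (simp add: inner_diff_left algebra_simps)
  then show ?thesis by (simp add: integral_unique)
qed

lemma riesz_system_lincomb:
  assumes "riesz_system b F C B g v Q P" "riesz_system b F' C' B' g' v' Q' P'"
  shows "riesz_system b (\<lambda>z. F z + c * F' z) (\<lambda>z. C z + c * C' z) (\<lambda>z. B z + c * B' z) (\<lambda>z. g z + c * g' z)
    (\<lambda>z. v z + c * v' z) (\<lambda>z. Q z + c * Q' z) (\<lambda>z. P z + c * P' z)"
proof -
  have *: "primitive_on (-b) b (\<lambda>z. G z + c * G' z) k"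
    if "primitive_on (-b) b G h" "primitive_on (-b) b G' h'" "\<And>z. h z + c * h' z = k z" for G G' h h' k
    using primitive_on_lincomb[OF that(1,2), of 1 c] that(3) by simp
  show ?thesis
    using assms unfolding riesz_system_def
    by (auto intro!: * simp: algebra_simps)
qed

text \<open>Testing the homogeneous system with its own solution \<open>g\<close> shows that \<open>g\<close>, \<open>v\<close> and \<open>P\<close> vanish; then \<open>Q\<close> is constant, and \<open>P' = -Q\<close> forces
  this constant to be zero.\<close>

lemma riesz_system_homogeneous_unique:
  assumes b: "b > 0" and s: "riesz_system b (\<lambda>_. 0) (\<lambda>_. 0) (\<lambda>_. 0) g v Q P"
    and bc: "g (-b) = 0" "v (-b) = 0" "v b = 0" "Q b = 0"
  shows "Q (-b) = 0" "P (-b) = 0"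
proof -
  have P: "primitive_on (-b) b P (\<lambda>z. 0 - v z - Q z)" and Q: "primitive_on (-b) b Q (\<lambda>z. 0 - g z)"
    and v: "primitive_on (-b) b v (\<lambda>z. 0 - P z)" and g: "primitive_on (-b) b g v"
    using s by (auto simp: riesz_system_def)
  have c: "continuous_on {-b..b} P" "continuous_on {-b..b} g" "continuous_on {-b..b} v"
    using primitive_on_continuous P g v by blast+
  define E where "E = (\<lambda>z. (cmod (g z))\<^sup>2 + (cmod (v z))\<^sup>2 + (cmod (P z))\<^sup>2)"
  have cE: "continuous_on {-b..b} E" unfolding E_def by (intro continuous_intros c)
  have "sq_integrable (-b) b (\<lambda>z. 0 - P z)"
    by (intro sq_integrable_continuous continuous_intros c)
  from riesz_system_weak_form[OF b s bc(4) _ g v this bc(1-3)]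
  have "integral {-b..b} E = 0"
    by (simp add: E_def power2_norm_eq_inner)
  then have "(E has_integral 0) (cbox (-b) b)"
    using integrable_integral[OF integrable_continuous_real[OF cE]] by simp
  then have "E z = 0" if "z \<in> {-b..b}" for z
    using has_integral_0_cbox_imp_0[of "-b" b E z] cE that b by (auto simp: E_def)
  then have 0: "g z = 0 \<and> v z = 0 \<and> P z = 0" if "z \<in> {-b..b}" for z
    using that by (fastforce simp: E_def add_nonneg_eq_0_iff)
  then show "P (-b) = 0" using b by simp
  have Qc: "Q z = Q (-b)" if z: "z \<in> {-b..b}" for z
  proof -
    have "Q z - Q (-b) = integral {-b..z} (\<lambda>z. 0 - g z)"
      using primitive_on_diff_eq[OF Q] z by auto
    also have "\<dots> = integral {-b..z} (\<lambda>z. 0)"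
      by (rule integral_cong) (use 0 z in auto)
    finally show ?thesis by simp
  qed
  have "P b - P (-b) = integral {-b..b} (\<lambda>z. 0 - v z - Q z)"
    using primitive_on_diff_eq[OF P] b by auto
  also have "\<dots> = integral {-b..b} (\<lambda>z. - Q (-b))"
  proof (rule integral_cong)
    fix z assume z: "z \<in> {-b..b}"
    show "0 - v z - Q z = - Q (-b)" using 0[OF z] Qc[OF z] by simp
  qed
  also have "\<dots> = - (2 * b) *\<^sub>R Q (-b)"
    using b by simp
  finally show "Q (-b) = 0" using 0[of b] 0[of "-b"] b by simp
qed

lemma cramer_2x2:
  fixes \<alpha> \<beta> \<gamma> \<delta> x y :: "'a::field"
  assumes inj: "\<And>q p. q * \<alpha> + p * \<beta> = 0 \<Longrightarrow> q * \<gamma> + p * \<delta> = 0 \<Longrightarrow> q = 0 \<and> p = 0"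
  shows "\<exists>q p. q * \<alpha> + p * \<beta> = x \<and> q * \<gamma> + p * \<delta> = y"
proof -
  define D where "D = \<alpha> * \<delta> - \<beta> * \<gamma>"
  have "D \<noteq> 0"
  proof
    assume D: "D = 0"
    have "\<beta> = 0 \<and> \<alpha> = 0" using inj[of "- \<beta>" \<alpha>] D by (simp add: D_def algebra_simps)
    moreover have "\<delta> = 0 \<and> \<gamma> = 0" using inj[of "- \<delta>" \<gamma>] D by (simp add: D_def algebra_simps)
    ultimately show False using inj[of 1 1] by simp
  qed
  then have "(x * \<delta> - y * \<beta>) / D * \<alpha> + (y * \<alpha> - x * \<gamma>) / D * \<beta> = x"
    "(x * \<delta> - y * \<beta>) / D * \<gamma> + (y * \<alpha> - x * \<gamma>) / D * \<delta> = y"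
    by (simp_all add: divide_simps) (simp_all add: D_def algebra_simps)
  then show ?thesis by blast
qed

text \<open>The conditions that membership in \<open>H2h_0\<close> imposes on a single node.\<close>

definition H2_bc :: "real \<Rightarrow> (real \<Rightarrow> complex) \<Rightarrow> bool" where
  "H2_bc b f \<longleftrightarrow> H2_interval b f \<and> f (-b) = 0 \<and> dz b f (-b) = 0 \<and> dz b f b = 0"

text \<open>Shooting: with \<open>g\<close> and \<open>v\<close> zero at the left end, the two free initial values of \<open>Q\<close> and \<open>P\<close> are chosen to meet the conditions
  \<open>v(b) = Q(b) = 0\<close>. These are two linear equations, solvable since the homogeneous problem has only the zero solution.\<close>

lemma H2_bc_riesz_representation:
  assumes b: "b > 0" and F: "sq_integrable (-b) b F" and C: "C absolutely_integrable_on {-b..b}"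
    and B: "B absolutely_integrable_on {-b..b}"
  shows "\<exists>g. H2_bc b g \<and> (\<forall>r. H2_bc b r \<longrightarrow>
    integral {-b..b} (\<lambda>z. inner (g z) (r z) + inner (dz b g z) (dz b r z) + inner (dzz b g z) (dzz b r z)) =
    integral {-b..b} (\<lambda>z. inner (F z) (dzz b r z) + inner (B z) (dz b r z) + inner (C z) (r z)))"
proof -
  have aF: "F absolutely_integrable_on {-b..b}" using F by (simp add: sq_integrable_def)
  have a0: "(\<lambda>_. 0::complex) absolutely_integrable_on {-b..b}" by simp
  obtain g0 v0 Q0 P0 where s0: "riesz_system b F C B g0 v0 Q0 P0"
    "g0 (-b) = 0" "v0 (-b) = 0" "Q0 (-b) = 0" "P0 (-b) = 0"
    using riesz_system_initial_value[OF b aF C B] by blast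
  obtain g1 v1 Q1 P1 where s1: "riesz_system b (\<lambda>_. 0) (\<lambda>_. 0) (\<lambda>_. 0) g1 v1 Q1 P1"
    "g1 (-b) = 0" "v1 (-b) = 0" "Q1 (-b) = 1" "P1 (-b) = 0"
    using riesz_system_initial_value[OF b a0 a0 a0] by blast
  obtain g2 v2 Q2 P2 where s2: "riesz_system b (\<lambda>_. 0) (\<lambda>_. 0) (\<lambda>_. 0) g2 v2 Q2 P2"
    "g2 (-b) = 0" "v2 (-b) = 0" "Q2 (-b) = 0" "P2 (-b) = 1"
    using riesz_system_initial_value[OF b a0 a0 a0] by blast
  have z: "riesz_system b (\<lambda>_. 0) (\<lambda>_. 0) (\<lambda>_. 0) (\<lambda>_. 0) (\<lambda>_. 0) (\<lambda>_. 0) (\<lambda>_. 0)"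
    by (simp add: riesz_system_def primitive_on_const)
  have "\<exists>q p. q * v1 b + p * v2 b = - v0 b \<and> q * Q1 b + p * Q2 b = - Q0 b"
  proof (rule cramer_2x2)
    fix q p assume 0: "q * v1 b + p * v2 b = 0" "q * Q1 b + p * Q2 b = 0"
    have "riesz_system b (\<lambda>_. 0) (\<lambda>_. 0) (\<lambda>_. 0) (\<lambda>z. q * g1 z + p * g2 z)
        (\<lambda>z. q * v1 z + p * v2 z) (\<lambda>z. q * Q1 z + p * Q2 z) (\<lambda>z. q * P1 z + p * P2 z)"
      using riesz_system_lincomb[OF riesz_system_lincomb[OF z s1(1), of q] s2(1), of p] by simp
    note u = riesz_system_homogeneous_unique[OF b this]
    have "q * Q1 (-b) + p * Q2 (-b) = 0" "q * P1 (-b) + p * P2 (-b) = 0"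
      by (rule u; simp add: s1(2-) s2(2-) 0)+
    then show "q = 0 \<and> p = 0" by (simp add: s1(2-) s2(2-))
  qed
  then obtain q p where qp: "q * v1 b + p * v2 b = - v0 b" "q * Q1 b + p * Q2 b = - Q0 b" by blast
  define g where "g = (\<lambda>z. g0 z + q * g1 z + p * g2 z)"
  define v where "v = (\<lambda>z. v0 z + q * v1 z + p * v2 z)"
  define Q where "Q = (\<lambda>z. Q0 z + q * Q1 z + p * Q2 z)"
  define P where "P = (\<lambda>z. P0 z + q * P1 z + p * P2 z)"
  have s: "riesz_system b F C B g v Q P"
    using riesz_system_lincomb[OF riesz_system_lincomb[OF s0(1) s1(1), of q] s2(1), of p]
    by (simp add: g_def v_def Q_def P_def)
  have bc: "g (-b) = 0" "v (-b) = 0" "v b = 0" "Q b = 0"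
    using s0 s1 s2 qp by (simp_all add: g_def v_def Q_def add.assoc)
  have pg: "primitive_on (-b) b g v" and pv: "primitive_on (-b) b v (\<lambda>z. F z - P z)"
    and pP: "primitive_on (-b) b P (\<lambda>z. B z - v z - Q z)"
    using s by (auto simp: riesz_system_def)
  have sq: "sq_integrable (-b) b (\<lambda>z. F z - P z)"
    by (intro sq_integrable_diff F sq_integrable_continuous primitive_on_continuous[OF pP])
  note H = H2_intervalI[OF b pg pv sq]
  have "H2_bc b g"
    using H(1,2) bc b by (simp add: H2_bc_def)
  moreover have "integral {-b..b} (\<lambda>z. inner (g z) (r z) + inner (dz b g z) (dz b r z) + inner (dzz b g z) (dzz b r z)) =
    integral {-b..b} (\<lambda>z. inner (F z) (dzz b r z) + inner (B z) (dz b r z) + inner (C z) (r z))" if r: "H2_bc b r" for r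
  proof -
    have r': "H2_interval b r" "r (-b) = 0" "dz b r (-b) = 0" "dz b r b = 0"
      using r by (auto simp: H2_bc_def)
    have "integral {-b..b} (\<lambda>z. inner (g z) (r z) + inner (dz b g z) (dz b r z) + inner (dzz b g z) (dzz b r z)) =
      integral {-b..b} (\<lambda>z. inner (g z) (r z) + inner (v z) (dz b r z) + inner (F z - P z) (dzz b r z))"
      by (rule integral_spike[OF H(3)]) (use H(2) in auto)
    also have "\<dots> = integral {-b..b} (\<lambda>z. inner (F z) (dzz b r z) + inner (B z) (dz b r z) + inner (C z) (r z))"
      by (rule riesz_system_weak_form[OF b s bc(4) F H2_interval_primitive_dz[OF b r'(1)]
          H2_interval_primitive_dzz[OF b r'(1)] H2_interval_sq_integrable_dzz[OF b r'(1)] r'(2-4)])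
    finally show ?thesis .
  qed
  ultimately show ?thesis by blast
qed

section \<open>Second-order operators with quadratic lower-order part\<close>

text \<open>The pair \<open>(i, False)\<close> selects the value of component \<open>i\<close> and \<open>(i, True)\<close> its first derivative. Treating both alike makes
  the lower-order part a polynomial in one finite family of variables.\<close>

definition jet :: "real \<Rightarrow> ('i \<Rightarrow> real \<Rightarrow> complex) \<Rightarrow> real \<Rightarrow> 'i \<times> bool \<Rightarrow> complex" where
  "jet b u z c = (if snd c then dz b (u (fst c)) z else u (fst c) z)"

definition h2_space :: "real \<Rightarrow> 'i set \<Rightarrow> ('i \<Rightarrow> real \<Rightarrow> complex) set" where
  "h2_space b I = {u. \<forall>i\<in>I. H2_interval b (u i)}"

definition h2_ip :: "real \<Rightarrow> 'i set \<Rightarrow> ('i \<Rightarrow> real \<Rightarrow> complex) \<Rightarrow> ('i \<Rightarrow> real \<Rightarrow> complex) \<Rightarrow> real" where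
  "h2_ip b I u v = (\<Sum>i\<in>I. integral {-b..b} (\<lambda>z. inner (u i z) (v i z) +
     inner (dz b (u i) z) (dz b (v i) z) + inner (dzz b (u i) z) (dzz b (v i) z)))"

definition zero_cauchy :: "real \<Rightarrow> 'i set \<Rightarrow> ('i \<Rightarrow> real \<Rightarrow> complex) \<Rightarrow> bool" where
  "zero_cauchy b I u \<longleftrightarrow> (\<forall>i\<in>I. u i (-b) = 0 \<and> dz b (u i) (-b) = 0)"

definition sd_plus :: "('i \<Rightarrow> real \<Rightarrow> complex) \<Rightarrow> ('i \<Rightarrow> real \<Rightarrow> complex) \<Rightarrow> 'i \<Rightarrow> real \<Rightarrow> complex" where
  "sd_plus u r = (\<lambda>i z. u i z + r i z)"

definition sd_cmult :: "complex \<Rightarrow> ('i \<Rightarrow> real \<Rightarrow> complex) \<Rightarrow> 'i \<Rightarrow> real \<Rightarrow> complex" where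
  "sd_cmult t u = (\<lambda>i z. t * u i z)"

lemma sum_power2_le:
  fixes a :: "'c \<Rightarrow> real"
  assumes "\<And>c. c \<in> C \<Longrightarrow> 0 \<le> a c" "\<And>c. c \<in> C \<Longrightarrow> (a c)\<^sup>2 \<le> K"
  shows "(sum a C)\<^sup>2 \<le> (real (card C))\<^sup>2 * K"
proof (cases "C = {} \<or> infinite C")
  case False
  then obtain c where "c \<in> C" by auto
  then have K: "K \<ge> 0" using assms(2)[of c] zero_le_power2[of "a c"] by linarith
  have "sum a C \<le> (\<Sum>c\<in>C. sqrt K)"
    by (intro sum_mono real_le_rsqrt assms)
  then have "(sum a C)\<^sup>2 \<le> (real (card C) * sqrt K)\<^sup>2"
    by (intro power_mono) (auto intro: sum_nonneg assms)
  then show ?thesis using K by (simp add: power_mult_distrib)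
qed auto

lemma inner_cnj_mult: "inner x (a * y) = inner (cnj a * x) y"
  by (simp add: inner_complex_def algebra_simps)

lemma square_norm_add_le: "(cmod (x + y))\<^sup>2 \<le> 2 * (cmod x)\<^sup>2 + 2 * (cmod y)\<^sup>2"
proof -
  have "(cmod (x + y))\<^sup>2 \<le> (cmod x + cmod y)\<^sup>2"
    by (simp add: norm_triangle_ineq power_mono)
  also have "\<dots> \<le> 2 * (cmod x)\<^sup>2 + 2 * (cmod y)\<^sup>2"
    using sum_squares_bound[of "cmod x" "cmod y"] by (simp add: power2_sum)
  finally show ?thesis .
qed

lemma half_square_norm_le: "(cmod x)\<^sup>2 / 2 - (cmod y)\<^sup>2 \<le> (cmod (x + y))\<^sup>2"
  using square_norm_add_le[of "x + y" "- y"] by simp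

text \<open>The operator is \<open>u \<mapsto> u'' + A\<xi> + Q(\<xi>, \<xi>)\<close>, where \<open>\<xi>\<close> is the jet of \<open>u\<close>. The index \<open>i\<close> runs over all components at
  all interior nodes, so that the coupling of nodes by difference quotients is part of the matrices \<open>A\<close> and \<open>Q\<close>.\<close>

locale quadratic_operator =
  fixes b :: real and I :: "'i set"
    and A :: "'i \<Rightarrow> 'i \<times> bool \<Rightarrow> real \<Rightarrow> complex"
    and Q :: "'i \<Rightarrow> 'i \<times> bool \<Rightarrow> 'i \<times> bool \<Rightarrow> real \<Rightarrow> complex"
  assumes b: "b > 0" and I: "finite I"
    and A: "\<And>i c. continuous_on {-b..b} (A i c)"
    and Q: "\<And>i c e. continuous_on {-b..b} (Q i c e)"
begin

definition J :: "('i \<times> bool) set" where "J = I \<times> UNIV"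

lemma finite_J [simp]: "finite J" using I by (simp add: J_def)

definition lin :: "'i \<Rightarrow> real \<Rightarrow> ('i \<times> bool \<Rightarrow> complex) \<Rightarrow> complex" where
  "lin i z \<xi> = (\<Sum>c\<in>J. A i c z * \<xi> c)"

definition quad :: "'i \<Rightarrow> real \<Rightarrow> ('i \<times> bool \<Rightarrow> complex) \<Rightarrow> ('i \<times> bool \<Rightarrow> complex) \<Rightarrow> complex" where
  "quad i z \<xi> \<eta> = (\<Sum>c\<in>J. \<Sum>e\<in>J. Q i c e z * \<xi> c * \<eta> e)"

definition op :: "('i \<Rightarrow> real \<Rightarrow> complex) \<Rightarrow> 'i \<Rightarrow> real \<Rightarrow> complex" where
  "op u i z = dzz b (u i) z + lin i z (jet b u z) + quad i z (jet b u z) (jet b u z)"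

definition dop_lower :: "('i \<Rightarrow> real \<Rightarrow> complex) \<Rightarrow> ('i \<Rightarrow> real \<Rightarrow> complex) \<Rightarrow> 'i \<Rightarrow> real \<Rightarrow> complex" where
  "dop_lower V r i z = lin i z (jet b r z) + quad i z (jet b V z) (jet b r z) + quad i z (jet b r z) (jet b V z)"

text \<open>The derivative of \<open>op\<close> at \<open>V\<close> in the direction \<open>r\<close>.\<close>

definition dop :: "('i \<Rightarrow> real \<Rightarrow> complex) \<Rightarrow> ('i \<Rightarrow> real \<Rightarrow> complex) \<Rightarrow> 'i \<Rightarrow> real \<Rightarrow> complex" where
  "dop V r i z = dzz b (r i) z + dop_lower V r i z"

definition qrem :: "('i \<Rightarrow> real \<Rightarrow> complex) \<Rightarrow> 'i \<Rightarrow> real \<Rightarrow> complex" where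
  "qrem r i z = quad i z (jet b r z) (jet b r z)"

definition functional :: "(real \<Rightarrow> real) \<Rightarrow> ('i \<Rightarrow> real \<Rightarrow> complex) \<Rightarrow> real" where
  "functional \<mu> u = (\<Sum>i\<in>I. weighted_sq b \<mu> (op u i))"

definition first_variation :: "(real \<Rightarrow> real) \<Rightarrow> ('i \<Rightarrow> real \<Rightarrow> complex) \<Rightarrow> ('i \<Rightarrow> real \<Rightarrow> complex) \<Rightarrow> real" where
  "first_variation \<mu> V r = (\<Sum>i\<in>I. integral {-b..b} (\<lambda>z. 2 * inner (op V i z) (dop V r i z) * \<mu> z))"

abbreviation remainder_density :: "('i \<Rightarrow> real \<Rightarrow> complex) \<Rightarrow> ('i \<Rightarrow> real \<Rightarrow> complex) \<Rightarrow> 'i \<Rightarrow> real \<Rightarrow> real" where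
  "remainder_density V r i z \<equiv> 2 * inner (op V i z) (qrem r i z) + (cmod (dop V r i z + qrem r i z))\<^sup>2"

definition remainder :: "(real \<Rightarrow> real) \<Rightarrow> ('i \<Rightarrow> real \<Rightarrow> complex) \<Rightarrow> ('i \<Rightarrow> real \<Rightarrow> complex) \<Rightarrow> real" where
  "remainder \<mu> V r = (\<Sum>i\<in>I. integral {-b..b} (\<lambda>z.
     remainder_density V r i z * \<mu> z))"

definition jet_norm :: "('i \<Rightarrow> real \<Rightarrow> complex) \<Rightarrow> real \<Rightarrow> real" where
  "jet_norm u z = (\<Sum>c\<in>J. cmod (jet b u z c))"

lemma jet_norm_nonneg [simp]: "0 \<le> jet_norm u z"
  by (simp add: jet_norm_def sum_nonneg)

text \<open>The quantity \<open>Y\<close> that controls all other terms for large \<open>\<lambda>\<close>.\<close>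

definition energy :: "(real \<Rightarrow> real) \<Rightarrow> ('i \<Rightarrow> real \<Rightarrow> complex) \<Rightarrow> real" where
  "energy \<mu> r = (\<Sum>i\<in>I. weighted_sq b \<mu> (dzz b (r i)))"

subsection \<open>Integrability\<close>

lemma h2_spaceD: "u \<in> h2_space b I \<Longrightarrow> i \<in> I \<Longrightarrow> H2_interval b (u i)"
  by (simp add: h2_space_def)

lemma continuous_on_jet:
  assumes "u \<in> h2_space b I" "c \<in> J"
  shows "continuous_on {-b..b} (\<lambda>z. jet b u z c)"
  using assms H2_interval_continuous[OF b h2_spaceD[OF assms(1)]]
    H2_interval_continuous_dz[OF b h2_spaceD[OF assms(1)]]
  by (cases "snd c") (auto simp: jet_def J_def)

lemma continuous_on_lin:
  assumes "u \<in> h2_space b I"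
  shows "continuous_on {-b..b} (\<lambda>z. lin i z (jet b u z))"
  unfolding lin_def by (intro continuous_intros continuous_on_jet assms A)

lemma continuous_on_quad:
  assumes "u \<in> h2_space b I" "v \<in> h2_space b I"
  shows "continuous_on {-b..b} (\<lambda>z. quad i z (jet b u z) (jet b v z))"
  unfolding quad_def by (intro continuous_intros continuous_on_jet assms Q)

lemma continuous_on_qrem:
  assumes "r \<in> h2_space b I"
  shows "continuous_on {-b..b} (qrem r i)"
  unfolding qrem_def by (intro continuous_on_quad assms)

lemma continuous_on_dop_lower:
  assumes "V \<in> h2_space b I" "r \<in> h2_space b I"
  shows "continuous_on {-b..b} (dop_lower V r i)"
  unfolding dop_lower_def by (intro continuous_intros continuous_on_quad continuous_on_lin assms)

lemma sq_integrable_dzz: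
  assumes "u \<in> h2_space b I" "i \<in> I"
  shows "sq_integrable (-b) b (dzz b (u i))"
  by (intro H2_interval_sq_integrable_dzz b h2_spaceD assms)

lemma sq_integrable_op:
  assumes "u \<in> h2_space b I" "i \<in> I"
  shows "sq_integrable (-b) b (op u i)"
  unfolding op_def
  by (intro sq_integrable_add sq_integrable_dzz assms sq_integrable_continuous continuous_on_lin continuous_on_quad)

lemma sq_integrable_dop:
  assumes "V \<in> h2_space b I" "r \<in> h2_space b I" "i \<in> I"
  shows "sq_integrable (-b) b (dop V r i)"
  unfolding dop_def
  by (intro sq_integrable_add sq_integrable_dzz assms sq_integrable_continuous continuous_on_dop_lower)

subsection \<open>The second-order expansion of the functional\<close>

lemma h2_space_plus:
  assumes "u \<in> h2_space b I" "r \<in> h2_space b I"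
  shows "sd_plus u r \<in> h2_space b I"
  using assms by (auto simp: h2_space_def sd_plus_def intro: H2_interval_add[OF b])

lemma h2_space_cmult:
  assumes "u \<in> h2_space b I"
  shows "sd_cmult t u \<in> h2_space b I"
  using assms by (auto simp: h2_space_def sd_cmult_def intro: H2_interval_cmult[OF b])

lemma jet_plus:
  assumes "u \<in> h2_space b I" "r \<in> h2_space b I" "z \<in> {-b..b}" "c \<in> J"
  shows "jet b (sd_plus u r) z c = jet b u z c + jet b r z c"
  using assms H2_interval_add(2)[OF b, of "u (fst c)" "r (fst c)" z]
  by (auto simp: jet_def sd_plus_def J_def h2_space_def)

lemma jet_cmult:
  assumes "u \<in> h2_space b I" "z \<in> {-b..b}" "c \<in> J"
  shows "jet b (sd_cmult t u) z c = t * jet b u z c"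
  using assms H2_interval_cmult(2)[OF b, of "u (fst c)" z t]
  by (auto simp: jet_def sd_cmult_def J_def h2_space_def)

lemma dzz_plus_ae:
  assumes "u \<in> h2_space b I" "r \<in> h2_space b I" "i \<in> I"
  shows "negligible {z \<in> {-b..b}. dzz b (sd_plus u r i) z \<noteq> dzz b (u i) z + dzz b (r i) z}"
  using H2_interval_add(3)[OF b h2_spaceD[OF assms(1,3)] h2_spaceD[OF assms(2,3)]]
  by (simp add: sd_plus_def)

lemma dzz_cmult_ae:
  assumes "u \<in> h2_space b I" "i \<in> I"
  shows "negligible {z \<in> {-b..b}. dzz b (sd_cmult t u i) z \<noteq> t * dzz b (u i) z}"
  using H2_interval_cmult(3)[OF b h2_spaceD[OF assms]]
  by (simp add: sd_cmult_def)

lemma lin_add: "lin i z (\<lambda>c. \<xi> c + \<eta> c) = lin i z \<xi> + lin i z \<eta>"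
  by (simp add: lin_def distrib_left sum.distrib)

lemma quad_add_left: "quad i z (\<lambda>c. \<xi> c + \<eta> c) \<zeta> = quad i z \<xi> \<zeta> + quad i z \<eta> \<zeta>"
  by (simp add: quad_def distrib_left distrib_right sum.distrib)

lemma quad_add_right: "quad i z \<zeta> (\<lambda>c. \<xi> c + \<eta> c) = quad i z \<zeta> \<xi> + quad i z \<zeta> \<eta>"
  by (simp add: quad_def distrib_left sum.distrib)

lemma lin_cong: "(\<And>c. c \<in> J \<Longrightarrow> \<xi> c = \<eta> c) \<Longrightarrow> lin i z \<xi> = lin i z \<eta>"
  by (simp add: lin_def)

lemma quad_cong:
  "(\<And>c. c \<in> J \<Longrightarrow> \<xi> c = \<xi>' c) \<Longrightarrow> (\<And>c. c \<in> J \<Longrightarrow> \<eta> c = \<eta>' c) \<Longrightarrow> quad i z \<xi> \<eta> = quad i z \<xi>' \<eta>'"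
  by (simp add: quad_def)

lemma op_plus:
  assumes "u \<in> h2_space b I" "r \<in> h2_space b I" "z \<in> {-b..b}"
    and "dzz b (sd_plus u r i) z = dzz b (u i) z + dzz b (r i) z"
  shows "op (sd_plus u r) i z = op u i z + dop u r i z + qrem r i z"
proof -
  have 1: "lin i z (jet b (sd_plus u r) z) = lin i z (\<lambda>c. jet b u z c + jet b r z c)"
    by (rule lin_cong) (rule jet_plus[OF assms(1-3)])
  have 2: "quad i z (jet b (sd_plus u r) z) (jet b (sd_plus u r) z) =
      quad i z (\<lambda>c. jet b u z c + jet b r z c) (\<lambda>c. jet b u z c + jet b r z c)"
    by (rule quad_cong) (rule jet_plus[OF assms(1-3)], assumption)+
  show ?thesis
    unfolding op_def dop_def dop_lower_def qrem_def 1 2 assms(4) lin_add quad_add_left quad_add_right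
    by (simp add: algebra_simps)
qed

text \<open>The operator is quadratic, so its expansion \<open>op_plus\<close> is exact, and expanding the square of the norm gives an identity. It
  holds pointwise only outside the null set on which the second derivative fails to be additive.\<close>

lemma functional_expansion:
  assumes u: "u \<in> h2_space b I" and r: "r \<in> h2_space b I" and \<mu>: "continuous_on {-b..b} \<mu>"
  shows "functional \<mu> (sd_plus u r) = functional \<mu> u + first_variation \<mu> u r + remainder \<mu> u r"
proof -
  have "weighted_sq b \<mu> (op (sd_plus u r) i) =
      weighted_sq b \<mu> (op u i) +
      integral {-b..b} (\<lambda>z. 2 * inner (op u i z) (dop u r i z) * \<mu> z) +
      integral {-b..b} (\<lambda>z. (2 * inner (op u i z) (qrem r i z) + (cmod (dop u r i z + qrem r i z))\<^sup>2) * \<mu> z)"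
    (is "?l = integral _ ?a + integral _ ?b + integral _ ?c") if i: "i \<in> I" for i
  proof -
    have sq: "sq_integrable (-b) b (qrem r i)"
      by (intro sq_integrable_continuous continuous_on_qrem r)
    have ab: "?a integrable_on {-b..b}" "?b integrable_on {-b..b}"
      by (intro sq_integrable_weighted_square sq_integrable_weighted_inner sq_integrable_op sq_integrable_dop u r i \<mu>)+
    have "(\<lambda>z. 2 * inner (op u i z) (qrem r i z) * \<mu> z + (cmod (dop u r i z + qrem r i z))\<^sup>2 * \<mu> z) integrable_on {-b..b}"
      by (intro integrable_add sq_integrable_weighted_square sq_integrable_weighted_inner sq_integrable_add
          sq_integrable_op sq_integrable_dop u r i \<mu> sq)
    then have c: "?c integrable_on {-b..b}"
      by (simp add: distrib_right)
    have "?l = integral {-b..b} (\<lambda>z. ?a z + ?b z + ?c z)"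
    proof (rule integral_spike[OF dzz_plus_ae[OF u r i]])
      fix z assume z: "z \<in> {-b..b} - {z \<in> {-b..b}. dzz b (sd_plus u r i) z \<noteq> dzz b (u i) z + dzz b (r i) z}"
      have "op (sd_plus u r) i z = op u i z + (dop u r i z + qrem r i z)"
        by (subst op_plus[OF u r]) (use z in auto)
      moreover have "(cmod (x + (y + w)))\<^sup>2 = (cmod x)\<^sup>2 + 2 * inner x y + (2 * inner x w + (cmod (y + w))\<^sup>2)" for x y w
        by (simp add: power2_norm_eq_inner inner_add_left inner_add_right inner_commute)
      ultimately show "?a z + ?b z + ?c z = (cmod (op (sd_plus u r) i z))\<^sup>2 * \<mu> z"
        by (simp add: distrib_right)
    qed
    also have "\<dots> = integral {-b..b} ?a + integral {-b..b} ?b + integral {-b..b} ?c"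
      using ab c by (simp add: integral_add integrable_add)
    finally show ?thesis .
  qed
  then show ?thesis
    unfolding functional_def first_variation_def remainder_def by (simp add: sum.distrib)
qed

subsection \<open>Representation of the first variation\<close>

definition h2_bc_space :: "('i \<Rightarrow> real \<Rightarrow> complex) set" where
  "h2_bc_space = {r. \<forall>i\<in>I. H2_bc b (r i)}"

lemma h2_bc_space_subset: "r \<in> h2_bc_space \<Longrightarrow> r \<in> h2_space b I"
  by (simp add: h2_bc_space_def h2_space_def H2_bc_def)

lemma sum_over_J: "(\<Sum>c\<in>J. f c) = (\<Sum>i\<in>I. f (i, True) + f (i, False))"
proof -
  have "(\<Sum>c\<in>J. f c) = (\<Sum>i\<in>I. \<Sum>e\<in>UNIV. f (i, e))"
    unfolding J_def by (simp add: sum.cartesian_product)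
  then show ?thesis by (simp add: UNIV_bool add.commute)
qed

definition dop_coeff :: "('i \<Rightarrow> real \<Rightarrow> complex) \<Rightarrow> 'i \<Rightarrow> 'i \<times> bool \<Rightarrow> real \<Rightarrow> complex" where
  "dop_coeff V i c z = A i c z + (\<Sum>e\<in>J. (Q i e c z + Q i c e z) * jet b V z e)"

text \<open>Collecting the coefficients of the jet of \<open>r\<close> is what allows the first variation to be written as an integral of \<open>r\<close>, \<open>r'\<close> and \<open>r''\<close>
  against fixed functions.\<close>

lemma dop_lower_eq: "dop_lower V r i z = (\<Sum>c\<in>J. dop_coeff V i c z * jet b r z c)"
proof -
  have "quad i z (jet b V z) (jet b r z) = (\<Sum>c\<in>J. \<Sum>e\<in>J. Q i e c z * jet b V z e * jet b r z c)"
    unfolding quad_def by (rule sum.swap)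
  then show ?thesis
    unfolding dop_lower_def lin_def quad_def dop_coeff_def
    by (simp add: algebra_simps sum.distrib sum_distrib_right sum_distrib_left)
qed

lemma continuous_on_dop_coeff:
  assumes "V \<in> h2_space b I"
  shows "continuous_on {-b..b} (dop_coeff V i c)"
  unfolding dop_coeff_def by (intro continuous_intros continuous_on_jet assms A Q)

text \<open>The first variation is a sum over indices of integrals of \<open>\<langle>F, r''\<rangle> + \<langle>G, r'\<rangle> + \<langle>G, r\<rangle>\<close>, after moving the coefficients of the
  linearised operator to the other factor and exchanging the sums. Each index is then handled by
  \<open>H2_bc_riesz_representation\<close>.\<close>

lemma first_variation_representation:
  assumes V: "V \<in> h2_space b I" and \<mu>: "continuous_on {-b..b} \<mu>"
  shows "\<exists>g\<in>h2_bc_space. \<forall>r\<in>h2_bc_space. h2_ip b I g r = first_variation \<mu> V r"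
proof -
  define F where "F = (\<lambda>i z. complex_of_real (2 * \<mu> z) * op V i z)"
  define G where "G = (\<lambda>c z. \<Sum>i\<in>I. cnj (dop_coeff V i c z) * F i z)"
  have F: "sq_integrable (-b) b (F i)" if "i \<in> I" for i
    unfolding F_def by (intro sq_integrable_mult_continuous sq_integrable_op that V continuous_intros \<mu>)
  have cF: "sq_integrable (-b) b (\<lambda>z. cnj (dop_coeff V i c z) * F i z)" if "i \<in> I" for i c
    by (intro sq_integrable_mult_continuous F that continuous_intros continuous_on_dop_coeff V)
  then have G: "sq_integrable (-b) b (G c)" for c
    unfolding G_def by (intro sq_integrable_sum I)
  have "\<forall>i\<in>I. \<exists>g. H2_bc b g \<and> (\<forall>r. H2_bc b r \<longrightarrow>
    integral {-b..b} (\<lambda>z. inner (g z) (r z) + inner (dz b g z) (dz b r z) + inner (dzz b g z) (dzz b r z)) =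
    integral {-b..b} (\<lambda>z. inner (F i z) (dzz b r z) + inner (G (i, True) z) (dz b r z) + inner (G (i, False) z) (r z)))"
    using G by (intro ballI H2_bc_riesz_representation[OF b F]) (auto simp: sq_integrable_def)
  from bchoice[OF this] obtain g where g: "\<And>i. i \<in> I \<Longrightarrow> H2_bc b (g i)"
    "\<And>i r. i \<in> I \<Longrightarrow> H2_bc b r \<Longrightarrow>
    integral {-b..b} (\<lambda>z. inner (g i z) (r z) + inner (dz b (g i) z) (dz b r z) + inner (dzz b (g i) z) (dzz b r z)) =
    integral {-b..b} (\<lambda>z. inner (F i z) (dzz b r z) + inner (G (i, True) z) (dz b r z) + inner (G (i, False) z) (r z))"
    by blast
  show ?thesis
  proof (intro bexI ballI)
    show "g \<in> h2_bc_space" using g by (simp add: h2_bc_space_def)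
    fix r assume r: "r \<in> h2_bc_space"
    note rH = h2_bc_space_subset[OF r]
    have int1: "(\<lambda>z. inner (F i z) (dzz b (r i) z)) integrable_on {-b..b}" if "i \<in> I" for i
      using sq_integrable_inner[OF F[OF that] sq_integrable_dzz[OF rH that]]
      by (simp add: absolutely_integrable_on_def)
    have sj: "sq_integrable (-b) b (\<lambda>z. jet b r z c)" if "c \<in> J" for c
      by (intro sq_integrable_continuous continuous_on_jet rH that)
    have int2: "(\<lambda>z. inner (G c z) (jet b r z c)) integrable_on {-b..b}" if "c \<in> J" for c
      using sq_integrable_inner[OF G sj[OF that]] by (simp add: absolutely_integrable_on_def)
    have int3: "(\<lambda>z. 2 * inner (op V i z) (dop V r i z) * \<mu> z) integrable_on {-b..b}" if "i \<in> I" for i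
      by (intro sq_integrable_weighted_inner sq_integrable_op sq_integrable_dop V rH \<mu> that)
    have pt: "2 * inner (op V i z) (dop V r i z) * \<mu> z =
        inner (F i z) (dzz b (r i) z) + (\<Sum>c\<in>J. inner (cnj (dop_coeff V i c z) * F i z) (jet b r z c))" for i z
    proof -
      have "2 * inner (op V i z) (dop V r i z) * \<mu> z = inner (F i z) (dop V r i z)"
        unfolding F_def by (simp add: inner_complex_def algebra_simps)
      then show ?thesis
        by (simp add: dop_def dop_lower_eq inner_add_right inner_sum_right inner_cnj_mult)
    qed
    have pt2: "(\<Sum>i\<in>I. 2 * inner (op V i z) (dop V r i z) * \<mu> z) =
        (\<Sum>i\<in>I. inner (F i z) (dzz b (r i) z) + inner (G (i, True) z) (dz b (r i) z) + inner (G (i, False) z) (r i z))" for z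
    proof -
      have "(\<Sum>i\<in>I. \<Sum>c\<in>J. inner (cnj (dop_coeff V i c z) * F i z) (jet b r z c)) = (\<Sum>c\<in>J. inner (G c z) (jet b r z c))"
        unfolding G_def inner_sum_left by (rule sum.swap)
      then show ?thesis
        unfolding pt sum.distrib by (simp add: sum_over_J jet_def sum.distrib)
    qed
    have j: "(i, True) \<in> J" "(i, False) \<in> J" if "i \<in> I" for i using that by (auto simp: J_def)
    have "h2_ip b I g r = (\<Sum>i\<in>I. integral {-b..b} (\<lambda>z. inner (F i z) (dzz b (r i) z) +
        inner (G (i, True) z) (dz b (r i) z) + inner (G (i, False) z) (r i z)))"
      unfolding h2_ip_def by (intro sum.cong refl g(2)) (use r in \<open>auto simp: h2_bc_space_def\<close>)
    also have "\<dots> = integral {-b..b} (\<lambda>z. \<Sum>i\<in>I. inner (F i z) (dzz b (r i) z) +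
        inner (G (i, True) z) (dz b (r i) z) + inner (G (i, False) z) (r i z))"
      using int1 int2[OF j(1)] int2[OF j(2)] I
      by (intro integral_sum[symmetric]) (auto intro!: integrable_add simp: jet_def)
    also have "\<dots> = integral {-b..b} (\<lambda>z. \<Sum>i\<in>I. 2 * inner (op V i z) (dop V r i z) * \<mu> z)"
      by (simp only: pt2)
    also have "\<dots> = first_variation \<mu> V r"
      unfolding first_variation_def by (intro integral_sum I int3)
    finally show "h2_ip b I g r = first_variation \<mu> V r" .
  qed
qed

subsection \<open>Pointwise bounds for the lower-order terms\<close>

lemma coefficient_bound:
  obtains K where "K \<ge> 0" "\<And>i c z. i \<in> I \<Longrightarrow> c \<in> J \<Longrightarrow> z \<in> {-b..b} \<Longrightarrow> cmod (A i c z) \<le> K"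
    "\<And>i c e z. i \<in> I \<Longrightarrow> c \<in> J \<Longrightarrow> e \<in> J \<Longrightarrow> z \<in> {-b..b} \<Longrightarrow> cmod (Q i c e z) \<le> K"
proof -
  have "bounded ((A i c) ` {-b..b})" for i c
    by (intro compact_imp_bounded compact_continuous_image A) auto
  moreover have "bounded ((Q i c e) ` {-b..b})" for i c e
    by (intro compact_imp_bounded compact_continuous_image Q) auto
  ultimately have "bounded ((\<Union>i\<in>I. \<Union>c\<in>J. A i c ` {-b..b}) \<union> (\<Union>i\<in>I. \<Union>c\<in>J. \<Union>e\<in>J. Q i c e ` {-b..b}))"
    using I by (auto intro!: bounded_UN)
  then obtain K where K: "K > 0" "\<And>x. x \<in> (\<Union>i\<in>I. \<Union>c\<in>J. A i c ` {-b..b}) \<union> (\<Union>i\<in>I. \<Union>c\<in>J. \<Union>e\<in>J. Q i c e ` {-b..b}) \<Longrightarrow> norm x \<le> K"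
    by (meson bounded_pos)
  show ?thesis
  proof (rule that)
    show "K \<ge> 0" using K by simp
    show "cmod (A i c z) \<le> K" if "i \<in> I" "c \<in> J" "z \<in> {-b..b}" for i c z
      by (rule K(2), rule UnI1, rule UN_I[OF that(1)], rule UN_I[OF that(2)], rule imageI[OF that(3)])
    show "cmod (Q i c e z) \<le> K" if "i \<in> I" "c \<in> J" "e \<in> J" "z \<in> {-b..b}" for i c e z
      by (rule K(2), rule UnI2, rule UN_I[OF that(1)], rule UN_I[OF that(2)], rule UN_I[OF that(3)], rule imageI[OF that(4)])
  qed
qed

lemma lin_bound:
  assumes "\<And>c. c \<in> J \<Longrightarrow> cmod (A i c z) \<le> K"
  shows "cmod (lin i z (jet b r z)) \<le> K * jet_norm r z"
  unfolding lin_def jet_norm_def sum_distrib_left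
  by (rule order_trans[OF norm_sum sum_mono]) (auto simp: norm_mult intro!: mult_right_mono assms)

lemma quad_bound:
  assumes "\<And>c e. c \<in> J \<Longrightarrow> e \<in> J \<Longrightarrow> cmod (Q i c e z) \<le> K"
  shows "cmod (quad i z (jet b u z) (jet b v z)) \<le> K * jet_norm u z * jet_norm v z"
proof -
  have "cmod (quad i z (jet b u z) (jet b v z)) \<le>
      (\<Sum>c\<in>J. \<Sum>e\<in>J. K * (cmod (jet b u z c) * cmod (jet b v z e)))"
    unfolding quad_def
    by (intro order_trans[OF norm_sum sum_mono]) (auto simp: norm_mult mult.assoc intro!: mult_right_mono assms)
  also have "\<dots> = K * jet_norm u z * jet_norm v z"
    unfolding jet_norm_def mult.assoc sum_product by (simp add: sum_distrib_left)
  finally show ?thesis .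
qed

text \<open>The factor \<open>1 + 1/(2b)\<close> is the constant of \<open>sobolev_sup_bound\<close> on \<open>[-b, b]\<close>; the square of the number of jet variables comes from
  adding up their absolute values.\<close>

definition sobolev_const :: real where "sobolev_const = (real (card J))\<^sup>2 * (1 + 1 / (2 * b))"

lemma sobolev_const_nonneg: "sobolev_const \<ge> 0" using b by (simp add: sobolev_const_def)

lemma h2_ip_nonneg_terms:
  assumes "u \<in> h2_space b I" "i \<in> I"
  shows "(\<lambda>z. (cmod (u i z))\<^sup>2) integrable_on {-b..b}" "(\<lambda>z. (cmod (dz b (u i) z))\<^sup>2) integrable_on {-b..b}"
    "(\<lambda>z. (cmod (dzz b (u i) z))\<^sup>2) integrable_on {-b..b}"
  using sq_integrable_dzz[OF assms] H2_interval_continuous[OF b h2_spaceD[OF assms]]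
    H2_interval_continuous_dz[OF b h2_spaceD[OF assms]]
  by (auto simp: sq_integrable_def intro!: integrable_continuous_real continuous_intros)

lemma h2_ip_self:
  assumes "u \<in> h2_space b I"
  shows "h2_ip b I u u = (\<Sum>i\<in>I. sq_int b (u i) +
    sq_int b (dz b (u i)) + sq_int b (dzz b (u i)))"
  unfolding h2_ip_def power2_norm_eq_inner[symmetric]
  using h2_ip_nonneg_terms[OF assms]
  by (intro sum.cong refl) (simp add: integral_add integrable_add)

lemma h2_ip_single:
  assumes u: "u \<in> h2_space b I" and i: "i \<in> I"
  shows "sq_int b (u i) + sq_int b (dz b (u i)) +
     sq_int b (dzz b (u i)) \<le> h2_ip b I u u"
  unfolding h2_ip_self[OF u]
  by (rule member_le_sum[OF i]) (auto intro!: add_nonneg_nonneg integral_ge_0 h2_ip_nonneg_terms u I)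

lemma h2_ip_self_nonneg: "u \<in> h2_space b I \<Longrightarrow> 0 \<le> h2_ip b I u u"
  unfolding h2_ip_self
  by (auto intro!: sum_nonneg add_nonneg_nonneg integral_ge_0 h2_ip_nonneg_terms)

lemma jet_bound:
  assumes u: "u \<in> h2_space b I" and c: "c \<in> J" and z: "z \<in> {-b..b}"
  shows "(cmod (jet b u z c))\<^sup>2 \<le> (1 + 1 / (2 * b)) * h2_ip b I u u"
proof -
  obtain i e where ce: "c = (i, e)" by force
  with c have i: "i \<in> I" by (simp add: J_def)
  note H = h2_spaceD[OF u i]
  note n = h2_ip_nonneg_terms[OF u i]
  have pos: "sq_int b (u i) \<ge> 0" "sq_int b (dzz b (u i)) \<ge> 0"
    using n by (auto intro!: integral_ge_0)
  have "b - (- b) = 2 * b" by simp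
  have "(cmod (dz b (u i) z))\<^sup>2 \<le> (1 + 1 / (b - (-b))) *
      integral {-b..b} (\<lambda>z. (cmod (dz b (u i) z))\<^sup>2 + (cmod (dzz b (u i) z))\<^sup>2)"
    by (rule sobolev_sup_bound[OF _ H2_interval_primitive_dzz[OF b H] H2_interval_sq_integrable_dzz[OF b H] z]) (use b in simp)
  also have "\<dots> \<le> (1 + 1 / (2 * b)) * h2_ip b I u u"
    unfolding \<open>b - (-b) = 2 * b\<close>
    using h2_ip_single[OF u i] pos b n by (intro mult_left_mono) (auto simp: integral_add)
  finally have 1: "(cmod (dz b (u i) z))\<^sup>2 \<le> (1 + 1 / (2 * b)) * h2_ip b I u u" .
  have "(cmod (u i z))\<^sup>2 \<le> (1 + 1 / (b - (-b))) *
      integral {-b..b} (\<lambda>z. (cmod (u i z))\<^sup>2 + (cmod (dz b (u i) z))\<^sup>2)"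
    by (rule sobolev_sup_bound[OF _ H2_interval_primitive_dz[OF b H]
        sq_integrable_continuous[OF H2_interval_continuous_dz[OF b H]] z]) (use b in simp)
  also have "\<dots> \<le> (1 + 1 / (2 * b)) * h2_ip b I u u"
    unfolding \<open>b - (-b) = 2 * b\<close>
    using h2_ip_single[OF u i] pos b n by (intro mult_left_mono) (auto simp: integral_add)
  finally show ?thesis using 1 ce by (simp add: jet_def)
qed

lemma jet_norm_bound:
  assumes "u \<in> h2_space b I" "z \<in> {-b..b}"
  shows "(jet_norm u z)\<^sup>2 \<le> sobolev_const * h2_ip b I u u"
  unfolding jet_norm_def sobolev_const_def mult.assoc
  by (rule sum_power2_le) (use jet_bound assms in auto)

text \<open>The bound \<open>2s\<close> for \<open>r\<close> is what one gets when both \<open>V\<close> and \<open>V + r\<close> are bounded by \<open>s\<close>.\<close>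

lemma lower_terms_bound:
  assumes K: "K \<ge> 0" "\<And>c. c \<in> J \<Longrightarrow> cmod (A i c z) \<le> K"
    "\<And>c e. c \<in> J \<Longrightarrow> e \<in> J \<Longrightarrow> cmod (Q i c e z) \<le> K"
    and s: "jet_norm V z \<le> s" "jet_norm r z \<le> 2 * s"
  shows "cmod (dop_lower V r i z + qrem r i z) \<le> K * (1 + 4 * s) * jet_norm r z"
proof -
  have "cmod (dop_lower V r i z + qrem r i z) \<le> cmod (lin i z (jet b r z)) + cmod (quad i z (jet b V z) (jet b r z))
      + cmod (quad i z (jet b r z) (jet b V z)) + cmod (quad i z (jet b r z) (jet b r z))"
    unfolding dop_lower_def qrem_def by (intro order_trans[OF norm_triangle_ineq] add_mono order_refl)
  also have "\<dots> \<le> K * jet_norm r z + K * jet_norm V z * jet_norm r z + K * jet_norm r z * jet_norm V z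
      + K * jet_norm r z * jet_norm r z"
    by (intro add_mono lin_bound quad_bound K)
  also have "\<dots> = K * (1 + 2 * jet_norm V z + jet_norm r z) * jet_norm r z"
    by (simp add: algebra_simps)
  also have "\<dots> \<le> K * (1 + 4 * s) * jet_norm r z"
    using s K by (intro mult_right_mono mult_left_mono) auto
  finally show ?thesis .
qed

lemma qrem_bound:
  assumes "\<And>c e. c \<in> J \<Longrightarrow> e \<in> J \<Longrightarrow> cmod (Q i c e z) \<le> K"
  shows "cmod (qrem r i z) \<le> K * (jet_norm r z)\<^sup>2"
  unfolding qrem_def using quad_bound[OF assms, where u=r and v=r] by (simp add: power2_eq_square mult.assoc)

subsection \<open>The remainder is quadratic\<close>

lemma remainder_integrable:
  assumes "V \<in> h2_space b I" "r \<in> h2_space b I" "i \<in> I" "continuous_on {-b..b} \<mu>"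
  shows "(\<lambda>z. remainder_density V r i z * \<mu> z) integrable_on {-b..b}"
proof -
  have "sq_integrable (-b) b (qrem r i)"
    by (intro sq_integrable_continuous continuous_on_qrem assms)
  then have "(\<lambda>z. 2 * inner (op V i z) (qrem r i z) * \<mu> z + (cmod (dop V r i z + qrem r i z))\<^sup>2 * \<mu> z) integrable_on {-b..b}"
    by (intro integrable_add sq_integrable_weighted_square sq_integrable_weighted_inner sq_integrable_add
        sq_integrable_op sq_integrable_dop assms)
  then show ?thesis by (simp add: distrib_right)
qed

lemma norm_op_integrable:
  assumes "V \<in> h2_space b I" "i \<in> I"
  shows "(\<lambda>z. cmod (op V i z)) integrable_on {-b..b}" "(\<lambda>z. (cmod (op V i z))\<^sup>2) integrable_on {-b..b}"
  using sq_integrable_op[OF assms] by (auto simp: sq_integrable_def absolutely_integrable_on_def)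

text \<open>The Sobolev bound controls the squared jet of \<open>r\<close> uniformly by the squared norm of \<open>r\<close>. The factor \<open>L(V)\<close>, which is merely
  integrable, multiplies only \<open>Q(r)\<close>, and this is quadratic in the jet.\<close>

lemma remainder_quadratic_bound:
  assumes V: "V \<in> h2_space b I" and \<mu>: "continuous_on {-b..b} \<mu>"
  shows "\<exists>C\<ge>0. \<forall>r\<in>h2_space b I. h2_ip b I r r \<le> 1 \<longrightarrow> \<bar>remainder \<mu> V r\<bar> \<le> C * h2_ip b I r r"
proof -
  obtain K where K: "K \<ge> 0" "\<And>i c z. i \<in> I \<Longrightarrow> c \<in> J \<Longrightarrow> z \<in> {-b..b} \<Longrightarrow> cmod (A i c z) \<le> K"
    "\<And>i c e z. i \<in> I \<Longrightarrow> c \<in> J \<Longrightarrow> e \<in> J \<Longrightarrow> z \<in> {-b..b} \<Longrightarrow> cmod (Q i c e z) \<le> K"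
    using coefficient_bound by metis
  have "bounded (\<mu> ` {-b..b})"
    by (intro compact_imp_bounded compact_continuous_image \<mu>) auto
  then obtain B where B: "B > 0" "\<And>z. z \<in> {-b..b} \<Longrightarrow> \<bar>\<mu> z\<bar> \<le> B"
    by (metis bounded_pos imageI real_norm_def)
  define s where "s = sqrt (sobolev_const * h2_ip b I V V) + sqrt sobolev_const"
  have s0: "s \<ge> 0" using sobolev_const_nonneg h2_ip_self_nonneg[OF V] by (simp add: s_def)
  define P where "P = K * (1 + 4 * s)"
  have P0: "P \<ge> 0" using K s0 by (simp add: P_def)
  \<comment> \<open>The first sum comes from the product of \<open>L(V)\<close> and \<open>Q(r)\<close>, the rest from the square of the linearised operator.\<close>
  define C where "C = (\<Sum>i\<in>I. integral {-b..b} (\<lambda>z. 2 * (K * sobolev_const) * cmod (op V i z) * B)) +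
      (2 * B + card I * (2 * b * (2 * P\<^sup>2 * sobolev_const * B)))"
  have C0: "C \<ge> 0"
    unfolding C_def using K B b sobolev_const_nonneg V
    by (intro add_nonneg_nonneg sum_nonneg mult_nonneg_nonneg integral_ge_0
        integrable_on_mult_right integrable_on_mult_left norm_op_integrable) auto
  show ?thesis
  proof (intro exI[of _ C] conjI ballI impI C0)
    fix r assume r: "r \<in> h2_space b I" and r1: "h2_ip b I r r \<le> 1"
    define N where "N = h2_ip b I r r"
    have N0: "N \<ge> 0" using h2_ip_self_nonneg[OF r] by (simp add: N_def)
    have ii: "\<bar>integral {-b..b} (\<lambda>z. remainder_density V r i z * \<mu> z)\<bar>
      \<le> N * integral {-b..b} (\<lambda>z. 2 * (K * sobolev_const) * cmod (op V i z) * B)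
        + (2 * B * sq_int b (dzz b (r i)) + N * (2 * b * (2 * P\<^sup>2 * sobolev_const * B)))"
      if i: "i \<in> I" for i
    proof -
      have i1: "(\<lambda>z. 2 * (K * sobolev_const) * cmod (op V i z) * B) integrable_on {-b..b}"
        by (intro integrable_on_mult_left integrable_on_mult_right norm_op_integrable V i)
      note i2 = h2_ip_nonneg_terms(3)[OF r i]
      have "norm (integral {-b..b} (\<lambda>z. remainder_density V r i z * \<mu> z))
        \<le> integral {-b..b} (\<lambda>z. N * (2 * (K * sobolev_const) * cmod (op V i z) * B)
            + (2 * B * (cmod (dzz b (r i) z))\<^sup>2 + N * (2 * P\<^sup>2 * sobolev_const * B)))"
      proof (rule integral_norm_bound_integral)
        show "(\<lambda>z. remainder_density V r i z * \<mu> z) integrable_on {-b..b}"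
          by (rule remainder_integrable[OF V r i \<mu>])
        show "(\<lambda>z. N * (2 * (K * sobolev_const) * cmod (op V i z) * B)
            + (2 * B * (cmod (dzz b (r i) z))\<^sup>2 + N * (2 * P\<^sup>2 * sobolev_const * B))) integrable_on {-b..b}"
          by (intro integrable_add integrable_on_mult_right[OF i1] integrable_on_mult_right[OF i2] integrable_const_ivl)
        fix z assume z: "z \<in> {-b..b}"
        have nr: "(jet_norm r z)\<^sup>2 \<le> sobolev_const * N" unfolding N_def by (rule jet_norm_bound[OF r z])
        have "(jet_norm r z)\<^sup>2 \<le> sobolev_const" using nr r1 sobolev_const_nonneg N0 mult_left_le[of N sobolev_const] by (simp add: N_def)
        then have "jet_norm r z \<le> sqrt sobolev_const" by (rule real_le_rsqrt)
        moreover have "jet_norm V z \<le> sqrt (sobolev_const * h2_ip b I V V)"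
          by (rule real_le_rsqrt[OF jet_norm_bound[OF V z]])
        moreover have "sqrt sobolev_const \<le> s" "sqrt (sobolev_const * h2_ip b I V V) \<le> s"
          using sobolev_const_nonneg h2_ip_self_nonneg[OF V] by (simp_all add: s_def)
        ultimately have s: "jet_norm V z \<le> s" "jet_norm r z \<le> 2 * s"
          using s0 by linarith+
        have q: "cmod (qrem r i z) \<le> K * sobolev_const * N"
          using order_trans[OF qrem_bound mult_left_mono[OF nr K(1)]] K(3)[OF i _ _ z] by (simp add: mult.assoc)
        have "cmod (dop_lower V r i z + qrem r i z) \<le> P * jet_norm r z"
          unfolding P_def by (rule lower_terms_bound) (use K i z s in auto)
        then have "(cmod (dop_lower V r i z + qrem r i z))\<^sup>2 \<le> (P * jet_norm r z)\<^sup>2"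
          by (rule power_mono) simp
        also have "\<dots> \<le> P\<^sup>2 * (sobolev_const * N)"
          unfolding power_mult_distrib by (rule mult_left_mono[OF nr]) simp
        finally have d: "(cmod (dop V r i z + qrem r i z))\<^sup>2 \<le> 2 * (cmod (dzz b (r i) z))\<^sup>2 + 2 * (P\<^sup>2 * (sobolev_const * N))"
          using square_norm_add_le[of "dzz b (r i) z" "dop_lower V r i z + qrem r i z"]
          by (simp add: dop_def add.assoc)
        have "\<bar>2 * inner (op V i z) (qrem r i z)\<bar> \<le> 2 * (cmod (op V i z) * (K * sobolev_const * N))"
          using Cauchy_Schwarz_ineq2[of "op V i z" "qrem r i z"] mult_left_mono[OF q, of "cmod (op V i z)"] by simp
        then have "\<bar>remainder_density V r i z\<bar>
          \<le> 2 * (cmod (op V i z) * (K * sobolev_const * N)) + (2 * (cmod (dzz b (r i) z))\<^sup>2 + 2 * (P\<^sup>2 * (sobolev_const * N)))"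
          using d order_trans[OF abs_triangle_ineq add_mono] by (metis abs_power2 order_refl)
        then have "\<bar>remainder_density V r i z\<bar> * \<bar>\<mu> z\<bar>
          \<le> (2 * (cmod (op V i z) * (K * sobolev_const * N)) + (2 * (cmod (dzz b (r i) z))\<^sup>2 + 2 * (P\<^sup>2 * (sobolev_const * N)))) * B"
          by (rule mult_mono[OF _ B(2)[OF z]]) (use K sobolev_const_nonneg N0 in auto)
        moreover have "(2 * (cmod (op V i z) * (K * sobolev_const * N)) + (2 * (cmod (dzz b (r i) z))\<^sup>2 + 2 * (P\<^sup>2 * (sobolev_const * N)))) * B
            = N * (2 * (K * sobolev_const) * cmod (op V i z) * B) + (2 * B * (cmod (dzz b (r i) z))\<^sup>2 + N * (2 * P\<^sup>2 * sobolev_const * B))"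
          by (simp add: algebra_simps)
        ultimately show "norm (remainder_density V r i z * \<mu> z)
            \<le> N * (2 * (K * sobolev_const) * cmod (op V i z) * B) + (2 * B * (cmod (dzz b (r i) z))\<^sup>2 + N * (2 * P\<^sup>2 * sobolev_const * B))"
          by (simp only: real_norm_def abs_mult)
      qed
      also have "\<dots> = N * integral {-b..b} (\<lambda>z. 2 * (K * sobolev_const) * cmod (op V i z) * B)
        + (2 * B * sq_int b (dzz b (r i)) + N * (2 * b * (2 * P\<^sup>2 * sobolev_const * B)))"
      proof -
        have *: "integral {-b..b} (\<lambda>z. N * f z + (2 * B * g z + k)) =
            N * integral {-b..b} f + (2 * B * integral {-b..b} g + 2 * b * k)"
          if "f integrable_on {-b..b}" "g integrable_on {-b..b}" for f g :: "real \<Rightarrow> real" and k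
        proof -
          have "((\<lambda>z. k) has_integral 2 * b * k) {-b..b}"
            using has_integral_const_real[of k "-b" b] b by simp
          then have "((\<lambda>z. N * f z + (2 * B * g z + k)) has_integral N * integral {-b..b} f +
              (2 * B * integral {-b..b} g + 2 * b * k)) {-b..b}"
            by (intro has_integral_add has_integral_mult_right integrable_integral that)
          then show ?thesis by (rule integral_unique)
        qed
        show ?thesis
          by (subst *[OF i1 i2]) (simp add: mult_ac)
      qed
      finally show ?thesis by simp
    qed
    have dz: "(\<Sum>i\<in>I. sq_int b (dzz b (r i))) \<le> N"
      unfolding N_def h2_ip_self[OF r]
      by (rule sum_mono) (auto intro!: add_nonneg_nonneg integral_ge_0 h2_ip_nonneg_terms[OF r])
    have "\<bar>remainder \<mu> V r\<bar> \<le> (\<Sum>i\<in>I. N * integral {-b..b} (\<lambda>z. 2 * (K * sobolev_const) * cmod (op V i z) * B)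
        + (2 * B * sq_int b (dzz b (r i)) + N * (2 * b * (2 * P\<^sup>2 * sobolev_const * B))))"
      unfolding remainder_def by (rule order_trans[OF sum_abs sum_mono[OF ii]])
    also have "\<dots> = N * (\<Sum>i\<in>I. integral {-b..b} (\<lambda>z. 2 * (K * sobolev_const) * cmod (op V i z) * B))
        + (2 * B * (\<Sum>i\<in>I. sq_int b (dzz b (r i))) + N * (card I * (2 * b * (2 * P\<^sup>2 * sobolev_const * B))))"
      by (simp only: sum.distrib sum_distrib_left[symmetric] sum_constant mult.left_commute)
    also have "\<dots> \<le> N * (\<Sum>i\<in>I. integral {-b..b} (\<lambda>z. 2 * (K * sobolev_const) * cmod (op V i z) * B))
        + (2 * B * N + N * (card I * (2 * b * (2 * P\<^sup>2 * sobolev_const * B))))"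
      using mult_left_mono[OF dz, of "2 * B"] B by simp
    also have "\<dots> = C * N"
      unfolding C_def by (simp only: distrib_right distrib_left mult_ac)
    finally show "\<bar>remainder \<mu> V r\<bar> \<le> C * h2_ip b I r r" by (simp add: N_def)
  qed
qed

subsection \<open>Weighted control of lower-order terms by the second derivative\<close>

lemma energy_term_nonneg:
  assumes "r \<in> h2_space b I" "i \<in> I" "continuous_on {-b..b} \<mu>" "\<And>z. z \<in> {-b..b} \<Longrightarrow> \<mu> z \<ge> 0"
  shows "0 \<le> weighted_sq b \<mu> (dzz b (r i))"
  by (intro integral_ge_0 sq_integrable_weighted_square sq_integrable_dzz assms)
     (use assms in auto)

lemma energy_single_le:
  assumes "r \<in> h2_space b I" "i \<in> I" "continuous_on {-b..b} \<mu>" "\<And>z. z \<in> {-b..b} \<Longrightarrow> \<mu> z \<ge> 0"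
  shows "weighted_sq b \<mu> (dzz b (r i)) \<le> energy \<mu> r"
  unfolding energy_def
  by (rule member_le_sum[OF assms(2)]) (use energy_term_nonneg[OF assms(1) _ assms(3,4)] I in auto)

lemma energy_nonneg:
  assumes "r \<in> h2_space b I" "continuous_on {-b..b} \<mu>" "\<And>z. z \<in> {-b..b} \<Longrightarrow> \<mu> z \<ge> 0"
  shows "0 \<le> energy \<mu> r"
  unfolding energy_def by (intro sum_nonneg energy_term_nonneg assms)

text \<open>Applying the first-order estimate to \<open>r'\<close> and then to \<open>r\<close> gains a power of \<open>\<kappa>\<close> each time a derivative is removed: the
  supremum form for the last step, the integral form before it. The cubic gain for \<open>r\<close> is the one that the Carleman estimate requires.\<close>

lemma weighted_bounds:
  fixes \<theta> lam :: real
  assumes r: "r \<in> h2_space b I" and z0: "zero_cauchy b I r" and i: "i \<in> I"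
    and \<theta>: "\<theta> > b" and lam: "lam > 0" and z: "z \<in> {-b..b}"
  defines "\<mu> \<equiv> carleman_weight \<theta> lam" and "\<kappa> \<equiv> lam * (\<theta> - b)"
  shows "(cmod (dz b (r i) z))\<^sup>2 * \<mu> z \<le> weighted_sq b \<mu> (dzz b (r i)) / (2 * \<kappa>)"
    "(cmod (r i z))\<^sup>2 * \<mu> z \<le> weighted_sq b \<mu> (dzz b (r i)) / (8 * \<kappa> ^ 3)"
proof -
  have \<kappa>: "\<kappa> > 0" using lam \<theta> by (simp add: \<kappa>_def)
  note H = h2_spaceD[OF r i]
  have 0: "r i (-b) = 0" "dz b (r i) (-b) = 0" using z0 i by (auto simp: zero_cauchy_def)
  note e1 = weighted_first_order_estimate[OF b \<theta> lam H2_interval_primitive_dzz[OF b H]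
      H2_interval_sq_integrable_dzz[OF b H] 0(2), folded \<mu>_def \<kappa>_def]
  note e2 = weighted_first_order_estimate(1)[OF b \<theta> lam H2_interval_primitive_dz[OF b H]
      sq_integrable_continuous[OF H2_interval_continuous_dz[OF b H]] 0(1) z, folded \<mu>_def \<kappa>_def]
  show "(cmod (dz b (r i) z))\<^sup>2 * \<mu> z \<le> weighted_sq b \<mu> (dzz b (r i)) / (2 * \<kappa>)" by (rule e1(1)[OF z])
  have "weighted_sq b \<mu> (dz b (r i)) / (2 * \<kappa>) \<le> weighted_sq b \<mu> (dzz b (r i)) / (4 * \<kappa>\<^sup>2) / (2 * \<kappa>)"
    using e1(2) \<kappa> by (intro divide_right_mono) auto
  also have "\<dots> = weighted_sq b \<mu> (dzz b (r i)) / (8 * \<kappa> ^ 3)"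
    by (simp add: power2_eq_square power3_eq_cube)
  finally show "(cmod (r i z))\<^sup>2 * \<mu> z \<le> weighted_sq b \<mu> (dzz b (r i)) / (8 * \<kappa> ^ 3)"
    using e2 by linarith
qed

lemma jet_norm_weighted_bound:
  fixes \<theta> lam :: real
  assumes r: "r \<in> h2_space b I" and z0: "zero_cauchy b I r"
    and \<theta>: "\<theta> > b" and lam: "lam > 0" and \<kappa>1: "lam * (\<theta> - b) \<ge> 1" and z: "z \<in> {-b..b}"
  defines "\<mu> \<equiv> carleman_weight \<theta> lam"
  shows "(jet_norm r z)\<^sup>2 * \<mu> z \<le> (real (card J))\<^sup>2 * (energy \<mu> r / (2 * (lam * (\<theta> - b))))"
proof -
  define \<kappa> where "\<kappa> = lam * (\<theta> - b)"
  have \<kappa>: "\<kappa> \<ge> 1" using \<kappa>1 by (simp add: \<kappa>_def)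
  have \<mu>: "continuous_on {-b..b} \<mu>" "\<And>z. \<mu> z > 0" unfolding \<mu>_def by (simp_all add: continuous_on_carleman_weight)
  have E: "energy \<mu> r \<ge> 0" using energy_nonneg[OF r \<mu>(1)] \<mu>(2) less_imp_le by blast
  have c: "(cmod (jet b r z c))\<^sup>2 \<le> energy \<mu> r / (2 * \<kappa>) / \<mu> z" if c: "c \<in> J" for c
  proof -
    obtain i e where ce: "c = (i, e)" and i: "i \<in> I" using c by (auto simp: J_def)
    define Y where "Y = weighted_sq b \<mu> (dzz b (r i))"
    have Y: "0 \<le> Y" "Y \<le> energy \<mu> r"
      unfolding Y_def using energy_single_le[OF r i \<mu>(1)] energy_term_nonneg[OF r i \<mu>(1)] \<mu>(2) less_imp_le by blast+
    note w = weighted_bounds[OF r z0 i \<theta> lam z, folded \<mu>_def, folded Y_def \<kappa>_def]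
    have "1 \<le> \<kappa>\<^sup>2" using \<kappa> by (simp add: one_le_power)
    then have "2 * \<kappa> * 1 \<le> 2 * \<kappa> * (4 * \<kappa>\<^sup>2)" using \<kappa> by (intro mult_left_mono) linarith+
    then have "Y / (8 * \<kappa> ^ 3) \<le> Y / (2 * \<kappa>)"
      using Y \<kappa> by (intro divide_left_mono) (auto simp: power2_eq_square power3_eq_cube)
    then have "(cmod (jet b r z c))\<^sup>2 * \<mu> z \<le> Y / (2 * \<kappa>)"
      using w ce by (cases e) (auto simp: jet_def)
    also have "\<dots> \<le> energy \<mu> r / (2 * \<kappa>)"
      using Y \<kappa> by (intro divide_right_mono) auto
    finally show ?thesis by (rule pos_le_divide_eq[THEN iffD2, OF \<mu>(2)])
  qed
  have "(jet_norm r z)\<^sup>2 \<le> (real (card J))\<^sup>2 * (energy \<mu> r / (2 * \<kappa>) / \<mu> z)"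
    unfolding jet_norm_def by (rule sum_power2_le[OF _ c]) auto
  then have "(jet_norm r z)\<^sup>2 * \<mu> z \<le> (real (card J))\<^sup>2 * (energy \<mu> r / (2 * \<kappa>) / \<mu> z) * \<mu> z"
    using \<mu>(2)[of z] by (intro mult_right_mono) auto
  then show ?thesis using \<mu>(2)[of z] by (simp add: \<kappa>_def less_imp_neq[symmetric])
qed

text \<open>The weight is bounded below by its value at the right end point, so the squared norm is at most its weighted version divided by
  this value; the lower-order parts of the weighted version are bounded by the second-order part.\<close>

lemma h2_ip_le_energy:
  fixes \<theta> lam :: real
  assumes r: "r \<in> h2_space b I" and z0: "zero_cauchy b I r"
    and \<theta>: "\<theta> > b" and lam: "lam > 0" and \<kappa>: "lam * (\<theta> - b) \<ge> 1" "lam * (\<theta> - b) \<ge> b"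
  shows "exp (2 * lam * (b - \<theta>)\<^sup>2) * h2_ip b I r r \<le> 3 * energy (carleman_weight \<theta> lam) r"
proof -
  define \<mu> where "\<mu> = carleman_weight \<theta> lam"
  define \<kappa> where "\<kappa> = lam * (\<theta> - b)"
  define e where "e = exp (2 * lam * (b - \<theta>)\<^sup>2)"
  have \<kappa>1: "\<kappa> \<ge> 1" "\<kappa> \<ge> b" using \<kappa> by (simp_all add: \<kappa>_def)
  have \<mu>: "continuous_on {-b..b} \<mu>" "\<And>z. \<mu> z > 0" unfolding \<mu>_def by (simp_all add: continuous_on_carleman_weight)
  have "e * (sq_int b (r i) + sq_int b (dz b (r i)) + sq_int b (dzz b (r i))) \<le> 3 * weighted_sq b \<mu> (dzz b (r i))"
    if i: "i \<in> I" for i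
  proof -
    define Y where "Y = weighted_sq b \<mu> (dzz b (r i))"
    have Y: "0 \<le> Y" unfolding Y_def using energy_term_nonneg[OF r i \<mu>(1)] \<mu>(2) less_imp_le by blast
    have iY: "(\<lambda>z. (cmod (dzz b (r i) z))\<^sup>2 * \<mu> z) integrable_on {-b..b}"
      by (intro sq_integrable_weighted_square sq_integrable_dzz r i \<mu>)
    have c: "((\<lambda>z. Y / \<kappa>) has_integral 2 * b * (Y / \<kappa>)) {-b..b}"
      using has_integral_const_real[of "Y / \<kappa>" "-b" b] b by simp
    have "e * (sq_int b (r i) + sq_int b (dz b (r i)) + sq_int b (dzz b (r i))) \<le> Y + 2 * b * (Y / \<kappa>)"
    proof (rule has_integral_le[OF has_integral_mult_right[OF has_integral_add[OF has_integral_add]] has_integral_add[OF _ c]])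
      show "((\<lambda>z. (cmod (dzz b (r i) z))\<^sup>2 * \<mu> z) has_integral Y) {-b..b}"
        unfolding Y_def by (rule integrable_integral[OF iY])
      fix z assume z: "z \<in> {-b..b}"
      note w = weighted_bounds[OF r z0 i \<theta> lam z, folded \<mu>_def, folded Y_def \<kappa>_def]
      have "e \<le> \<mu> z"
        unfolding e_def \<mu>_def by (rule carleman_weight_lower_bound[OF lam \<theta>]) (use z in auto)
      then have "e * ((cmod (r i z))\<^sup>2 + (cmod (dz b (r i) z))\<^sup>2 + (cmod (dzz b (r i) z))\<^sup>2)
        \<le> \<mu> z * ((cmod (r i z))\<^sup>2 + (cmod (dz b (r i) z))\<^sup>2 + (cmod (dzz b (r i) z))\<^sup>2)"
        by (rule mult_right_mono) simp
      moreover have "Y / (8 * \<kappa> ^ 3) \<le> Y / (2 * \<kappa>)"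
      proof -
        have "1 \<le> \<kappa>\<^sup>2" using \<kappa>1 by (simp add: one_le_power)
        then have "2 * \<kappa> * 1 \<le> 2 * \<kappa> * (4 * \<kappa>\<^sup>2)" using \<kappa>1 by (intro mult_left_mono) linarith+
        then show ?thesis
          using Y \<kappa>1 by (intro divide_left_mono) (auto simp: power2_eq_square power3_eq_cube)
      qed
      moreover have "Y / \<kappa> = Y / (2 * \<kappa>) + Y / (2 * \<kappa>)" by simp
      ultimately show "e * ((cmod (r i z))\<^sup>2 + (cmod (dz b (r i) z))\<^sup>2 + (cmod (dzz b (r i) z))\<^sup>2)
        \<le> (cmod (dzz b (r i) z))\<^sup>2 * \<mu> z + Y / \<kappa>"
        using w unfolding distrib_left mult.commute[of "\<mu> z"] by linarith
    qed (rule integrable_integral, rule h2_ip_nonneg_terms[OF r i])+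
    also have "2 * b * (Y / \<kappa>) \<le> 2 * Y"
      using mult_right_mono[OF \<kappa>1(2) Y] \<kappa>1(1) by (simp add: field_simps)
    finally show ?thesis by (simp add: Y_def)
  qed
  then have "e * h2_ip b I r r \<le> 3 * energy \<mu> r"
    unfolding h2_ip_self[OF r] energy_def sum_distrib_left by (rule sum_mono)
  then show ?thesis by (simp add: e_def \<mu>_def)
qed

text \<open>The absorption argument: an integrand that falls short of half the energy density by at most a multiple of
  \<open>Y/\<kappa>\<close> integrates to at least \<open>Y/4\<close> once \<open>\<kappa>\<close> is large. The function \<open>m\<close> stands for a factor that is bounded in the mean only.\<close>

lemma quarter_energy_le_sum:
  fixes F m :: "'i \<Rightarrow> real \<Rightarrow> real"
  assumes r: "r \<in> h2_space b I" and \<mu>: "continuous_on {-b..b} \<mu>" "\<And>z. \<mu> z > 0"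
    and \<kappa>: "\<kappa> > 0" and G: "G = (real (card J))\<^sup>2 * (energy \<mu> r / (2 * \<kappa>))" and k1: "k1 \<ge> 0"
    and F: "\<And>i. i \<in> I \<Longrightarrow> F i integrable_on {-b..b}"
    and m: "\<And>i. i \<in> I \<Longrightarrow> m i integrable_on {-b..b}" "\<And>i. i \<in> I \<Longrightarrow> integral {-b..b} (m i) \<le> E"
    and le: "\<And>i z. i \<in> I \<Longrightarrow> z \<in> {-b..b} \<Longrightarrow> (cmod (dzz b (r i) z))\<^sup>2 * \<mu> z / 2 - G * (k0 + k1 * m i z) \<le> F i z"
    and H: "2 * (real (card I) * (2 * b * k0 + k1 * E) * (real (card J))\<^sup>2) \<le> \<kappa>"
  shows "energy \<mu> r / 4 \<le> (\<Sum>i\<in>I. integral {-b..b} (F i))"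
proof -
  define Y where "Y = energy \<mu> r"
  have Y: "Y \<ge> 0" unfolding Y_def using energy_nonneg[OF r \<mu>(1)] \<mu>(2) less_imp_le by blast
  then have G0: "G \<ge> 0" using \<kappa> by (simp add: G Y_def)
  have "weighted_sq b \<mu> (dzz b (r i)) / 2 - G * (2 * b * k0 + k1 * E) \<le> integral {-b..b} (F i)" if i: "i \<in> I" for i
  proof -
    have iY: "(\<lambda>z. (cmod (dzz b (r i) z))\<^sup>2 * \<mu> z) integrable_on {-b..b}"
      by (intro sq_integrable_weighted_square sq_integrable_dzz r i \<mu>)
    have "((\<lambda>z. k0) has_integral 2 * b * k0) {-b..b}"
      using has_integral_const_real[of k0 "-b" b] b by simp
    then have hi: "((\<lambda>z. (cmod (dzz b (r i) z))\<^sup>2 * \<mu> z / 2 - G * (k0 + k1 * m i z)) has_integral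
        weighted_sq b \<mu> (dzz b (r i)) / 2 - G * (2 * b * k0 + k1 * integral {-b..b} (m i))) {-b..b}"
      by (intro has_integral_diff has_integral_divide has_integral_mult_right has_integral_add integrable_integral iY m i)
    have "G * (2 * b * k0 + k1 * integral {-b..b} (m i)) \<le> G * (2 * b * k0 + k1 * E)"
      by (intro mult_left_mono add_left_mono m(2)[OF i] G0 k1)
    then show ?thesis
      using has_integral_le[OF hi integrable_integral[OF F[OF i]] le[OF i]] by linarith
  qed
  then have "(\<Sum>i\<in>I. weighted_sq b \<mu> (dzz b (r i)) / 2 - G * (2 * b * k0 + k1 * E)) \<le> (\<Sum>i\<in>I. integral {-b..b} (F i))"
    by (rule sum_mono)
  then have "Y / 2 - card I * (G * (2 * b * k0 + k1 * E)) \<le> (\<Sum>i\<in>I. integral {-b..b} (F i))"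
    unfolding Y_def energy_def sum_subtractf sum_divide_distrib sum_constant .
  moreover have "card I * (G * (2 * b * k0 + k1 * E)) =
      2 * (real (card I) * (2 * b * k0 + k1 * E) * (real (card J))\<^sup>2) * Y / (4 * \<kappa>)"
    by (simp add: G Y_def)
  moreover have "\<dots> \<le> \<kappa> * Y / (4 * \<kappa>)"
    using H Y \<kappa> by (intro divide_right_mono mult_right_mono) auto
  moreover have "\<kappa> * Y / (4 * \<kappa>) = Y / 4" using \<kappa> by simp
  ultimately show ?thesis unfolding Y_def by linarith
qed

text \<open>The remainder density is at least \<open>|r''|\<^sup>2/2\<close> minus the square of the lower-order terms minus \<open>2|L(V)| |Q(r)|\<close>. On the ball both
  subtracted terms are bounded by the weighted squared jet of \<open>r\<close>, hence by \<open>Y/\<kappa>\<close>, the second one with the factor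
  \<open>|L(V)|\<close>, whose integral is bounded on the ball.\<close>

lemma remainder_coercive:
  assumes \<theta>: "\<theta> > b" and M: "M \<ge> 0"
  shows "\<exists>lam1>1. \<forall>lam\<ge>lam1. \<forall>V\<in>h2_space b I. \<forall>r\<in>h2_space b I.
    zero_cauchy b I r \<longrightarrow> h2_ip b I V V \<le> M \<longrightarrow> h2_ip b I (sd_plus V r) (sd_plus V r) \<le> M \<longrightarrow>
    exp (2 * lam * (b - \<theta>)\<^sup>2) / 12 * h2_ip b I r r \<le> remainder (carleman_weight \<theta> lam) V r"
proof -
  obtain K where K: "K \<ge> 0" "\<And>i c z. i \<in> I \<Longrightarrow> c \<in> J \<Longrightarrow> z \<in> {-b..b} \<Longrightarrow> cmod (A i c z) \<le> K"
    "\<And>i c e z. i \<in> I \<Longrightarrow> c \<in> J \<Longrightarrow> e \<in> J \<Longrightarrow> z \<in> {-b..b} \<Longrightarrow> cmod (Q i c e z) \<le> K"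
    using coefficient_bound by metis
  define s where "s = sqrt (sobolev_const * M)"
  have s0: "s \<ge> 0" using sobolev_const_nonneg M by (simp add: s_def)
  define P where "P = K * (1 + 4 * s)"
  define T where "T = K * s + K * s * s"
  define E where "E = 2 * b + 2 * M + 2 * b * (2 * T\<^sup>2)"
  have P0: "P \<ge> 0" and T0: "T \<ge> 0" using K s0 by (auto simp: P_def T_def)
  have E0: "E \<ge> 0" using b M by (simp add: E_def)
  define H where "H = real (card I) * (2 * b * P\<^sup>2 + 2 * K * E) * (real (card J))\<^sup>2"
  have H0: "H \<ge> 0" unfolding H_def using b K E0 by (intro mult_nonneg_nonneg add_nonneg_nonneg) auto
  \<comment> \<open>Chosen such that \<open>\<kappa> \<ge> 2H + 1 + b\<close>: the summand \<open>2H\<close> is for the absorption, \<open>1\<close> and \<open>b\<close> are for \<open>h2_ip_le_energy\<close>.\<close>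
  define lam1 where "lam1 = max 2 ((2 * H + 1 + b) / (\<theta> - b))"
  show ?thesis
  proof (intro exI[of _ lam1] conjI allI impI ballI)
    show "lam1 > 1" by (simp add: lam1_def)
    fix lam V r
    assume lam1: "lam \<ge> lam1" and V: "V \<in> h2_space b I" and r: "r \<in> h2_space b I" and z0: "zero_cauchy b I r"
      and VM: "h2_ip b I V V \<le> M" and VrM: "h2_ip b I (sd_plus V r) (sd_plus V r) \<le> M"
    define \<mu> where "\<mu> = carleman_weight \<theta> lam"
    define \<kappa> where "\<kappa> = lam * (\<theta> - b)"
    have lam: "lam > 0" using lam1 by (simp add: lam1_def)
    have "(2 * H + 1 + b) / (\<theta> - b) \<le> lam" using lam1 by (simp add: lam1_def)
    then have \<kappa>H: "2 * H + 1 + b \<le> \<kappa>" using \<theta> by (simp add: \<kappa>_def pos_divide_le_eq)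
    then have \<kappa>: "\<kappa> \<ge> 1" "\<kappa> \<ge> b" "\<kappa> > 0" using H0 b by auto
    have \<mu>: "continuous_on {-b..b} \<mu>" "\<And>z. \<mu> z > 0" unfolding \<mu>_def by (simp_all add: continuous_on_carleman_weight)
    define Y where "Y = energy \<mu> r"
    have Y0: "Y \<ge> 0" unfolding Y_def using energy_nonneg[OF r \<mu>(1)] \<mu>(2) less_imp_le by blast
    define G where "G = (real (card J))\<^sup>2 * (Y / (2 * \<kappa>))"
    have G0: "G \<ge> 0" using Y0 \<kappa> by (simp add: G_def)
    have nG: "(jet_norm r z)\<^sup>2 * \<mu> z \<le> G" if "z \<in> {-b..b}" for z
      unfolding G_def Y_def \<kappa>_def \<mu>_def
      by (rule jet_norm_weighted_bound[OF r z0 \<theta> lam _ that]) (use \<kappa> in \<open>simp add: \<kappa>_def\<close>)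
    have jV: "jet_norm V z \<le> s" if "z \<in> {-b..b}" for z
      unfolding s_def
      by (rule real_le_rsqrt) (use jet_norm_bound[OF V that] mult_left_mono[OF VM sobolev_const_nonneg] in linarith)
    have jVr: "jet_norm (sd_plus V r) z \<le> s" if "z \<in> {-b..b}" for z
      unfolding s_def
      by (rule real_le_rsqrt) (use jet_norm_bound[OF h2_space_plus[OF V r] that] mult_left_mono[OF VrM sobolev_const_nonneg] in linarith)
    have jr: "jet_norm r z \<le> 2 * s" if z: "z \<in> {-b..b}" for z
    proof -
      have "jet_norm r z \<le> (\<Sum>c\<in>J. cmod (jet b (sd_plus V r) z c) + cmod (jet b V z c))"
        unfolding jet_norm_def
      proof (rule sum_mono)
        fix c assume "c \<in> J"
        then have "jet b r z c = jet b (sd_plus V r) z c - jet b V z c"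
          using jet_plus[OF V r z] by simp
        then show "cmod (jet b r z c) \<le> cmod (jet b (sd_plus V r) z c) + cmod (jet b V z c)"
          using norm_triangle_ineq4 by metis
      qed
      also have "\<dots> = jet_norm (sd_plus V r) z + jet_norm V z"
        by (simp add: jet_norm_def sum.distrib)
      finally show ?thesis using jV[OF z] jVr[OF z] by linarith
    qed
    \<comment> \<open>The mean of \<open>|L(V)|\<close> is bounded on the ball, as \<open>2|L(V)| \<le> 1 + |L(V)|\<^sup>2\<close>.\<close>
    have opE: "integral {-b..b} (\<lambda>z. cmod (op V i z)) \<le> E" if i: "i \<in> I" for i
    proof -
      note i2 = h2_ip_nonneg_terms(3)[OF V i]
      have c: "((\<lambda>z. k) has_integral 2 * b * k) {-b..b}" for k :: real
        using has_integral_const_real[of k "-b" b] b by simp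
      have hi: "((\<lambda>z. (1 + 2 * (cmod (dzz b (V i) z))\<^sup>2) + 2 * T\<^sup>2) has_integral
          (2 * b * 1 + 2 * sq_int b (dzz b (V i))) + 2 * b * (2 * T\<^sup>2)) {-b..b}"
        by (intro has_integral_add c has_integral_mult_right integrable_integral i2)
      have "integral {-b..b} (\<lambda>z. cmod (op V i z)) \<le> integral {-b..b} (\<lambda>z. (1 + 2 * (cmod (dzz b (V i) z))\<^sup>2) + 2 * T\<^sup>2)"
      proof (rule integral_le[OF norm_op_integrable(1)[OF V i]])
        show "(\<lambda>z. (1 + 2 * (cmod (dzz b (V i) z))\<^sup>2) + 2 * T\<^sup>2) integrable_on {-b..b}" using hi by blast
        fix z assume z: "z \<in> {-b..b}"
        have "cmod (lin i z (jet b V z) + quad i z (jet b V z) (jet b V z)) \<le> K * jet_norm V z + K * jet_norm V z * jet_norm V z"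
          by (intro order_trans[OF norm_triangle_ineq] add_mono lin_bound quad_bound) (use K i z in auto)
        also have "\<dots> \<le> T"
          unfolding T_def using K s0 jV[OF z] by (intro add_mono mult_mono mult_nonneg_nonneg) auto
        finally have "(cmod (lin i z (jet b V z) + quad i z (jet b V z) (jet b V z)))\<^sup>2 \<le> T\<^sup>2"
          by (rule power_mono) simp
        then have "(cmod (op V i z))\<^sup>2 \<le> 2 * (cmod (dzz b (V i) z))\<^sup>2 + 2 * T\<^sup>2"
          using square_norm_add_le[of "dzz b (V i) z" "lin i z (jet b V z) + quad i z (jet b V z) (jet b V z)"]
          by (simp add: op_def add.assoc)
        moreover have "2 * cmod (op V i z) \<le> 1 + (cmod (op V i z))\<^sup>2"
          using sum_squares_bound[of 1 "cmod (op V i z)"] by simp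
        ultimately show "cmod (op V i z) \<le> (1 + 2 * (cmod (dzz b (V i) z))\<^sup>2) + 2 * T\<^sup>2"
          using norm_ge_zero[of "op V i z"] by linarith
      qed
      also have "\<dots> = (2 * b * 1 + 2 * sq_int b (dzz b (V i))) + 2 * b * (2 * T\<^sup>2)"
        by (rule integral_unique[OF hi])
      also have "\<dots> \<le> E"
      proof -
        have "0 \<le> sq_int b (V i)" "0 \<le> sq_int b (dz b (V i))"
          using h2_ip_nonneg_terms[OF V i] by (auto intro!: integral_ge_0)
        then have "sq_int b (dzz b (V i)) \<le> M"
          using h2_ip_single[OF V i] VM by linarith
        then show ?thesis by (simp add: E_def)
      qed
      finally show ?thesis .
    qed
    have "Y / 4 \<le> remainder \<mu> V r"
      unfolding remainder_def Y_def
    proof (rule quarter_energy_le_sum[OF r \<mu> \<kappa>(3) G_def[unfolded Y_def], where m = "\<lambda>i z. cmod (op V i z)"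
          and ?k0.0 = "P\<^sup>2" and ?k1.0 = "2 * K" and E = E])
      fix i z assume i: "i \<in> I" and z: "z \<in> {-b..b}"
      show "(cmod (dzz b (r i) z))\<^sup>2 * \<mu> z / 2 - G * (P\<^sup>2 + 2 * K * cmod (op V i z)) \<le> remainder_density V r i z * \<mu> z"
      proof -
        have "cmod (qrem r i z) \<le> K * (jet_norm r z)\<^sup>2"
          by (rule qrem_bound) (use K i z in auto)
        then have "cmod (qrem r i z) * \<mu> z \<le> K * (jet_norm r z)\<^sup>2 * \<mu> z"
          by (rule mult_right_mono) (simp add: \<mu>(2) less_imp_le)
        also have "\<dots> \<le> K * G" using mult_left_mono[OF nG[OF z] K(1)] by (simp add: mult.assoc)
        finally have q: "cmod (op V i z) * (cmod (qrem r i z) * \<mu> z) \<le> cmod (op V i z) * (K * G)"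
          by (rule mult_left_mono) simp
        have "- inner (op V i z) (qrem r i z) \<le> cmod (op V i z) * cmod (qrem r i z)"
          using Cauchy_Schwarz_ineq2[of "op V i z" "qrem r i z"] by (simp add: abs_le_iff)
        then have "- inner (op V i z) (qrem r i z) * \<mu> z \<le> cmod (op V i z) * cmod (qrem r i z) * \<mu> z"
          by (rule mult_right_mono) (simp add: \<mu>(2) less_imp_le)
        then have "- (inner (op V i z) (qrem r i z) * \<mu> z) \<le> cmod (op V i z) * (K * G)"
          using q unfolding mult.assoc by linarith
        moreover have "2 * K * G * cmod (op V i z) = 2 * (cmod (op V i z) * (K * G))"
          "2 * inner (op V i z) (qrem r i z) * \<mu> z = 2 * (inner (op V i z) (qrem r i z) * \<mu> z)"
          by simp_all
        ultimately have 1: "- (2 * K * G * cmod (op V i z)) \<le> 2 * inner (op V i z) (qrem r i z) * \<mu> z"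
          by linarith
        have "cmod (dop_lower V r i z + qrem r i z) \<le> P * jet_norm r z"
          unfolding P_def by (rule lower_terms_bound) (use K i z jV jr in auto)
        then have "(cmod (dop_lower V r i z + qrem r i z))\<^sup>2 \<le> P\<^sup>2 * (jet_norm r z)\<^sup>2"
          unfolding power_mult_distrib[symmetric] by (rule power_mono) simp
        then have "(cmod (dop_lower V r i z + qrem r i z))\<^sup>2 * \<mu> z \<le> P\<^sup>2 * (jet_norm r z)\<^sup>2 * \<mu> z"
          by (rule mult_right_mono) (simp add: \<mu>(2) less_imp_le)
        also have "\<dots> \<le> P\<^sup>2 * G" using mult_left_mono[OF nG[OF z], of "P\<^sup>2"] by (simp add: mult.assoc)
        finally have 2: "(cmod (dop_lower V r i z + qrem r i z))\<^sup>2 * \<mu> z \<le> P\<^sup>2 * G" .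
        have "(cmod (dzz b (r i) z))\<^sup>2 / 2 - (cmod (dop_lower V r i z + qrem r i z))\<^sup>2 \<le> (cmod (dop V r i z + qrem r i z))\<^sup>2"
          using half_square_norm_le[of "dzz b (r i) z" "dop_lower V r i z + qrem r i z"] by (simp add: dop_def add.assoc)
        then have "((cmod (dzz b (r i) z))\<^sup>2 / 2 - (cmod (dop_lower V r i z + qrem r i z))\<^sup>2) * \<mu> z \<le> (cmod (dop V r i z + qrem r i z))\<^sup>2 * \<mu> z"
          by (rule mult_right_mono) (simp add: \<mu>(2) less_imp_le)
        then have 3: "(cmod (dzz b (r i) z))\<^sup>2 * \<mu> z / 2 - (cmod (dop_lower V r i z + qrem r i z))\<^sup>2 * \<mu> z
            \<le> (cmod (dop V r i z + qrem r i z))\<^sup>2 * \<mu> z"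
          unfolding left_diff_distrib by linarith
        have "G * (P\<^sup>2 + 2 * K * cmod (op V i z)) = P\<^sup>2 * G + 2 * K * G * cmod (op V i z)"
          by (simp add: algebra_simps)
        then show ?thesis
          unfolding distrib_right using 1 2 3 by linarith
      qed
    qed (use K opE remainder_integrable[OF V r _ \<mu>(1)] norm_op_integrable[OF V] \<kappa>H b in \<open>auto simp: H_def\<close>)
    moreover have "exp (2 * lam * (b - \<theta>)\<^sup>2) * h2_ip b I r r \<le> 3 * Y"
      unfolding Y_def \<mu>_def by (rule h2_ip_le_energy[OF r z0 \<theta> lam]) (use \<kappa> in \<open>simp_all add: \<kappa>_def\<close>)
    ultimately show "exp (2 * lam * (b - \<theta>)\<^sup>2) / 12 * h2_ip b I r r \<le> remainder (carleman_weight \<theta> lam) V r"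
      unfolding \<mu>_def by simp
  qed
qed

subsection \<open>The linear case and homogeneity\<close>

text \<open>The linear case of the absorption argument. The lower-order coefficients are fixed continuous functions here, so the estimate holds
  on the whole space rather than on a ball.\<close>

lemma functional_coercive_of_linear:
  assumes \<theta>: "\<theta> > b" and Q0: "\<And>i c e z. Q i c e z = 0"
  shows "\<exists>lam0>1. \<forall>lam\<ge>lam0. \<forall>r\<in>h2_space b I. zero_cauchy b I r \<longrightarrow>
    energy (carleman_weight \<theta> lam) r / 4 \<le> functional (carleman_weight \<theta> lam) r"
proof -
  obtain K where K: "K \<ge> 0" "\<And>i c z. i \<in> I \<Longrightarrow> c \<in> J \<Longrightarrow> z \<in> {-b..b} \<Longrightarrow> cmod (A i c z) \<le> K"
    using coefficient_bound by metis
  define H where "H = real (card I) * (2 * b * K\<^sup>2 + 0 * 0) * (real (card J))\<^sup>2"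
  have H0: "H \<ge> 0" unfolding H_def using b by simp
  define lam0 where "lam0 = max 2 ((2 * H + 1) / (\<theta> - b))"
  show ?thesis
  proof (intro exI[of _ lam0] conjI allI impI ballI)
    show "lam0 > 1" by (simp add: lam0_def)
    fix lam r assume lam0: "lam \<ge> lam0" and r: "r \<in> h2_space b I" and z0: "zero_cauchy b I r"
    define \<mu> where "\<mu> = carleman_weight \<theta> lam"
    define \<kappa> where "\<kappa> = lam * (\<theta> - b)"
    have lam: "lam > 0" using lam0 by (simp add: lam0_def)
    have "(2 * H + 1) / (\<theta> - b) \<le> lam" using lam0 by (simp add: lam0_def)
    then have \<kappa>H: "2 * H + 1 \<le> \<kappa>" using \<theta> by (simp add: \<kappa>_def pos_divide_le_eq)
    then have \<kappa>: "\<kappa> \<ge> 1" "\<kappa> > 0" using H0 by auto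
    have \<mu>: "continuous_on {-b..b} \<mu>" "\<And>z. \<mu> z > 0" unfolding \<mu>_def by (simp_all add: continuous_on_carleman_weight)
    define G where "G = (real (card J))\<^sup>2 * (energy \<mu> r / (2 * \<kappa>))"
    have nG: "(jet_norm r z)\<^sup>2 * \<mu> z \<le> G" if "z \<in> {-b..b}" for z
      unfolding G_def \<kappa>_def \<mu>_def
      by (rule jet_norm_weighted_bound[OF r z0 \<theta> lam _ that]) (use \<kappa> in \<open>simp add: \<kappa>_def\<close>)
    have "energy \<mu> r / 4 \<le> functional \<mu> r"
      unfolding functional_def
    proof (rule quarter_energy_le_sum[OF r \<mu> \<kappa>(2) G_def, where m = "\<lambda>i z. 0" and ?k0.0 = "K\<^sup>2" and ?k1.0 = 0 and E = 0])
      fix i assume i: "i \<in> I"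
      show "(\<lambda>z. (cmod (op r i z))\<^sup>2 * \<mu> z) integrable_on {-b..b}"
        by (intro sq_integrable_weighted_square sq_integrable_op r i \<mu>)
      fix z assume z: "z \<in> {-b..b}"
      have "cmod (lin i z (jet b r z)) \<le> K * jet_norm r z"
        by (rule lin_bound) (use K i z in auto)
      then have "(cmod (lin i z (jet b r z)))\<^sup>2 \<le> K\<^sup>2 * (jet_norm r z)\<^sup>2"
        unfolding power_mult_distrib[symmetric] by (rule power_mono) simp
      then have "(cmod (lin i z (jet b r z)))\<^sup>2 * \<mu> z \<le> K\<^sup>2 * (jet_norm r z)\<^sup>2 * \<mu> z"
        by (rule mult_right_mono) (simp add: \<mu>(2) less_imp_le)
      also have "\<dots> \<le> K\<^sup>2 * G" using mult_left_mono[OF nG[OF z], of "K\<^sup>2"] by (simp add: mult.assoc)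
      finally have 1: "(cmod (lin i z (jet b r z)))\<^sup>2 * \<mu> z \<le> G * (K\<^sup>2 + 0 * 0)" by (simp add: mult.commute)
      have "(cmod (dzz b (r i) z))\<^sup>2 / 2 - (cmod (lin i z (jet b r z)))\<^sup>2 \<le> (cmod (op r i z))\<^sup>2"
        using half_square_norm_le[of "dzz b (r i) z" "lin i z (jet b r z)"] by (simp add: op_def quad_def Q0)
      then have "((cmod (dzz b (r i) z))\<^sup>2 / 2 - (cmod (lin i z (jet b r z)))\<^sup>2) * \<mu> z \<le> (cmod (op r i z))\<^sup>2 * \<mu> z"
        by (rule mult_right_mono) (simp add: \<mu>(2) less_imp_le)
      then show "(cmod (dzz b (r i) z))\<^sup>2 * \<mu> z / 2 - G * (K\<^sup>2 + 0 * 0) \<le> (cmod (op r i z))\<^sup>2 * \<mu> z"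
        using 1 unfolding left_diff_distrib by linarith
    qed (use \<kappa>H in \<open>auto simp: H_def\<close>)
    then show "energy (carleman_weight \<theta> lam) r / 4 \<le> functional (carleman_weight \<theta> lam) r"
      unfolding \<mu>_def .
  qed
qed

lemma h2_bc_space_cmult:
  assumes "r \<in> h2_bc_space"
  shows "sd_cmult t r \<in> h2_bc_space"
  using assms H2_interval_cmult[OF b] b by (auto simp: h2_bc_space_def sd_cmult_def H2_bc_def)

lemma h2_ip_cmult_right:
  assumes r: "r \<in> h2_space b I"
  shows "h2_ip b I g (sd_cmult (of_real t) r) = t * h2_ip b I g r"
  unfolding h2_ip_def sum_distrib_left
proof (rule sum.cong[OF refl])
  fix i assume i: "i \<in> I"
  have "integral {-b..b} (\<lambda>z. inner (g i z) (sd_cmult (of_real t) r i z) +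
      inner (dz b (g i) z) (dz b (sd_cmult (of_real t) r i) z) + inner (dzz b (g i) z) (dzz b (sd_cmult (of_real t) r i) z))
    = integral {-b..b} (\<lambda>z. t * (inner (g i z) (r i z) + inner (dz b (g i) z) (dz b (r i) z) + inner (dzz b (g i) z) (dzz b (r i) z)))"
  proof (rule integral_spike[OF dzz_cmult_ae[OF r i, of "of_real t"]])
    fix z assume z: "z \<in> {-b..b} - {z \<in> {-b..b}. dzz b (sd_cmult (of_real t) r i) z \<noteq> of_real t * dzz b (r i) z}"
    then have "dzz b (sd_cmult (of_real t) r i) z = of_real t * dzz b (r i) z" by simp
    moreover have "dz b (sd_cmult (of_real t) r i) z = of_real t * dz b (r i) z"
      unfolding sd_cmult_def by (rule H2_interval_cmult(2)[OF b h2_spaceD[OF r i]]) (use z in auto)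
    ultimately show "t * (inner (g i z) (r i z) + inner (dz b (g i) z) (dz b (r i) z) + inner (dzz b (g i) z) (dzz b (r i) z)) =
      inner (g i z) (sd_cmult (of_real t) r i z) + inner (dz b (g i) z) (dz b (sd_cmult (of_real t) r i) z) +
      inner (dzz b (g i) z) (dzz b (sd_cmult (of_real t) r i) z)"
      by (simp add: sd_cmult_def inner_complex_def algebra_simps)
  qed
  then show "integral {-b..b} (\<lambda>z. inner (g i z) (sd_cmult (of_real t) r i z) +
      inner (dz b (g i) z) (dz b (sd_cmult (of_real t) r i) z) + inner (dzz b (g i) z) (dzz b (sd_cmult (of_real t) r i) z))
    = t * integral {-b..b} (\<lambda>z. inner (g i z) (r i z) + inner (dz b (g i) z) (dz b (r i) z) + inner (dzz b (g i) z) (dzz b (r i) z))"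
    by simp
qed

lemma h2_ip_cmult_self:
  assumes r: "r \<in> h2_space b I"
  shows "h2_ip b I (sd_cmult (of_real t) r) (sd_cmult (of_real t) r) = t\<^sup>2 * h2_ip b I r r"
proof -
  have c: "h2_ip b I u v = h2_ip b I v u" for u v
    unfolding h2_ip_def by (simp add: inner_commute)
  show ?thesis
    using h2_ip_cmult_right[OF r, of "sd_cmult (of_real t) r" t] h2_ip_cmult_right[OF r, of r t] c
    by (simp add: power2_eq_square mult.assoc)
qed

lemma dop_cmult:
  assumes r: "r \<in> h2_space b I" and z: "z \<in> {-b..b}"
    and "dzz b (sd_cmult t r i) z = t * dzz b (r i) z"
  shows "dop V (sd_cmult t r) i z = t * dop V r i z"
proof -
  have "(\<Sum>c\<in>J. dop_coeff V i c z * jet b (sd_cmult t r) z c) = (\<Sum>c\<in>J. dop_coeff V i c z * (t * jet b r z c))"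
    by (intro sum.cong refl) (simp add: jet_cmult[OF r z])
  then show ?thesis
    by (simp add: dop_def dop_lower_eq assms(3) distrib_left sum_distrib_left mult.left_commute)
qed

lemma first_variation_cmult:
  assumes V: "V \<in> h2_space b I" and r: "r \<in> h2_space b I"
  shows "first_variation \<mu> V (sd_cmult (of_real t) r) = t * first_variation \<mu> V r"
  unfolding first_variation_def sum_distrib_left
proof (rule sum.cong[OF refl])
  fix i assume i: "i \<in> I"
  have "integral {-b..b} (\<lambda>z. 2 * inner (op V i z) (dop V (sd_cmult (of_real t) r) i z) * \<mu> z) =
    integral {-b..b} (\<lambda>z. t * (2 * inner (op V i z) (dop V r i z) * \<mu> z))"
  proof (rule integral_spike[OF dzz_cmult_ae[OF r i, of "of_real t"]])
    fix z assume z: "z \<in> {-b..b} - {z \<in> {-b..b}. dzz b (sd_cmult (of_real t) r i) z \<noteq> of_real t * dzz b (r i) z}"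
    have "dop V (sd_cmult (of_real t) r) i z = of_real t * dop V r i z"
      by (rule dop_cmult[OF r]) (use z in auto)
    then show "t * (2 * inner (op V i z) (dop V r i z) * \<mu> z) = 2 * inner (op V i z) (dop V (sd_cmult (of_real t) r) i z) * \<mu> z"
      by (simp add: inner_complex_def algebra_simps)
  qed
  then show "integral {-b..b} (\<lambda>z. 2 * inner (op V i z) (dop V (sd_cmult (of_real t) r) i z) * \<mu> z) =
    t * integral {-b..b} (\<lambda>z. 2 * inner (op V i z) (dop V r i z) * \<mu> z)" by simp
qed

text \<open>A pointwise quadratic inequality for linear combinations passes to the norm, which is an integral of squares; it is
  used for convexity on segments and for sums.\<close>

lemma h2_ip_mono_combination:
  assumes u: "u \<in> h2_space b I" and v: "v \<in> h2_space b I" and w: "w \<in> h2_space b I"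
    and \<alpha>\<beta>: "\<alpha> \<ge> 0" "\<beta> \<ge> 0" and eq: "w = sd_plus (sd_cmult x u) (sd_cmult y v)"
    and bound: "\<And>s t. (cmod (x * s + y * t))\<^sup>2 \<le> \<alpha> * (cmod s)\<^sup>2 + \<beta> * (cmod t)\<^sup>2"
  shows "h2_ip b I w w \<le> \<alpha> * h2_ip b I u u + \<beta> * h2_ip b I v v"
  unfolding h2_ip_self[OF u] h2_ip_self[OF v] h2_ip_self[OF w] sum_distrib_left sum.distrib[symmetric]
proof (rule sum_mono)
  fix i assume i: "i \<in> I"
  note nu = h2_ip_nonneg_terms[OF u i] and nv = h2_ip_nonneg_terms[OF v i] and nw = h2_ip_nonneg_terms[OF w i]
  have hi: "((\<lambda>z. \<alpha> * f z + \<beta> * g z) has_integral \<alpha> * integral {-b..b} f + \<beta> * integral {-b..b} g) {-b..b}"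
    if "f integrable_on {-b..b}" "g integrable_on {-b..b}" for f g :: "real \<Rightarrow> real"
    by (intro has_integral_add has_integral_mult_right integrable_integral that)
  have xu: "sd_cmult x u \<in> h2_space b I" and yv: "sd_cmult y v \<in> h2_space b I"
    by (intro h2_space_cmult u v)+
  have 0: "sq_int b (w i) \<le> \<alpha> * sq_int b (u i) + \<beta> * sq_int b (v i)"
    by (rule has_integral_le[OF integrable_integral[OF nw(1)] hi[OF nu(1) nv(1)]])
       (simp add: eq sd_plus_def sd_cmult_def bound)
  have 1: "sq_int b (dz b (w i)) \<le> \<alpha> * sq_int b (dz b (u i)) + \<beta> * sq_int b (dz b (v i))"
  proof (rule has_integral_le[OF integrable_integral[OF nw(2)] hi[OF nu(2) nv(2)]])
    fix z assume z: "z \<in> {-b..b}"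
    have "dz b (w i) z = jet b w z (i, True)" by (simp add: jet_def)
    also have "\<dots> = x * dz b (u i) z + y * dz b (v i) z"
      unfolding eq using i by (simp add: jet_plus[OF xu yv z] jet_cmult[OF u z] jet_cmult[OF v z] J_def) (simp add: jet_def)
    finally show "(cmod (dz b (w i) z))\<^sup>2 \<le> \<alpha> * (cmod (dz b (u i) z))\<^sup>2 + \<beta> * (cmod (dz b (v i) z))\<^sup>2"
      by (simp add: bound)
  qed
  have neg: "negligible ({z \<in> {-b..b}. dzz b (w i) z \<noteq> dzz b (sd_cmult x u i) z + dzz b (sd_cmult y v i) z} \<union>
      ({z \<in> {-b..b}. dzz b (sd_cmult x u i) z \<noteq> x * dzz b (u i) z} \<union> {z \<in> {-b..b}. dzz b (sd_cmult y v i) z \<noteq> y * dzz b (v i) z}))"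
    unfolding eq by (intro negligible_Un dzz_plus_ae dzz_cmult_ae u v xu yv i)
  have 2: "sq_int b (dzz b (w i)) \<le> \<alpha> * sq_int b (dzz b (u i)) + \<beta> * sq_int b (dzz b (v i))"
  proof -
    have "((\<lambda>z. (cmod (x * dzz b (u i) z + y * dzz b (v i) z))\<^sup>2) has_integral sq_int b (dzz b (w i))) {-b..b}"
      by (rule has_integral_spike[OF neg _ integrable_integral[OF nw(3)]]) auto
    from has_integral_le[OF this hi[OF nu(3) nv(3)]] show ?thesis by (simp add: bound)
  qed
  show "sq_int b (w i) + sq_int b (dz b (w i)) + sq_int b (dzz b (w i))
    \<le> \<alpha> * (sq_int b (u i) + sq_int b (dz b (u i)) + sq_int b (dzz b (u i)))
    + \<beta> * (sq_int b (v i) + sq_int b (dz b (v i)) + sq_int b (dzz b (v i)))"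
    using 0 1 2 unfolding distrib_left by linarith
qed

text \<open>Balls are convex, because the squared norm is convex.\<close>

lemma h2_ip_segment_le:
  assumes u: "u \<in> h2_space b I" and v: "v \<in> h2_space b I" and t: "0 \<le> t" "t \<le> 1"
    and M: "h2_ip b I u u \<le> M" "h2_ip b I v v \<le> M"
  defines "w \<equiv> sd_plus (sd_cmult (of_real (1 - t)) u) (sd_cmult (of_real t) v)"
  shows "w \<in> h2_space b I" "h2_ip b I w w \<le> M"
proof -
  show w: "w \<in> h2_space b I"
    unfolding w_def by (intro h2_space_plus h2_space_cmult u v)
  have "h2_ip b I w w \<le> (1 - t) * h2_ip b I u u + t * h2_ip b I v v"
  proof (rule h2_ip_mono_combination[OF u v w _ t(1) w_def[THEN meta_eq_to_obj_eq]])
    show "0 \<le> 1 - t" using t by simp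
    fix x y
    have "(cmod (of_real (1 - t) * x + of_real t * y))\<^sup>2 \<le> ((1 - t) * cmod x + t * cmod y)\<^sup>2"
      using t by (intro power_mono order_trans[OF norm_triangle_ineq]) (auto simp: norm_mult simp del: of_real_diff)
    also have "\<dots> = (1 - t) * (cmod x)\<^sup>2 + t * (cmod y)\<^sup>2 - (1 - t) * t * (cmod x - cmod y)\<^sup>2"
      by (simp add: power2_eq_square algebra_simps)
    also have "\<dots> \<le> (1 - t) * (cmod x)\<^sup>2 + t * (cmod y)\<^sup>2"
      using t by simp
    finally show "(cmod (of_real (1 - t) * x + of_real t * y))\<^sup>2 \<le> (1 - t) * (cmod x)\<^sup>2 + t * (cmod y)\<^sup>2" .
  qed
  also have "\<dots> \<le> (1 - t) * M + t * M"
    using t M by (intro add_mono mult_left_mono) auto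
  finally show "h2_ip b I w w \<le> M" by (simp add: algebra_simps)
qed

lemma h2_ip_plus_le:
  assumes u: "u \<in> h2_space b I" and v: "v \<in> h2_space b I"
  shows "h2_ip b I (sd_plus u v) (sd_plus u v) \<le> 2 * h2_ip b I u u + 2 * h2_ip b I v v"
proof -
  have e: "sd_plus u v = sd_plus (sd_cmult 1 u) (sd_cmult 1 v)" by (simp add: sd_cmult_def)
  show ?thesis
    by (rule h2_ip_mono_combination[OF u v h2_space_plus[OF u v] _ _ e])
       (use square_norm_add_le in auto)
qed

end

section \<open>Continuity of the coefficients of the nonlinearity\<close>

text \<open>Each step of the Gram--Schmidt process is a linear combination of smooth functions, divided by a number. If that number were zero,
  division by zero would yield the zero function, which is smooth as well.\<close>

lemma Psi_C1:
  "\<exists>f'. (\<forall>x. (Psi a1 a2 n has_real_derivative f' x) (at x)) \<and> continuous_on UNIV f'"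
proof (induction n rule: less_induct)
  case (less n)
  then have "\<forall>i\<in>{..<n}. \<exists>f'. (\<forall>x. (Psi a1 a2 i has_real_derivative f' x) (at x)) \<and> continuous_on UNIV f'"
    by auto
  from bchoice[OF this] obtain D where D: "\<And>i x. i < n \<Longrightarrow> (Psi a1 a2 i has_real_derivative D i x) (at x)"
    "\<And>i. i < n \<Longrightarrow> continuous_on UNIV (D i)"
    by auto
  define c where "c = (\<lambda>i. ip_L2 a1 a2 (\<lambda>\<alpha>. \<alpha> ^ n * exp \<alpha>) (Psi a1 a2 i))"
  define u where "u = (\<lambda>\<alpha>. \<alpha> ^ n * exp \<alpha> - (\<Sum>i<n. c i * Psi a1 a2 i \<alpha>))"
  define K where "K = sqrt (ip_L2 a1 a2 u u)"
  have P: "Psi a1 a2 n = (\<lambda>\<alpha>. u \<alpha> / K)"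
    by (subst Psi.simps) (simp add: Let_def u_def c_def K_def)
  define f' where "f' = (\<lambda>x. ((real n * x ^ (n - 1)) * exp x + x ^ n * exp x - (\<Sum>i<n. c i * D i x)) / K)"
  have "(Psi a1 a2 n has_real_derivative f' x) (at x)" for x
  proof -
    have "((\<lambda>\<alpha>. \<Sum>i<n. c i * Psi a1 a2 i \<alpha>) has_real_derivative (\<Sum>i<n. c i * D i x)) (at x)"
      by (rule DERIV_sum) (auto intro: DERIV_cmult D)
    moreover have "((\<lambda>\<alpha>. \<alpha> ^ n * exp \<alpha>) has_real_derivative (real n * x ^ (n - 1)) * exp x + x ^ n * exp x) (at x)"
      by (auto intro!: derivative_eq_intros)
    ultimately show ?thesis
      unfolding P u_def f'_def by (intro DERIV_cdivide DERIV_diff)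
  qed
  moreover have "continuous_on UNIV f'"
    unfolding f'_def divide_inverse by (intro continuous_intros D) auto
  ultimately show ?case by blast
qed

lemma continuous_on_Psi [continuous_intros]: "continuous_on S (Psi a1 a2 n)"
proof -
  obtain f' where "\<And>x. (Psi a1 a2 n has_real_derivative f' x) (at x)" using Psi_C1 by blast
  then have "isCont (Psi a1 a2 n) x" for x by (rule DERIV_isCont)
  then show ?thesis by (simp add: continuous_at_imp_continuous_on)
qed

lemma continuous_on_deriv_Psi [continuous_intros]: "continuous_on S (deriv (Psi a1 a2 n))"
proof -
  obtain f' where f': "\<And>x. (Psi a1 a2 n has_real_derivative f' x) (at x)" "continuous_on UNIV f'"
    using Psi_C1 by blast
  then have "deriv (Psi a1 a2 n) = f'" by (auto intro!: DERIV_imp_deriv)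
  then show ?thesis using f'(2) continuous_on_subset by auto
qed

lemma has_vector_derivative_vecI:
  fixes f :: "real \<Rightarrow> 'b::euclidean_space ^ 'n"
  assumes "\<And>i. ((\<lambda>x. vec_nth (f x) i) has_vector_derivative vec_nth f' i) (at a within S)"
  shows "(f has_vector_derivative f') (at a within S)"
  unfolding has_vector_derivative_def
proof (subst has_derivative_componentwise_within, rule ballI)
  fix e :: "'b ^ 'n" assume "e \<in> Basis"
  then obtain i u where e: "e = axis i u" by (auto simp: Basis_vec_def)
  show "((\<lambda>x. inner (f x) e) has_derivative (\<lambda>x. inner (x *\<^sub>R f') e)) (at a within S)"
    using has_derivative_inner_left[OF assms[of i, unfolded has_vector_derivative_def], of u]
    by (simp add: e inner_axis)
qed

text \<open>The distance of the point \<open>(x1, x2, z)\<close> from the source \<open>(\<alpha>, 0, -d)\<close>. It is positive for \<open>z > -d\<close>, which keeps all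
  coefficients regular.\<close>

definition source_dist :: "real \<Rightarrow> real \<Rightarrow> real \<Rightarrow> real \<Rightarrow> real \<Rightarrow> real" where
  "source_dist d x1 x2 z \<alpha> = sqrt ((x1 - \<alpha>)\<^sup>2 + x2\<^sup>2 + (z + d)\<^sup>2)"

lemma norm_vector_3: "norm (vector [x, y, z] :: real ^ 3) = sqrt (x\<^sup>2 + y\<^sup>2 + z\<^sup>2)"
  by (simp add: norm_vec_def L2_set_def sum_3)

lemma source_dist_eq:
  "norm (vector [x1, x2, z] - vector [\<alpha>, 0, -d] :: real ^ 3) = source_dist d x1 x2 z \<alpha>"
proof -
  have "(vector [x1, x2, z] - vector [\<alpha>, 0, -d] :: real ^ 3) = vector [x1 - \<alpha>, x2, z + d]"
    by (simp add: Finite_Cartesian_Product.vec_eq_iff forall_3)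
  then show ?thesis by (simp add: norm_vector_3 source_dist_def)
qed

lemma source_dist_pos:
  assumes "z + d > 0"
  shows "source_dist d x1 x2 z \<alpha> > 0"
  unfolding source_dist_def using assms by (simp add: add_nonneg_pos)

lemma continuous_on_source_dist [continuous_intros]:
  assumes "continuous_on S f" "continuous_on S g"
  shows "continuous_on S (\<lambda>w. source_dist d x1 x2 (f w) (g w))"
  unfolding source_dist_def by (intro continuous_intros assms)

lemma source_dist_deriv:
  assumes "z + d > 0"
  shows "((\<lambda>\<alpha>. source_dist d x1 x2 z \<alpha>) has_real_derivative - (x1 - \<alpha>) / source_dist d x1 x2 z \<alpha>) (at \<alpha>)"
proof -
  have "(x1 - \<alpha>)\<^sup>2 + x2\<^sup>2 + (z + d)\<^sup>2 > 0" using assms by (simp add: add_nonneg_pos)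
  then show ?thesis
    unfolding source_dist_def by (auto intro!: derivative_eq_intros simp: divide_simps)
qed

definition source_offset :: "real \<Rightarrow> real \<Rightarrow> real \<Rightarrow> real \<Rightarrow> real \<Rightarrow> 3 \<Rightarrow> real" where
  "source_offset d x1 x2 z \<alpha> i = vec_nth (vector [x1 - \<alpha>, x2, z + d] :: real ^ 3) i"

lemma x_tilde_nth:
  "vec_nth (x_tilde k d (vector [x1, x2, z]) \<alpha>) i =
     \<i> * of_real (k * (source_offset d x1 x2 z \<alpha> i / source_dist d x1 x2 z \<alpha>))
       - of_real (source_offset d x1 x2 z \<alpha> i / (source_dist d x1 x2 z \<alpha>)\<^sup>2)"
proof -
  have "vec_nth (vector [x1, x2, z] - vector [\<alpha>, 0, -d] :: real ^ 3) i = source_offset d x1 x2 z \<alpha> i"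
    using exhaust_3[of i] by (auto simp: source_offset_def)
  then show ?thesis
    by (simp add: x_tilde_def Let_def source_dist_eq del: vector_minus_component)
qed

lemma continuous_on_source_offset [continuous_intros]:
  assumes "continuous_on S f" "continuous_on S g"
  shows "continuous_on S (\<lambda>w. source_offset d x1 x2 (f w) (g w) i)"
  using exhaust_3[of i]
  by (elim disjE) (simp_all add: source_offset_def, (intro continuous_intros assms)+)

lemma source_offset_deriv:
  "((\<lambda>\<alpha>. source_offset d x1 x2 z \<alpha> i) has_real_derivative (if i = 1 then -1 else 0)) (at \<alpha>)"
proof -
  have "(1::3) \<noteq> 2" "(3::3) \<noteq> 1" by auto
  then show ?thesis
    using exhaust_3[of i] by (auto simp: source_offset_def intro!: derivative_eq_intros)
qed

text \<open>The componentwise derivative of \<open>x_tilde\<close> with respect to \<open>\<alpha>\<close>, obtained from the quotient rule: \<open>e\<close> is the derivative of the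
  component \<open>y\<close> of the offset, and that of \<open>\<rho>\<close> is \<open>-(x1 - \<alpha>)/\<rho>\<close>.\<close>

definition x_hat_explicit :: "real \<Rightarrow> real \<Rightarrow> real \<Rightarrow> real \<Rightarrow> real \<Rightarrow> real \<Rightarrow> 3 \<Rightarrow> complex" where
  "x_hat_explicit k d x1 x2 z \<alpha> i = (let \<rho> = source_dist d x1 x2 z \<alpha>; y = source_offset d x1 x2 z \<alpha> i;
       e = (if i = 1 then -1 else 0) in
     \<i> * of_real (k * (e / \<rho> + y * (x1 - \<alpha>) / \<rho> ^ 3)) - of_real (e / \<rho>\<^sup>2 + 2 * y * (x1 - \<alpha>) / \<rho> ^ 4))"

lemma x_hat_nth:
  assumes z: "z + d > 0"
  shows "vec_nth (x_hat k d (vector [x1, x2, z]) \<alpha>) i = x_hat_explicit k d x1 x2 z \<alpha> i"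
proof -
  define \<rho> where "\<rho> = source_dist d x1 x2 z \<alpha>"
  have \<rho>: "\<rho> > 0" unfolding \<rho>_def by (rule source_dist_pos[OF z])
  have "((\<lambda>\<alpha>. vec_nth (x_tilde k d (vector [x1, x2, z]) \<alpha>) j) has_vector_derivative x_hat_explicit k d x1 x2 z \<alpha> j) (at \<alpha>)" for j
  proof -
    define e :: real where "e = (if j = 1 then -1 else 0)"
    define y where "y = source_offset d x1 x2 z \<alpha> j"
    have y': "((\<lambda>\<alpha>. source_offset d x1 x2 z \<alpha> j) has_real_derivative e) (at \<alpha>)"
      unfolding e_def by (rule source_offset_deriv)
    have r': "((\<lambda>\<alpha>. source_dist d x1 x2 z \<alpha>) has_real_derivative - (x1 - \<alpha>) / \<rho>) (at \<alpha>)"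
      unfolding \<rho>_def by (rule source_dist_deriv[OF z])
    have 1: "((\<lambda>\<alpha>. k * (source_offset d x1 x2 z \<alpha> j / source_dist d x1 x2 z \<alpha>)) has_real_derivative
        k * (e / \<rho> + y * (x1 - \<alpha>) / \<rho> ^ 3)) (at \<alpha>)"
      using \<rho> by (auto intro!: derivative_eq_intros y' r' simp: \<rho>_def[symmetric] y_def[symmetric] field_simps power3_eq_cube)
    have 2: "((\<lambda>\<alpha>. source_offset d x1 x2 z \<alpha> j / (source_dist d x1 x2 z \<alpha>)\<^sup>2) has_real_derivative
        e / \<rho>\<^sup>2 + 2 * y * (x1 - \<alpha>) / \<rho> ^ 4) (at \<alpha>)"
      using \<rho> by (auto intro!: derivative_eq_intros y' r' simp: \<rho>_def[symmetric] y_def[symmetric] field_simps power2_eq_square power4_eq_xxxx)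
    have "((\<lambda>\<alpha>. \<i> * of_real (k * (source_offset d x1 x2 z \<alpha> j / source_dist d x1 x2 z \<alpha>))
       - of_real (source_offset d x1 x2 z \<alpha> j / (source_dist d x1 x2 z \<alpha>)\<^sup>2)) has_vector_derivative
       \<i> * of_real (k * (e / \<rho> + y * (x1 - \<alpha>) / \<rho> ^ 3)) - of_real (e / \<rho>\<^sup>2 + 2 * y * (x1 - \<alpha>) / \<rho> ^ 4)) (at \<alpha>)"
      by (intro has_vector_derivative_diff has_vector_derivative_mult_right has_vector_derivative_of_real 1 2)
    then show ?thesis
      unfolding x_tilde_nth x_hat_explicit_def Let_def e_def y_def \<rho>_def .
  qed
  then have "(x_tilde k d (vector [x1, x2, z]) has_vector_derivative (\<chi> j. x_hat_explicit k d x1 x2 z \<alpha> j)) (at \<alpha>)"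
    by (intro has_vector_derivative_vecI) simp
  then have "x_hat k d (vector [x1, x2, z]) \<alpha> = (\<chi> j. x_hat_explicit k d x1 x2 z \<alpha> j)"
    unfolding x_hat_def by (rule vector_derivative_at)
  then show ?thesis by simp
qed

lemma continuous_on_x_tilde:
  assumes "d > b"
  shows "continuous_on ({-b..b} \<times> T) (\<lambda>(z, \<alpha>). vec_nth (x_tilde k d (vector [x1, x2, z]) \<alpha>) i)"
proof -
  have "source_dist d x1 x2 (fst w) (snd w) \<noteq> 0" if "w \<in> {-b..b} \<times> T" for w
    using that assms source_dist_pos[of "fst w" d x1 x2 "snd w"] by auto
  then show ?thesis
    unfolding x_tilde_nth case_prod_unfold by (intro continuous_intros) auto
qed

lemma continuous_on_x_hat:
  assumes "d > b"
  shows "continuous_on ({-b..b} \<times> T) (\<lambda>(z, \<alpha>). vec_nth (x_hat k d (vector [x1, x2, z]) \<alpha>) i)"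
proof -
  have "source_dist d x1 x2 (fst w) (snd w) \<noteq> 0" if "w \<in> {-b..b} \<times> T" for w
    using that assms source_dist_pos[of "fst w" d x1 x2 "snd w"] by auto
  then have "continuous_on ({-b..b} \<times> T) (\<lambda>w. x_hat_explicit k d x1 x2 (fst w) (snd w) i)"
    unfolding x_hat_explicit_def Let_def by (intro continuous_intros) auto
  then show ?thesis
    by (rule continuous_on_eq) (use assms in \<open>auto simp: x_hat_nth\<close>)
qed

lemma continuous_on_weighted_integral:
  fixes F :: "real \<Rightarrow> real \<Rightarrow> complex"
  assumes "continuous_on ({-b..b} \<times> {a1..a2}) (\<lambda>(z, \<alpha>). F z \<alpha>)" "continuous_on {a1..a2} w"
  shows "continuous_on {-b..b} (\<lambda>z. integral {a1..a2} (\<lambda>\<alpha>. of_real (w \<alpha>) * F z \<alpha>))"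
proof -
  have "continuous_on ({-b..b} \<times> {a1..a2}) (\<lambda>u. of_real (w (snd u)) * (case u of (z, \<alpha>) \<Rightarrow> F z \<alpha>))"
    by (intro continuous_intros assms continuous_on_compose2[OF assms(2)]) auto
  then have "continuous_on ({-b..b} \<times> cbox a1 a2) (\<lambda>(z, \<alpha>). of_real (w \<alpha>) * F z \<alpha>)"
    by (simp add: case_prod_unfold)
  from integral_continuous_on_param[OF this] show ?thesis by simp
qed

text \<open>The gradient does not depend on \<open>\<alpha>\<close>, so it can be taken out of the integral; what remains are coefficients depending on the point only.\<close>

lemma weighted_integral_bdot:
  fixes X :: "real \<Rightarrow> complex ^ 3"
  assumes "\<And>i. continuous_on {a1..a2} (\<lambda>\<alpha>. vec_nth (X \<alpha>) i)" "continuous_on {a1..a2} w"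
  shows "integral {a1..a2} (\<lambda>\<alpha>. of_real (w \<alpha>) * bdot G (X \<alpha>)) =
    (\<Sum>i\<in>UNIV. integral {a1..a2} (\<lambda>\<alpha>. of_real (w \<alpha>) * vec_nth (X \<alpha>) i) * vec_nth G i)"
proof -
  have int: "(\<lambda>\<alpha>. of_real (w \<alpha>) * vec_nth (X \<alpha>) i) integrable_on {a1..a2}" for i
    by (intro integrable_continuous_real continuous_intros assms)
  have "integral {a1..a2} (\<lambda>\<alpha>. of_real (w \<alpha>) * bdot G (X \<alpha>)) =
    integral {a1..a2} (\<lambda>\<alpha>. \<Sum>i\<in>UNIV. of_real (w \<alpha>) * vec_nth (X \<alpha>) i * vec_nth G i)"
    by (simp add: bdot_def sum_distrib_left mult_ac)
  also have "\<dots> = (\<Sum>i\<in>UNIV. integral {a1..a2} (\<lambda>\<alpha>. of_real (w \<alpha>) * vec_nth (X \<alpha>) i * vec_nth G i))"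
    by (intro integral_sum integrable_on_mult_left int) auto
  finally show ?thesis by simp
qed

lemma bdot_commute: "bdot u v = bdot v u"
  by (simp add: bdot_def mult.commute)

section \<open>The semi-discrete operator as an operator with quadratic lower-order part\<close>

definition grid_index :: "nat \<Rightarrow> nat \<Rightarrow> (nat \<times> nat \<times> nat) set" where
  "grid_index Z N = {..<N} \<times> {1..Z-1} \<times> {1..Z-1}"

definition flat :: "sdvec \<Rightarrow> nat \<times> nat \<times> nat \<Rightarrow> real \<Rightarrow> complex" where
  "flat V = (\<lambda>(n, p, q). V n p q)"

lemma finite_grid_index [simp]: "finite (grid_index Z N)"
  by (simp add: grid_index_def)

abbreviation linear_form ::
  "real \<Rightarrow> nat \<Rightarrow> nat \<Rightarrow> ((nat \<times> nat \<times> nat) \<times> bool \<Rightarrow> real \<Rightarrow> complex) \<Rightarrow> sdvec \<Rightarrow> real \<Rightarrow> complex" where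
  "linear_form b Z N a V z \<equiv> (\<Sum>c\<in>grid_index Z N \<times> UNIV. a c z * jet b (flat V) z c)"

abbreviation quadratic_form ::
  "real \<Rightarrow> nat \<Rightarrow> nat \<Rightarrow> ((nat \<times> nat \<times> nat) \<times> bool \<Rightarrow> (nat \<times> nat \<times> nat) \<times> bool \<Rightarrow> real \<Rightarrow> complex) \<Rightarrow> sdvec \<Rightarrow> real \<Rightarrow> complex" where
  "quadratic_form b Z N q V z \<equiv> (\<Sum>c\<in>grid_index Z N \<times> UNIV. \<Sum>e\<in>grid_index Z N \<times> UNIV.
     q c e z * jet b (flat V) z c * jet b (flat V) z e)"

text \<open>The expression \<open>T V z\<close> is a linear form in the jet of \<open>V\<close> with coefficients continuous in \<open>z\<close>, for grid functions satisfying the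
  lateral conditions. Together with its quadratic analogue, this property is stable under the operations that build the
  nonlinearity, so the coefficients themselves never have to be written down.\<close>

definition jet_linear :: "real \<Rightarrow> nat \<Rightarrow> nat \<Rightarrow> (sdvec \<Rightarrow> real \<Rightarrow> complex) \<Rightarrow> bool" where
  "jet_linear b Z N T \<longleftrightarrow> (\<exists>a. (\<forall>c. continuous_on {-b..b} (a c)) \<and>
     (\<forall>V. lateral_neumann b Z N V \<longrightarrow> (\<forall>z\<in>{-b..b}.
        T V z = linear_form b Z N a V z)))"

definition jet_quadratic :: "real \<Rightarrow> nat \<Rightarrow> nat \<Rightarrow> (sdvec \<Rightarrow> real \<Rightarrow> complex) \<Rightarrow> bool" where
  "jet_quadratic b Z N T \<longleftrightarrow> (\<exists>a q. (\<forall>c. continuous_on {-b..b} (a c)) \<and> (\<forall>c e. continuous_on {-b..b} (q c e)) \<and>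
     (\<forall>V. lateral_neumann b Z N V \<longrightarrow> (\<forall>z\<in>{-b..b}.
        T V z = linear_form b Z N a V z +
          quadratic_form b Z N q V z)))"

lemma jet_linearE:
  assumes "jet_linear b Z N T"
  obtains a where "\<And>c. continuous_on {-b..b} (a c)" "\<And>V z. lateral_neumann b Z N V \<Longrightarrow> z \<in> {-b..b} \<Longrightarrow>
      T V z = linear_form b Z N a V z"
  using assms unfolding jet_linear_def by blast

lemma jet_quadraticE:
  assumes "jet_quadratic b Z N T"
  obtains a q where "\<And>c. continuous_on {-b..b} (a c)" "\<And>c e. continuous_on {-b..b} (q c e)"
    "\<And>V z. lateral_neumann b Z N V \<Longrightarrow> z \<in> {-b..b} \<Longrightarrow>
      T V z = linear_form b Z N a V z +
          quadratic_form b Z N q V z"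
  using assms unfolding jet_quadratic_def by blast

lemma jet_linear_add:
  assumes "jet_linear b Z N S" "jet_linear b Z N T"
  shows "jet_linear b Z N (\<lambda>V z. S V z + T V z)"
proof -
  obtain a where a: "\<And>c. continuous_on {-b..b} (a c)" "\<And>V z. lateral_neumann b Z N V \<Longrightarrow> z \<in> {-b..b} \<Longrightarrow>
      S V z = linear_form b Z N a V z"
    using assms(1) by (rule jet_linearE) blast
  obtain a' where a': "\<And>c. continuous_on {-b..b} (a' c)" "\<And>V z. lateral_neumann b Z N V \<Longrightarrow> z \<in> {-b..b} \<Longrightarrow>
      T V z = linear_form b Z N a' V z"
    using assms(2) by (rule jet_linearE) blast
  show ?thesis
    unfolding jet_linear_def
    by (rule exI[of _ "\<lambda>c z. a c z + a' c z"])
       (auto intro!: continuous_intros a a' simp: a(2) a'(2) distrib_right sum.distrib)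
qed

lemma jet_linear_cmult:
  assumes "jet_linear b Z N S" "continuous_on {-b..b} f"
  shows "jet_linear b Z N (\<lambda>V z. f z * S V z)"
proof -
  obtain a where a: "\<And>c. continuous_on {-b..b} (a c)" "\<And>V z. lateral_neumann b Z N V \<Longrightarrow> z \<in> {-b..b} \<Longrightarrow>
      S V z = linear_form b Z N a V z"
    using assms(1) by (rule jet_linearE) blast
  show ?thesis
    unfolding jet_linear_def
    by (rule exI[of _ "\<lambda>c z. f z * a c z"])
       (auto intro!: continuous_intros a assms simp: a(2) sum_distrib_left mult.assoc)
qed

lemma jet_linear_0: "jet_linear b Z N (\<lambda>V z. 0)"
  unfolding jet_linear_def by (rule exI[of _ "\<lambda>c z. 0"]) auto

lemma jet_linear_sum:
  assumes "finite S" "\<And>s. s \<in> S \<Longrightarrow> jet_linear b Z N (T s)"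
  shows "jet_linear b Z N (\<lambda>V z. \<Sum>s\<in>S. T s V z)"
  using assms by induction (auto intro: jet_linear_0 jet_linear_add)

lemma jet_linear_jet:
  assumes "c \<in> grid_index Z N \<times> UNIV"
  shows "jet_linear b Z N (\<lambda>V z. jet b (flat V) z c)"
  unfolding jet_linear_def
proof (intro exI conjI allI impI ballI)
  fix c' :: "(nat \<times> nat \<times> nat) \<times> bool"
  show "continuous_on {-b..b} (\<lambda>z::real. if c' = c then 1 else (0::complex))"
    by (intro continuous_intros)
next
  fix V z
  have "(\<Sum>c'\<in>grid_index Z N \<times> UNIV. (if c' = c then 1 else 0) * jet b (flat V) z c') =
      (\<Sum>c'\<in>grid_index Z N \<times> UNIV. if c' = c then jet b (flat V) z c' else 0)"
    by (intro sum.cong) auto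
  then show "jet b (flat V) z c = (\<Sum>c'\<in>grid_index Z N \<times> UNIV. (if c' = c then 1 else 0) * jet b (flat V) z c')"
    using assms by (simp add: sum.delta')
qed

lemma jet_linear_interior:
  assumes "n < N" "p \<in> {1..Z-1}" "q \<in> {1..Z-1}"
  shows "jet_linear b Z N (\<lambda>V z. V n p q z)" "jet_linear b Z N (\<lambda>V z. dz b (V n p q) z)"
  using jet_linear_jet[of "((n, p, q), False)" Z N b] jet_linear_jet[of "((n, p, q), True)" Z N b] assms
  by (simp_all add: jet_def flat_def grid_index_def)

lemma jet_linear_cong:
  assumes "jet_linear b Z N S" "\<And>V z. lateral_neumann b Z N V \<Longrightarrow> z \<in> {-b..b} \<Longrightarrow> T V z = S V z"
  shows "jet_linear b Z N T"
  using assms unfolding jet_linear_def by auto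

text \<open>The neighbour of an interior node may lie on the lateral boundary; its value then equals that of an interior node.\<close>

lemma jet_linear_neighbour:
  assumes "Z \<ge> 2" "n < N" "p \<le> Z" "q \<in> {1..Z-1}"
  shows "jet_linear b Z N (\<lambda>V z. V n p q z)" "jet_linear b Z N (\<lambda>V z. V n q p z)"
proof -
  consider "p = 0" | "p = Z" | "p \<in> {1..Z-1}" using assms by fastforce
  then show "jet_linear b Z N (\<lambda>V z. V n p q z)"
  proof cases
    case 1
    show ?thesis
      by (rule jet_linear_cong[OF jet_linear_interior(1)[of n N 1 Z q]])
         (use assms 1 in \<open>auto simp: lateral_neumann_def\<close>)
  next
    case 2
    show ?thesis
      by (rule jet_linear_cong[OF jet_linear_interior(1)[of n N "Z-1" Z q]])
         (use assms 2 in \<open>auto simp: lateral_neumann_def\<close>)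
  qed (use assms jet_linear_interior in blast)
  consider "p = 0" | "p = Z" | "p \<in> {1..Z-1}" using assms by fastforce
  then show "jet_linear b Z N (\<lambda>V z. V n q p z)"
  proof cases
    case 1
    show ?thesis
      by (rule jet_linear_cong[OF jet_linear_interior(1)[of n N q Z 1]])
         (use assms 1 in \<open>auto simp: lateral_neumann_def\<close>)
  next
    case 2
    show ?thesis
      by (rule jet_linear_cong[OF jet_linear_interior(1)[of n N q Z "Z-1"]])
         (use assms 2 in \<open>auto simp: lateral_neumann_def\<close>)
  qed (use assms jet_linear_interior in blast)
qed

lemma jet_linear_const_mult:
  assumes "jet_linear b Z N S"
  shows "jet_linear b Z N (\<lambda>V z. x * S V z)"
  by (rule jet_linear_cmult[OF assms continuous_on_const])

lemma jet_linear_diff: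
  assumes "jet_linear b Z N S" "jet_linear b Z N T"
  shows "jet_linear b Z N (\<lambda>V z. S V z - T V z)"
  using jet_linear_add[OF assms(1) jet_linear_const_mult[OF assms(2), of "-1"]] by simp

lemma jet_linear_divide:
  assumes "jet_linear b Z N S"
  shows "jet_linear b Z N (\<lambda>V z. S V z / x)"
  using jet_linear_const_mult[OF assms, of "inverse x"] by (simp add: divide_inverse mult.commute)

lemma jet_linear_differences:
  assumes Z: "Z \<ge> 2" and n: "n < N" and pq: "p \<in> {1..Z-1}" "q \<in> {1..Z-1}"
  shows "jet_linear b Z N (\<lambda>V z. dxh R Z (V n) p q z)" "jet_linear b Z N (\<lambda>V z. dyh R Z (V n) p q z)"
    "jet_linear b Z N (\<lambda>V z. dxxh R Z (V n) p q z)" "jet_linear b Z N (\<lambda>V z. dyyh R Z (V n) p q z)"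
proof -
  have "p + 1 \<le> Z" "p - 1 \<le> Z" "q + 1 \<le> Z" "q - 1 \<le> Z" "p \<le> Z" using pq Z by auto
  note N = jet_linear_neighbour(1)[OF Z n _ pq(2)] jet_linear_neighbour(2)[OF Z n _ pq(1)] this
  show "jet_linear b Z N (\<lambda>V z. dxh R Z (V n) p q z)" "jet_linear b Z N (\<lambda>V z. dyh R Z (V n) p q z)"
    "jet_linear b Z N (\<lambda>V z. dxxh R Z (V n) p q z)" "jet_linear b Z N (\<lambda>V z. dyyh R Z (V n) p q z)"
    unfolding dxh_def dyh_def dxxh_def dyyh_def
    by (intro jet_linear_divide jet_linear_add jet_linear_diff jet_linear_const_mult N)+
qed

lemma jet_linear_grad_h:
  assumes "Z \<ge> 2" "n < N" "p \<in> {1..Z-1}" "q \<in> {1..Z-1}"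
  shows "jet_linear b Z N (\<lambda>V z. vec_nth (grad_h R b Z (V n) p q z) i)"
proof -
  have "vec_nth (grad_h R b Z (V n) p q z) i = (if i = 1 then dxh R Z (V n) p q z
      else if i = 2 then dyh R Z (V n) p q z else dz b (V n p q) z)" for V :: sdvec and z
    using exhaust_3[of i] by (auto simp: grad_h_def)
  then show ?thesis
    using jet_linear_differences(1,2)[OF assms, of b R] jet_linear_interior(2)[OF assms(2-4), of b]
    by (cases "i = 1"; cases "i = 2") simp_all
qed

lemma jet_quadratic_add:
  assumes "jet_quadratic b Z N S" "jet_quadratic b Z N T"
  shows "jet_quadratic b Z N (\<lambda>V z. S V z + T V z)"
proof -
  obtain a q where a: "\<And>c. continuous_on {-b..b} (a c)" "\<And>c e. continuous_on {-b..b} (q c e)"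
    "\<And>V z. lateral_neumann b Z N V \<Longrightarrow> z \<in> {-b..b} \<Longrightarrow>
      S V z = linear_form b Z N a V z +
          quadratic_form b Z N q V z"
    using assms(1) by (rule jet_quadraticE) blast
  obtain a' q' where a': "\<And>c. continuous_on {-b..b} (a' c)" "\<And>c e. continuous_on {-b..b} (q' c e)"
    "\<And>V z. lateral_neumann b Z N V \<Longrightarrow> z \<in> {-b..b} \<Longrightarrow>
      T V z = linear_form b Z N a' V z +
          quadratic_form b Z N q' V z"
    using assms(2) by (rule jet_quadraticE) blast
  show ?thesis
    unfolding jet_quadratic_def
    by (rule exI[of _ "\<lambda>c z. a c z + a' c z"], rule exI[of _ "\<lambda>c e z. q c e z + q' c e z"])
       (auto intro!: continuous_intros a a' simp: a(3) a'(3) distrib_right sum.distrib)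
qed

lemma jet_quadratic_const_mult:
  assumes S: "jet_quadratic b Z N S"
  shows "jet_quadratic b Z N (\<lambda>V z. x * S V z)"
proof -
  obtain a q where a: "\<And>c. continuous_on {-b..b} (a c)" "\<And>c e. continuous_on {-b..b} (q c e)"
    "\<And>V z. lateral_neumann b Z N V \<Longrightarrow> z \<in> {-b..b} \<Longrightarrow>
      S V z = linear_form b Z N a V z +
          quadratic_form b Z N q V z"
    using assms(1) by (rule jet_quadraticE) blast
  show ?thesis
    unfolding jet_quadratic_def
    by (rule exI[of _ "\<lambda>c z. x * a c z"], rule exI[of _ "\<lambda>c e z. x * q c e z"])
       (auto intro!: continuous_intros a simp: a(3) distrib_left sum_distrib_left mult.assoc)
qed

lemma jet_quadratic_linear:
  assumes S: "jet_linear b Z N S"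
  shows "jet_quadratic b Z N S"
proof -
  obtain a where a: "\<And>c. continuous_on {-b..b} (a c)" "\<And>V z. lateral_neumann b Z N V \<Longrightarrow> z \<in> {-b..b} \<Longrightarrow>
      S V z = linear_form b Z N a V z"
    using assms by (rule jet_linearE) blast
  show ?thesis
    unfolding jet_quadratic_def
    by (rule exI[of _ a], rule exI[of _ "\<lambda>c e z. 0"]) (auto simp: a(2) intro: a(1))
qed

lemma jet_quadratic_sum:
  assumes "finite S" "\<And>s. s \<in> S \<Longrightarrow> jet_quadratic b Z N (T s)"
  shows "jet_quadratic b Z N (\<lambda>V z. \<Sum>s\<in>S. T s V z)"
  using assms by induction (auto intro: jet_quadratic_linear[OF jet_linear_0] jet_quadratic_add)

lemma jet_quadratic_mult:
  assumes "jet_linear b Z N S" "jet_linear b Z N T"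
  shows "jet_quadratic b Z N (\<lambda>V z. S V z * T V z)"
proof -
  obtain a where a: "\<And>c. continuous_on {-b..b} (a c)" "\<And>V z. lateral_neumann b Z N V \<Longrightarrow> z \<in> {-b..b} \<Longrightarrow>
      S V z = linear_form b Z N a V z"
    using assms(1) by (rule jet_linearE) blast
  obtain a' where a': "\<And>c. continuous_on {-b..b} (a' c)" "\<And>V z. lateral_neumann b Z N V \<Longrightarrow> z \<in> {-b..b} \<Longrightarrow>
      T V z = linear_form b Z N a' V z"
    using assms(2) by (rule jet_linearE) blast
  have "S V z * T V z = (\<Sum>c\<in>grid_index Z N \<times> UNIV. \<Sum>e\<in>grid_index Z N \<times> UNIV.
             a c z * a' e z * jet b (flat V) z c * jet b (flat V) z e)"
    if "lateral_neumann b Z N V" "z \<in> {-b..b}" for V z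
    unfolding a(2)[OF that] a'(2)[OF that] sum_product by (intro sum.cong refl) (simp add: mult_ac)
  then show ?thesis
    unfolding jet_quadratic_def
    by (intro exI[of _ "\<lambda>c z. 0"] exI[of _ "\<lambda>c e z. a c z * a' e z"] conjI allI impI ballI)
       (auto intro!: continuous_intros a a')
qed

lemma jet_quadratic_cong:
  assumes "jet_quadratic b Z N S" "\<And>V z. z \<in> {-b..b} \<Longrightarrow> T V z = S V z"
  shows "jet_quadratic b Z N T"
  using assms unfolding jet_quadratic_def by auto

lemma jet_linear_weighted_integral:
  fixes X :: "real \<Rightarrow> real \<Rightarrow> complex ^ 3" and w :: "real \<Rightarrow> real"
  assumes Z: "Z \<ge> 2" and n: "n < N" and pq: "p \<in> {1..Z-1}" "q \<in> {1..Z-1}"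
    and w: "continuous_on {a1..a2} w"
    and X: "\<And>i. continuous_on ({-b..b} \<times> {a1..a2}) (\<lambda>(z, \<alpha>). vec_nth (X z \<alpha>) i)"
  shows "jet_linear b Z N (\<lambda>V z. integral {a1..a2} (\<lambda>\<alpha>. of_real (w \<alpha>) * bdot (grad_h R b Z (V n) p q z) (X z \<alpha>)))"
proof (rule jet_linear_cong)
  show "jet_linear b Z N (\<lambda>V z. \<Sum>i\<in>UNIV. integral {a1..a2} (\<lambda>\<alpha>. of_real (w \<alpha>) * vec_nth (X z \<alpha>) i) *
      vec_nth (grad_h R b Z (V n) p q z) i)"
    by (intro jet_linear_sum jet_linear_cmult jet_linear_grad_h Z n pq continuous_on_weighted_integral[OF X w] finite)
  fix V :: sdvec and z assume z: "z \<in> {-b..b}"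
  have "continuous_on {a1..a2} (\<lambda>\<alpha>. case (z, \<alpha>) of (z, \<alpha>) \<Rightarrow> vec_nth (X z \<alpha>) i)" for i
    by (rule continuous_on_compose2[OF X]) (use z in \<open>auto intro!: continuous_intros\<close>)
  then have c: "continuous_on {a1..a2} (\<lambda>\<alpha>. vec_nth (X z \<alpha>) i)" for i
    by simp
  show "integral {a1..a2} (\<lambda>\<alpha>. of_real (w \<alpha>) * bdot (grad_h R b Z (V n) p q z) (X z \<alpha>)) =
      (\<Sum>i\<in>UNIV. integral {a1..a2} (\<lambda>\<alpha>. of_real (w \<alpha>) * vec_nth (X z \<alpha>) i) * vec_nth (grad_h R b Z (V n) p q z) i)"
    by (rule weighted_integral_bdot[OF c w])
qed

lemma jet_quadratic_f_nonlin:
  assumes db: "d > b" and Z: "Z \<ge> 2" and pq: "p \<in> {1..Z-1}" "q \<in> {1..Z-1}"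
  shows "jet_quadratic b Z N (\<lambda>V z. f_nonlin d a1 a2 k N (vector [x1, x2, z]) (\<lambda>l. grad_h R b Z (V l) p q z) m)"
proof -
  have 1: "jet_quadratic b Z N (\<lambda>V z. bdot (grad_h R b Z (V n) p q z) (grad_h R b Z (V l) p q z) *
      of_real (integral {a1..a2} (\<lambda>\<alpha>. Psi a1 a2 m \<alpha> * Psi a1 a2 n \<alpha> * deriv (Psi a1 a2 l) \<alpha>)))"
    if "n < N" "l < N" for n l
    unfolding bdot_def
    by (subst mult.commute)
       (intro jet_quadratic_const_mult jet_quadratic_sum jet_quadratic_mult jet_linear_grad_h Z pq that finite)
  have 2: "jet_quadratic b Z N (\<lambda>V z. integral {a1..a2} (\<lambda>\<alpha>. of_real (Psi a1 a2 m \<alpha> * deriv (Psi a1 a2 n) \<alpha>) *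
      bdot (grad_h R b Z (V n) p q z) (x_tilde k d (vector [x1, x2, z]) \<alpha>)))" if "n < N" for n
    by (intro jet_quadratic_linear jet_linear_weighted_integral Z that pq continuous_intros continuous_on_x_tilde db)
  have 3: "jet_quadratic b Z N (\<lambda>V z. integral {a1..a2} (\<lambda>\<alpha>. of_real (Psi a1 a2 m \<alpha> * Psi a1 a2 n \<alpha>) *
      bdot (x_hat k d (vector [x1, x2, z]) \<alpha>) (grad_h R b Z (V n) p q z)))" if "n < N" for n
    unfolding bdot_commute[of "x_hat k d _ _"]
    by (intro jet_quadratic_linear jet_linear_weighted_integral Z that pq continuous_intros continuous_on_x_hat db)
  show ?thesis
    unfolding f_nonlin_def
    by (intro jet_quadratic_add jet_quadratic_const_mult jet_quadratic_sum finite_lessThan; intro 1 2 3; simp)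
qed

lemma jet_quadratic_lower_order_L_h:
  assumes db: "d > b" and Z: "Z \<ge> 2" and n: "n < N" and pq: "p \<in> {1..Z-1}" "q \<in> {1..Z-1}"
  shows "jet_quadratic b Z N (\<lambda>V z. L_h R b d a1 a2 k Z N V n p q z - dzz b (V n p q) z)"
proof (rule jet_quadratic_cong)
  show "jet_quadratic b Z N (\<lambda>V z. dxxh R Z (V n) p q z + dyyh R Z (V n) p q z +
     (\<Sum>m<N. of_real (S_inv a1 a2 N $$ (n, m)) *
        f_nonlin d a1 a2 k N (vector [node R Z p, node R Z q, z]) (\<lambda>l. grad_h R b Z (V l) p q z) m))"
    by (intro jet_quadratic_add jet_quadratic_linear jet_linear_differences jet_quadratic_sum
        jet_quadratic_const_mult jet_quadratic_f_nonlin db Z n pq finite_lessThan)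
qed (simp add: L_h_def laplace_h_def K_nonlin_def)

lemma jet_linear_lower_order_laplace_h:
  assumes Z: "Z \<ge> 2" and n: "n < N" and pq: "p \<in> {1..Z-1}" "q \<in> {1..Z-1}"
  shows "jet_linear b Z N (\<lambda>V z. laplace_h R b Z (V n) p q z - dzz b (V n p q) z)"
proof (rule jet_linear_cong)
  show "jet_linear b Z N (\<lambda>V z. dxxh R Z (V n) p q z + dyyh R Z (V n) p q z)"
    by (intro jet_linear_add jet_linear_differences Z n pq)
qed (simp add: laplace_h_def)

text \<open>Coefficients are chosen for every interior index; outside the index set they are set to zero, to keep them continuous for all indices.\<close>

lemma L_h_quadratic_operator:
  assumes b: "b > 0" and db: "d > b" and Z: "Z \<ge> 2"
  obtains A Q where "quadratic_operator b (grid_index Z N) A Q"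
    "\<And>V n p q z. lateral_neumann b Z N V \<Longrightarrow> (n, p, q) \<in> grid_index Z N \<Longrightarrow> z \<in> {-b..b} \<Longrightarrow>
       L_h R b d a1 a2 k Z N V n p q z = quadratic_operator.op b (grid_index Z N) A Q (flat V) (n, p, q) z"
proof -
  define T where "T = (\<lambda>i (V :: sdvec) z. case i of (n, p, q) \<Rightarrow> L_h R b d a1 a2 k Z N V n p q z - dzz b (V n p q) z)"
  have "\<forall>i\<in>grid_index Z N. jet_quadratic b Z N (T i)"
    using jet_quadratic_lower_order_L_h[OF db Z] by (auto simp: T_def grid_index_def)
  then have "\<forall>i\<in>grid_index Z N. \<exists>aq. (\<forall>c. continuous_on {-b..b} (fst aq c)) \<and> (\<forall>c e. continuous_on {-b..b} (snd aq c e)) \<and>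
     (\<forall>V. lateral_neumann b Z N V \<longrightarrow> (\<forall>z\<in>{-b..b}.
        T i V z = linear_form b Z N (fst aq) V z +
          quadratic_form b Z N (snd aq) V z))"
    unfolding jet_quadratic_def split_paired_Ex fst_conv snd_conv .
  from bchoice[OF this] obtain aq where aq0: "\<forall>i\<in>grid_index Z N. (\<forall>c. continuous_on {-b..b} (fst (aq i) c)) \<and>
     (\<forall>c e. continuous_on {-b..b} (snd (aq i) c e)) \<and>
     (\<forall>V. lateral_neumann b Z N V \<longrightarrow> (\<forall>z\<in>{-b..b}.
        T i V z = linear_form b Z N (fst (aq i)) V z +
          quadratic_form b Z N (snd (aq i)) V z))" ..
  have aq: "i \<in> grid_index Z N \<Longrightarrow> continuous_on {-b..b} (fst (aq i) c)"
      "i \<in> grid_index Z N \<Longrightarrow> continuous_on {-b..b} (snd (aq i) c e)"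
      "i \<in> grid_index Z N \<Longrightarrow> lateral_neumann b Z N V \<Longrightarrow> z \<in> {-b..b} \<Longrightarrow>
        T i V z = linear_form b Z N (fst (aq i)) V z +
          quadratic_form b Z N (snd (aq i)) V z" for i c e V z
    using aq0 by blast+
  define A where "A = (\<lambda>i c z. if i \<in> grid_index Z N then fst (aq i) c z else 0)"
  define Q where "Q = (\<lambda>i c e z. if i \<in> grid_index Z N then snd (aq i) c e z else 0)"
  have "continuous_on {-b..b} (A i c)" "continuous_on {-b..b} (Q i c e)" for i c e
    using aq(1)[of i c] aq(2)[of i c e] by (cases "i \<in> grid_index Z N"; simp add: A_def Q_def)+
  then interpret quadratic_operator b "grid_index Z N" A Q
    by unfold_locales (simp_all add: b)
  show ?thesis
  proof (rule that[OF quadratic_operator_axioms])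
    fix V n p q z assume V: "lateral_neumann b Z N V" and i: "(n, p, q) \<in> grid_index Z N" and z: "z \<in> {-b..b}"
    show "L_h R b d a1 a2 k Z N V n p q z = op (flat V) (n, p, q) z"
      unfolding op_def lin_def quad_def J_def
      using aq(3)[OF i V z] i by (simp add: A_def Q_def T_def flat_def algebra_simps)
  qed
qed

lemma laplace_h_linear_operator:
  assumes b: "b > 0" and Z: "Z \<ge> 2"
  obtains A where "quadratic_operator b (grid_index Z N) A (\<lambda>i c e z. 0)"
    "\<And>V n p q z. lateral_neumann b Z N V \<Longrightarrow> (n, p, q) \<in> grid_index Z N \<Longrightarrow> z \<in> {-b..b} \<Longrightarrow>
       laplace_h R b Z (V n) p q z = quadratic_operator.op b (grid_index Z N) A (\<lambda>i c e z. 0) (flat V) (n, p, q) z"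
proof -
  define T where "T = (\<lambda>i (V :: sdvec) z. case i of (n, p, q) \<Rightarrow> laplace_h R b Z (V n) p q z - dzz b (V n p q) z)"
  have "\<forall>i\<in>grid_index Z N. jet_linear b Z N (T i)"
    using jet_linear_lower_order_laplace_h[OF Z] by (auto simp: T_def grid_index_def)
  from bchoice[OF this[unfolded jet_linear_def]] obtain a where
    a0: "\<forall>i\<in>grid_index Z N. (\<forall>c. continuous_on {-b..b} (a i c)) \<and> (\<forall>V. lateral_neumann b Z N V \<longrightarrow> (\<forall>z\<in>{-b..b}.
        T i V z = linear_form b Z N (a i) V z))" ..
  have a: "i \<in> grid_index Z N \<Longrightarrow> continuous_on {-b..b} (a i c)"
      "i \<in> grid_index Z N \<Longrightarrow> lateral_neumann b Z N V \<Longrightarrow> z \<in> {-b..b} \<Longrightarrow>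
        T i V z = linear_form b Z N (a i) V z" for i c V z
    using a0 by blast+
  define A where "A = (\<lambda>i c z. if i \<in> grid_index Z N then a i c z else 0)"
  have "continuous_on {-b..b} (A i c)" for i c
    using a(1)[of i c] by (cases "i \<in> grid_index Z N"; simp add: A_def)+
  then interpret quadratic_operator b "grid_index Z N" A "\<lambda>i c e z. 0"
    by unfold_locales (simp_all add: b)
  show ?thesis
  proof (rule that[OF quadratic_operator_axioms])
    fix V n p q z assume V: "lateral_neumann b Z N V" and i: "(n, p, q) \<in> grid_index Z N" and z: "z \<in> {-b..b}"
    show "laplace_h R b Z (V n) p q z = op (flat V) (n, p, q) z"
      unfolding op_def lin_def quad_def J_def
      using a(2)[OF i V z] i by (simp add: A_def T_def flat_def algebra_simps)
  qed
qed

section \<open>Transfer between grid functions and indexed families\<close>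

lemma mesh_pos: "R > 0 \<Longrightarrow> Z \<ge> 2 \<Longrightarrow> mesh R Z > 0"
  by (simp add: mesh_def)

lemma sum_grid_index:
  "(\<Sum>i\<in>grid_index Z N. f i) = (\<Sum>p\<in>{1..Z-1}. \<Sum>q\<in>{1..Z-1}. \<Sum>n<N. f (n, p, q))"
proof -
  have "(\<Sum>i\<in>grid_index Z N. f i) = (\<Sum>n<N. \<Sum>p\<in>{1..Z-1}. \<Sum>q\<in>{1..Z-1}. f (n, p, q))"
    unfolding grid_index_def by (simp add: sum.cartesian_product)
  also have "\<dots> = (\<Sum>p\<in>{1..Z-1}. \<Sum>n<N. \<Sum>q\<in>{1..Z-1}. f (n, p, q))"
    by (rule sum.swap)
  also have "\<dots> = (\<Sum>p\<in>{1..Z-1}. \<Sum>q\<in>{1..Z-1}. \<Sum>n<N. f (n, p, q))"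
    by (intro sum.cong refl sum.swap)
  finally show ?thesis .
qed

text \<open>Moves the summation over components out of the integral and merges it with the summation over nodes.\<close>

lemma grid_sum_integral_eq:
  assumes "\<And>n p q. n < N \<Longrightarrow> p \<in> {1..Z-1} \<Longrightarrow> q \<in> {1..Z-1} \<Longrightarrow> f n p q integrable_on {-b..b}"
  shows "grid_sum R Z (\<lambda>p q. integral {-b..b} (\<lambda>z. \<Sum>n<N. f n p q z)) =
    (mesh R Z)\<^sup>2 * (\<Sum>(n, p, q)\<in>grid_index Z N. integral {-b..b} (f n p q))"
proof -
  have "integral {-b..b} (\<lambda>z. \<Sum>n<N. f n p q z) = (\<Sum>n<N. integral {-b..b} (f n p q))"
    if "p \<in> {1..Z-1}" "q \<in> {1..Z-1}" for p q
    by (rule integral_sum) (use assms that in auto)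
  then show ?thesis
    unfolding grid_sum_def sum_grid_index sum_distrib_left by (intro sum.cong refl) (simp add: sum_distrib_left)
qed

lemma flat_h2_space_iff: "V \<in> H2h b Z N \<longleftrightarrow> flat V \<in> h2_space b (grid_index Z N)"
  by (auto simp: H2h_def h2_space_def flat_def grid_index_def)

lemma flat_sd_add: "flat (sd_add V r) = sd_plus (flat V) (flat r)"
  by (auto simp: flat_def sd_add_def sd_plus_def fun_eq_iff)

lemma flat_sd_diff: "flat (sd_diff V W) = sd_plus (flat V) (sd_cmult (-1) (flat W))"
  by (auto simp: flat_def sd_diff_def sd_plus_def sd_cmult_def fun_eq_iff)

lemma flat_zero_cauchy:
  "cauchy_data b Z N (\<lambda>n p q. 0) (\<lambda>n p q. 0) r \<longleftrightarrow> zero_cauchy b (grid_index Z N) (flat r)"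
  by (auto simp: cauchy_data_def zero_cauchy_def flat_def grid_index_def)

context quadratic_operator
begin

lemma h2_ip_integrable:
  assumes "u \<in> h2_space b I" "v \<in> h2_space b I" "i \<in> I"
  shows "(\<lambda>z. inner (u i z) (v i z) + inner (dz b (u i) z) (dz b (v i) z) +
     inner (dzz b (u i) z) (dzz b (v i) z)) integrable_on {-b..b}"
proof -
  have 1: "(\<lambda>z. inner (dzz b (u i) z) (dzz b (v i) z)) integrable_on {-b..b}"
    using sq_integrable_inner[OF sq_integrable_dzz[OF assms(1,3)] sq_integrable_dzz[OF assms(2,3)]]
    by (simp add: absolutely_integrable_on_def)
  have 2: "(\<lambda>z. inner (u i z) (v i z) + inner (dz b (u i) z) (dz b (v i) z)) integrable_on {-b..b}"
    by (intro integrable_continuous_real continuous_intros H2_interval_continuous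
      H2_interval_continuous_dz b h2_spaceD[OF assms(1,3)] h2_spaceD[OF assms(2,3)])
  show ?thesis by (rule integrable_add[OF 2 1])
qed

end

text \<open>A grid operator \<open>L\<close> that acts on laterally admissible functions as an operator of the previous kind. It is instantiated both
  with the nonlinear operator and with the discrete Laplacian.\<close>

locale grid_operator = quadratic_operator b "grid_index Z N" A Q
  for b :: real and Z N :: nat and A Q +
  fixes R :: real and L :: "sdvec \<Rightarrow> sdvec"
  assumes R: "R > 0" and Z: "Z \<ge> 2"
    and L: "\<And>V n p q z. lateral_neumann b Z N V \<Longrightarrow> (n, p, q) \<in> grid_index Z N \<Longrightarrow> z \<in> {-b..b} \<Longrightarrow>
       L V n p q z = op (flat V) (n, p, q) z"
begin

abbreviation "h \<equiv> mesh R Z"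
abbreviation "I \<equiv> grid_index Z N"

lemma h: "h > 0" by (rule mesh_pos[OF R Z])

definition cost :: "(real \<Rightarrow> real) \<Rightarrow> sdvec \<Rightarrow> real" where
  "cost \<mu> V = grid_sum R Z (\<lambda>p q. integral {-b..b} (\<lambda>z. (\<Sum>n<N. (cmod (L V n p q z))\<^sup>2) * \<mu> z))"

lemma ip_H2h_eq:
  assumes "u \<in> H2h b Z N" "v \<in> H2h b Z N"
  shows "ip_H2h R b Z N u v = h\<^sup>2 * h2_ip b I (flat u) (flat v)"
  unfolding ip_H2h_def
proof (subst grid_sum_integral_eq)
  fix n p q assume *: "n < N" "p \<in> {1..Z - 1}" "q \<in> {1..Z - 1}"
  then have "(n, p, q) \<in> I" by (simp add: grid_index_def)
  from h2_ip_integrable[OF assms[unfolded flat_h2_space_iff] this]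
  show "(\<lambda>z. inner (u n p q z) (v n p q z) + inner (dz b (u n p q) z) (dz b (v n p q) z) +
        inner (dzz b (u n p q) z) (dzz b (v n p q) z)) integrable_on {-b..b}"
    by (simp add: flat_def)
qed (auto simp: h2_ip_def flat_def intro!: sum.cong)

lemma norm_H2h_eq:
  assumes "u \<in> H2h b Z N"
  shows "(norm_H2h R b Z N u)\<^sup>2 = h\<^sup>2 * h2_ip b I (flat u) (flat u)" "0 \<le> norm_H2h R b Z N u"
  using ip_H2h_eq[OF assms assms] h2_ip_self_nonneg[of "flat u"] assms
  by (simp_all add: norm_H2h_def flat_h2_space_iff)

lemma L_eq:
  assumes "lateral_neumann b Z N V" "(n, p, q) \<in> I" "z \<in> {-b..b}"
  shows "(cmod (L V n p q z))\<^sup>2 * \<mu> z = (cmod (op (flat V) (n, p, q) z))\<^sup>2 * \<mu> z"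
  using L[OF assms] by simp

lemma cost_integrable:
  assumes V: "V \<in> H2h b Z N" "lateral_neumann b Z N V" and i: "(n, p, q) \<in> I" and \<mu>: "continuous_on {-b..b} \<mu>"
  shows "(\<lambda>z. (cmod (L V n p q z))\<^sup>2 * \<mu> z) integrable_on {-b..b}"
proof -
  have "(\<lambda>z. (cmod (op (flat V) (n, p, q) z))\<^sup>2 * \<mu> z) integrable_on {-b..b}"
    using V i by (intro sq_integrable_weighted_square sq_integrable_op \<mu>) (auto simp: flat_h2_space_iff)
  then show ?thesis
    by (rule integrable_eq) (rule L_eq[OF V(2) i, symmetric])
qed

lemma cost_eq:
  assumes V: "V \<in> H2h b Z N" "lateral_neumann b Z N V" and \<mu>: "continuous_on {-b..b} \<mu>"
  shows "cost \<mu> V = h\<^sup>2 * functional \<mu> (flat V)"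
proof -
  have "cost \<mu> V = h\<^sup>2 * (\<Sum>(n, p, q)\<in>I. weighted_sq b \<mu> (L V n p q))"
    unfolding cost_def sum_distrib_right
    by (rule grid_sum_integral_eq) (rule cost_integrable[OF V _ \<mu>], simp add: grid_index_def)
  also have "(\<Sum>(n, p, q)\<in>I. weighted_sq b \<mu> (L V n p q)) = functional \<mu> (flat V)"
    unfolding functional_def using L_eq[OF V(2)] by (intro sum.cong refl) (auto intro!: integral_cong)
  finally show ?thesis .
qed

lemma h2_bc_space_eq_H2h_0:
  assumes "r \<in> H2h_0 b Z N"
  shows "flat r \<in> h2_bc_space" "lateral_neumann b Z N r"
  using assms unfolding h2_bc_space_def by (auto simp: H2h_0_def H2_bc_def H2h_def discrete_neumann_def
      cauchy_data_def flat_def grid_index_def)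

lemma lateral_neumann_add:
  "lateral_neumann b Z N V \<Longrightarrow> lateral_neumann b Z N r \<Longrightarrow> lateral_neumann b Z N (sd_add V r)"
  by (simp add: lateral_neumann_def sd_add_def)

lemma H2h_add:
  assumes "V \<in> H2h b Z N" "r \<in> H2h b Z N"
  shows "sd_add V r \<in> H2h b Z N"
  using h2_space_plus assms by (simp add: flat_h2_space_iff flat_sd_add)

lemma H2h_diff:
  assumes "V \<in> H2h b Z N" "r \<in> H2h b Z N"
  shows "sd_diff V r \<in> H2h b Z N"
  using h2_space_plus h2_space_cmult assms by (simp add: flat_h2_space_iff flat_sd_diff)

lemma cost_expansion:
  assumes V: "V \<in> H2h b Z N" "lateral_neumann b Z N V" and r: "r \<in> H2h b Z N" "lateral_neumann b Z N r"
    and \<mu>: "continuous_on {-b..b} \<mu>"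
  shows "cost \<mu> (sd_add V r) - cost \<mu> V = h\<^sup>2 * first_variation \<mu> (flat V) (flat r) + h\<^sup>2 * remainder \<mu> (flat V) (flat r)"
proof -
  have "cost \<mu> (sd_add V r) = h\<^sup>2 * functional \<mu> (sd_plus (flat V) (flat r))"
    using cost_eq[OF H2h_add[OF V(1) r(1)] lateral_neumann_add[OF V(2) r(2)] \<mu>] by (simp add: flat_sd_add)
  also have "\<dots> = h\<^sup>2 * (functional \<mu> (flat V) + first_variation \<mu> (flat V) (flat r) + remainder \<mu> (flat V) (flat r))"
    using V(1) r(1) \<mu> by (subst functional_expansion) (simp_all add: flat_h2_space_iff)
  finally show ?thesis by (simp add: cost_eq[OF V \<mu>] distrib_left)
qed

section \<open>Existence and uniqueness of the derivative\<close>

text \<open>Projects a node index to the nearest interior one. Composing with it extends interior values so that the lateral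
  conditions hold.\<close>

definition clamp_index :: "nat \<Rightarrow> nat" where "clamp_index p = max 1 (min (Z - 1) p)"

lemma neumann_extension:
  assumes "g \<in> h2_bc_space"
  shows "\<exists>G\<in>H2h_0 b Z N. \<forall>i\<in>I. flat G i = g i"
proof -
  define G where "G = (\<lambda>n p q. g (n, clamp_index p, clamp_index q))"
  have c: "clamp_index 0 = 1" "clamp_index Z = Z - 1" "\<And>p. p \<in> {1..Z-1} \<Longrightarrow> clamp_index p = p"
    using Z by (auto simp: clamp_index_def)
  have G: "G n p q = g (n, p, q)" if "p \<in> {1..Z-1}" "q \<in> {1..Z-1}" for n p q
    using that c by (simp add: G_def)
  have one: "Suc 0 \<in> {1..Z-1}" "Z - Suc 0 \<in> {1..Z-1}" using Z by auto
  have lat: "lateral_neumann b Z N G"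
    using c(1,2) c(3)[OF one(1)] c(3)[OF one(2)] by (simp add: lateral_neumann_def G_def)
  have "H2_bc b (G n p q)" if "n < N" "p \<in> {1..Z-1}" "q \<in> {1..Z-1}" for n p q
    using assms that unfolding h2_bc_space_def by (simp add: G[OF that(2,3)] grid_index_def)
  then have "G \<in> H2h_0 b Z N"
    using lat by (simp add: H2h_0_def H2h_def discrete_neumann_def cauchy_data_def H2_bc_def)
  moreover have "\<forall>i\<in>I. flat G i = g i"
    by (auto simp: grid_index_def flat_def G)
  ultimately show ?thesis by blast
qed

lemma H2h_0_subset: "r \<in> H2h_0 b Z N \<Longrightarrow> r \<in> H2h b Z N"
  by (simp add: H2h_0_def)

text \<open>The representing element has to be given values at the lateral nodes as well; the extension does not affect the scalar product.\<close>

lemma cost_has_frechet_deriv: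
  assumes V: "V \<in> H2h b Z N" "lateral_neumann b Z N V" and \<mu>: "continuous_on {-b..b} \<mu>"
  shows "\<exists>g. has_frechet_deriv R b Z N (cost \<mu>) V g"
proof -
  have fV: "flat V \<in> h2_space b I" using V by (simp add: flat_h2_space_iff)
  obtain g where g: "g \<in> h2_bc_space" "\<And>r. r \<in> h2_bc_space \<Longrightarrow> h2_ip b I g r = first_variation \<mu> (flat V) r"
    using first_variation_representation[OF fV \<mu>] by blast
  obtain G where G: "G \<in> H2h_0 b Z N" "\<And>i. i \<in> I \<Longrightarrow> flat G i = g i"
    using neumann_extension[OF g(1)] by blast
  obtain C where C: "C \<ge> 0" "\<And>r. r \<in> h2_space b I \<Longrightarrow> h2_ip b I r r \<le> 1 \<Longrightarrow> \<bar>remainder \<mu> (flat V) r\<bar> \<le> C * h2_ip b I r r"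
    using remainder_quadratic_bound[OF fV \<mu>] by blast
  have "has_frechet_deriv R b Z N (cost \<mu>) V G"
    unfolding has_frechet_deriv_def
  proof (intro conjI allI impI G(1))
    fix \<epsilon> :: real assume \<epsilon>: "\<epsilon> > 0"
    \<comment> \<open>The bound \<open>h\<close> ensures that the family underlying \<open>r\<close>, whose norm lacks the factor \<open>h\<close>, has norm at most one.\<close>
    define \<delta> where "\<delta> = min h (\<epsilon> / (C + 1))"
    have \<delta>: "\<delta> > 0" "\<delta> \<le> h" "C * \<delta> \<le> \<epsilon>"
    proof -
      show "\<delta> > 0" "\<delta> \<le> h" using h \<epsilon> C(1) by (auto simp: \<delta>_def)
      have "C * \<delta> \<le> C * (\<epsilon> / (C + 1))" using C(1) by (intro mult_left_mono) (auto simp: \<delta>_def)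
      also have "\<dots> \<le> \<epsilon>" using C(1) \<epsilon> by (simp add: field_simps)
      finally show "C * \<delta> \<le> \<epsilon>" .
    qed
    show "\<exists>\<delta>>0. \<forall>r\<in>H2h_0 b Z N. norm_H2h R b Z N r < \<delta> \<longrightarrow>
        \<bar>cost \<mu> (sd_add V r) - cost \<mu> V - ip_H2h R b Z N G r\<bar> \<le> \<epsilon> * norm_H2h R b Z N r"
    proof (intro exI[of _ \<delta>] conjI ballI impI \<delta>(1))
      fix r assume r: "r \<in> H2h_0 b Z N" and small: "norm_H2h R b Z N r < \<delta>"
      note rb = h2_bc_space_eq_H2h_0[OF r]
      note rH = H2h_0_subset[OF r]
      have fr: "flat r \<in> h2_space b I" using rH by (simp add: flat_h2_space_iff)
      note n = norm_H2h_eq[OF rH]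
      have "(norm_H2h R b Z N r)\<^sup>2 \<le> h\<^sup>2"
        using small \<delta>(2) n(2) by (intro power_mono) auto
      then have "h2_ip b I (flat r) (flat r) \<le> 1"
        using h unfolding n(1) by simp
      from C(2)[OF fr this] have rem: "h\<^sup>2 * \<bar>remainder \<mu> (flat V) (flat r)\<bar> \<le> C * (norm_H2h R b Z N r)\<^sup>2"
        unfolding n(1) using mult_left_mono[of _ _ "h\<^sup>2"] by (metis mult.left_commute zero_le_power2)
      have "ip_H2h R b Z N G r = h\<^sup>2 * first_variation \<mu> (flat V) (flat r)"
      proof -
        have "h2_ip b I (flat G) (flat r) = h2_ip b I g (flat r)"
          unfolding h2_ip_def using G(2) by (intro sum.cong refl) simp
        then show ?thesis
          using ip_H2h_eq[OF H2h_0_subset[OF G(1)] rH] g(2)[OF rb(1)] by simp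
      qed
      then have "\<bar>cost \<mu> (sd_add V r) - cost \<mu> V - ip_H2h R b Z N G r\<bar> = h\<^sup>2 * \<bar>remainder \<mu> (flat V) (flat r)\<bar>"
        using cost_expansion[OF V rH rb(2) \<mu>] by (simp add: abs_mult)
      also have "\<dots> \<le> C * norm_H2h R b Z N r * norm_H2h R b Z N r"
        using rem by (simp add: power2_eq_square mult.assoc)
      also have "\<dots> \<le> (C * \<delta>) * norm_H2h R b Z N r"
        using small n(2) C(1) by (intro mult_right_mono mult_left_mono) auto
      also have "\<dots> \<le> \<epsilon> * norm_H2h R b Z N r"
        using \<delta>(3) n(2) by (rule mult_right_mono)
      finally show "\<bar>cost \<mu> (sd_add V r) - cost \<mu> V - ip_H2h R b Z N G r\<bar> \<le> \<epsilon> * norm_H2h R b Z N r" .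
    qed
  qed
  then show ?thesis by blast
qed

lemma flat_cmult: "flat (\<lambda>n p q z. t * r n p q z) = sd_cmult t (flat r)"
  by (auto simp: flat_def sd_cmult_def fun_eq_iff)

lemma H2h_0_cmult:
  assumes r: "r \<in> H2h_0 b Z N"
  shows "(\<lambda>n p q z. t * r n p q z) \<in> H2h_0 b Z N"
proof -
  have bc: "H2_bc b (\<lambda>z. t * r n p q z)" if "n < N" "p \<in> {1..Z-1}" "q \<in> {1..Z-1}" for n p q
    using h2_bc_space_cmult[OF h2_bc_space_eq_H2h_0(1)[OF r], of t] that
    unfolding h2_bc_space_def by (simp add: grid_index_def sd_cmult_def flat_def)
  have "lateral_neumann b Z N r" by (rule h2_bc_space_eq_H2h_0(2)[OF r])
  then have "lateral_neumann b Z N (\<lambda>n p q z. t * r n p q z)"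
    by (simp add: lateral_neumann_def)
  then show ?thesis
    using bc by (simp add: H2h_0_def H2h_def discrete_neumann_def cauchy_data_def H2_bc_def)
qed

text \<open>Differentiability determines the derivative: along \<open>t r\<close> the difference of the two candidates is \<open>t D\<close>, whereas the definition of
  the derivative and the quadratic bound for the remainder force it to be \<open>o(t)\<close>.\<close>

lemma frechet_deriv_eq_first_variation:
  assumes V: "V \<in> H2h b Z N" "lateral_neumann b Z N V" and \<mu>: "continuous_on {-b..b} \<mu>"
    and g: "has_frechet_deriv R b Z N (cost \<mu>) V g" and r: "r \<in> H2h_0 b Z N"
  shows "ip_H2h R b Z N g r = h\<^sup>2 * first_variation \<mu> (flat V) (flat r)"
proof -
  have fV: "flat V \<in> h2_space b I" using V by (simp add: flat_h2_space_iff)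
  have rH: "r \<in> H2h b Z N" and fr: "flat r \<in> h2_space b I"
    using H2h_0_subset[OF r] by (simp_all add: flat_h2_space_iff)
  have gH: "g \<in> H2h b Z N" using g by (simp add: has_frechet_deriv_def H2h_0_subset)
  obtain C where C: "C \<ge> 0" "\<And>r. r \<in> h2_space b I \<Longrightarrow> h2_ip b I r r \<le> 1 \<Longrightarrow> \<bar>remainder \<mu> (flat V) r\<bar> \<le> C * h2_ip b I r r"
    using remainder_quadratic_bound[OF fV \<mu>] by blast
  define D where "D = h\<^sup>2 * first_variation \<mu> (flat V) (flat r) - ip_H2h R b Z N g r"
  define n where "n = norm_H2h R b Z N r"
  define m where "m = h2_ip b I (flat r) (flat r)"
  have n0: "n \<ge> 0" and m0: "m \<ge> 0" using norm_H2h_eq(2)[OF rH] h2_ip_self_nonneg[OF fr] by (simp_all add: n_def m_def)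
  have "\<bar>D\<bar> \<le> 0 + e" if e: "e > 0" for e
  proof -
    define \<epsilon> where "\<epsilon> = e / (2 * (n + 1))"
    have \<epsilon>: "\<epsilon> > 0" using e n0 by (simp add: \<epsilon>_def)
    then obtain \<delta> where \<delta>: "\<delta> > 0" "\<And>r. r \<in> H2h_0 b Z N \<Longrightarrow> norm_H2h R b Z N r < \<delta> \<Longrightarrow>
        \<bar>cost \<mu> (sd_add V r) - cost \<mu> V - ip_H2h R b Z N g r\<bar> \<le> \<epsilon> * norm_H2h R b Z N r"
      using g unfolding has_frechet_deriv_def by blast
    \<comment> \<open>The four bounds make \<open>t r\<close> small enough for the derivative estimate, \<open>t\<close> at most one, the squared norm of \<open>t r\<close> at most one, and the quadratic
    term at most \<open>e/2\<close>.\<close>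
    define t where "t = min (min 1 (\<delta> / (n + 1) / 2)) (min (1 / (m + 1)) (e / (2 * (h\<^sup>2 * C * m + 1))))"
    have hC: "0 \<le> h\<^sup>2 * C * m" using C(1) m0 by simp
    have t: "t > 0" using \<delta>(1) n0 m0 e hC by (simp add: t_def)
    have t1: "t \<le> 1" "t \<le> \<delta> / (n + 1) / 2" "t \<le> 1 / (m + 1)" "t \<le> e / (2 * (h\<^sup>2 * C * m + 1))"
      unfolding t_def by linarith+
    define s where "s = (\<lambda>n p q z. complex_of_real t * r n p q z)"
    have s0: "s \<in> H2h_0 b Z N" unfolding s_def by (rule H2h_0_cmult[OF r])
    have fs: "flat s = sd_cmult (of_real t) (flat r)" unfolding s_def by (rule flat_cmult)
    have ips: "h2_ip b I (flat s) (flat s) = t\<^sup>2 * m"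
      unfolding fs m_def by (rule h2_ip_cmult_self[OF fr])
    have ns: "norm_H2h R b Z N s = t * n"
    proof -
      have "(norm_H2h R b Z N s)\<^sup>2 = (t * n)\<^sup>2"
        using norm_H2h_eq(1)[OF H2h_0_subset[OF s0]] norm_H2h_eq(1)[OF rH] ips
        by (simp add: n_def m_def power_mult_distrib)
      then show ?thesis
        using norm_H2h_eq(2)[OF H2h_0_subset[OF s0]] t n0 by (simp add: power2_eq_iff_nonneg)
    qed
    have "t * n \<le> \<delta> / (n + 1) / 2 * n" using t1(2) n0 by (rule mult_right_mono)
    also have "\<dots> < \<delta>" using \<delta>(1) n0 by (simp add: field_simps add_nonneg_pos)
    finally have "\<bar>cost \<mu> (sd_add V s) - cost \<mu> V - ip_H2h R b Z N g s\<bar> \<le> \<epsilon> * (t * n)"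
      using \<delta>(2)[OF s0] ns by simp
    moreover have "ip_H2h R b Z N g s = t * ip_H2h R b Z N g r"
      using ip_H2h_eq[OF gH H2h_0_subset[OF s0]] ip_H2h_eq[OF gH rH] fs h2_ip_cmult_right[OF fr] by simp
    moreover have "cost \<mu> (sd_add V s) - cost \<mu> V = t * (h\<^sup>2 * first_variation \<mu> (flat V) (flat r)) + h\<^sup>2 * remainder \<mu> (flat V) (flat s)"
      using cost_expansion[OF V H2h_0_subset[OF s0] h2_bc_space_eq_H2h_0(2)[OF s0] \<mu>]
      by (simp add: fs first_variation_cmult[OF fV fr])
    ultimately have 1: "\<bar>t * D + h\<^sup>2 * remainder \<mu> (flat V) (flat s)\<bar> \<le> \<epsilon> * (t * n)"
      by (simp add: D_def algebra_simps)
    have tm: "t * m \<le> 1" using t1(3) m0 by (simp add: pos_le_divide_eq algebra_simps) (use t in linarith)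
    have "t\<^sup>2 * m \<le> 1" using mult_mono[OF t1(1) tm] t m0 by (simp add: power2_eq_square mult.assoc)
    then have "\<bar>remainder \<mu> (flat V) (flat s)\<bar> \<le> C * (t\<^sup>2 * m)"
      using C(2)[of "flat s"] H2h_0_subset[OF s0] ips by (simp add: flat_h2_space_iff)
    then have 2: "\<bar>h\<^sup>2 * remainder \<mu> (flat V) (flat s)\<bar> \<le> h\<^sup>2 * (C * (t\<^sup>2 * m))"
      unfolding abs_mult by (simp add: mult_left_mono)
    have "t * \<bar>D\<bar> = \<bar>t * D\<bar>" using t by (simp add: abs_mult)
    also have "\<dots> \<le> \<epsilon> * (t * n) + h\<^sup>2 * (C * (t\<^sup>2 * m))" using 1 2 by linarith
    also have "\<dots> = t * (\<epsilon> * n + t * (h\<^sup>2 * C * m))" by (simp add: power2_eq_square algebra_simps)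
    finally have "\<bar>D\<bar> \<le> \<epsilon> * n + t * (h\<^sup>2 * C * m)" using t by simp
    also have "\<epsilon> * n \<le> e / 2"
      using e n0 by (simp add: \<epsilon>_def field_simps)
    also have "t * (h\<^sup>2 * C * m) \<le> e / (2 * (h\<^sup>2 * C * m + 1)) * (h\<^sup>2 * C * m)"
      using t1(4) hC by (rule mult_right_mono)
    also have "\<dots> \<le> e / 2"
    proof -
      define x where "x = h\<^sup>2 * C * m"
      have "x \<ge> 0" using hC by (simp add: x_def)
      then show ?thesis unfolding x_def[symmetric] using e by (simp add: field_simps)
    qed
    finally show ?thesis by simp
  qed
  then have "\<bar>D\<bar> \<le> 0" by (rule field_le_epsilon)
  then show ?thesis by (simp add: D_def)
qed

end

section \<open>Convexity on the closed ball\<close>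

lemma eq_if_norm_arbitrarily_small:
  fixes x :: "'a::real_normed_vector"
  assumes "\<And>\<epsilon>. \<epsilon> > 0 \<Longrightarrow> norm x \<le> K * \<epsilon>" "K \<ge> 0"
  shows "x = 0"
proof -
  have "norm x \<le> 0 + e" if "e > 0" for e
  proof -
    have "norm x \<le> K * (e / (K + 1))" using assms that by (intro assms(1)) auto
    also have "\<dots> \<le> e" using that assms(2) by (simp add: field_simps)
    finally show ?thesis by simp
  qed
  then have "norm x \<le> 0" by (rule field_le_epsilon)
  then show ?thesis by simp
qed

context grid_operator
begin

lemma jet_flat_diff:
  assumes "V \<in> H2h b Z N" "W \<in> H2h b Z N" "z \<in> {-b..b}" "c \<in> J"
  shows "jet b (flat (sd_diff V W)) z c = jet b (flat V) z c - jet b (flat W) z c"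
  using assms h2_space_cmult[of "flat W" "-1"]
  by (simp add: flat_sd_diff jet_plus jet_cmult flat_h2_space_iff)

lemma jet_flat_values:
  assumes "n < N" "p \<in> {1..Z-1}" "q \<in> {1..Z-1}"
  shows "((n, p, q), e) \<in> J" "jet b (flat V) z ((n, p, q), False) = V n p q z"
    "jet b (flat V) z ((n, p, q), True) = dz b (V n p q) z"
proof -
  show "((n, p, q), e) \<in> J" unfolding J_def using assms by (simp add: grid_index_def)
qed (simp_all add: jet_def flat_def)

lemma diff_in_H2h_0:
  assumes V: "V \<in> H2h b Z N" "cauchy_data b Z N \<psi>0 \<psi>1 V" "discrete_neumann b Z N V"
    and W: "W \<in> H2h b Z N" "cauchy_data b Z N \<psi>0 \<psi>1 W" "discrete_neumann b Z N W"
  shows "sd_diff W V \<in> H2h_0 b Z N"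
proof -
  have lat: "lateral_neumann b Z N (sd_diff W V)"
    using V(3) W(3) by (simp add: discrete_neumann_def lateral_neumann_def sd_diff_def)
  have bb: "b \<in> {-b..b}" "-b \<in> {-b..b}" using b by auto
  have dz: "dz b (sd_diff W V n p q) z = dz b (W n p q) z - dz b (V n p q) z"
    if "n < N" "p \<in> {1..Z-1}" "q \<in> {1..Z-1}" "z \<in> {-b..b}" for n p q z
    using jet_flat_diff[OF W(1) V(1) that(4) jet_flat_values(1)[OF that(1-3)], of True]
    by (simp only: jet_flat_values(3)[OF that(1-3)])
  have "discrete_neumann b Z N (sd_diff W V)"
    using lat V(3) W(3) dz[OF _ _ _ bb(1)] by (simp add: discrete_neumann_def)
  moreover have "cauchy_data b Z N (\<lambda>n p q. 0) (\<lambda>n p q. 0) (sd_diff W V)"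
    using V(2) W(2) dz[OF _ _ _ bb(2)] by (simp add: cauchy_data_def) (simp add: sd_diff_def)
  ultimately show ?thesis
    using H2h_diff[OF W(1) V(1)] by (simp add: H2h_0_def)
qed

lemma sobolev_grid:
  assumes V: "V \<in> H2h b Z N" and c: "c \<in> J" and z: "z \<in> {-b..b}"
  shows "cmod (jet b (flat V) z c) \<le> sqrt ((1 + 1 / (2 * b)) / h\<^sup>2) * norm_H2h R b Z N V"
proof -
  have "(cmod (jet b (flat V) z c))\<^sup>2 \<le> (1 + 1 / (2 * b)) * h2_ip b I (flat V) (flat V)"
    using jet_bound[OF _ c z] V by (simp add: flat_h2_space_iff)
  also have "\<dots> = (1 + 1 / (2 * b)) / h\<^sup>2 * (norm_H2h R b Z N V)\<^sup>2"
    using h unfolding norm_H2h_eq(1)[OF V] by simp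
  finally have "cmod (jet b (flat V) z c) \<le> sqrt ((1 + 1 / (2 * b)) / h\<^sup>2 * (norm_H2h R b Z N V)\<^sup>2)"
    by (rule real_le_rsqrt)
  also have "\<dots> = sqrt ((1 + 1 / (2 * b)) / h\<^sup>2) * norm_H2h R b Z N V"
    by (simp only: real_sqrt_mult real_sqrt_abs abs_of_nonneg[OF norm_H2h_eq(2)[OF V]])
  finally show ?thesis .
qed

text \<open>Convergence in the norm implies uniform convergence of values and first derivatives (\<open>sobolev_grid\<close>), so the conditions at
  \<open>z = -b\<close> and \<open>z = b\<close> pass to the limit. The crude bound \<open>2M\<^sup>2 + 2\<close> comes from an approximation within distance one.\<close>

lemma closure_B_properties:
  assumes V: "V \<in> closure_B R b Z N \<psi>0 \<psi>1 M" and M: "M > 0"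
  shows "V \<in> H2h b Z N" "lateral_neumann b Z N V" "cauchy_data b Z N \<psi>0 \<psi>1 V" "discrete_neumann b Z N V"
    "(norm_H2h R b Z N V)\<^sup>2 \<le> 2 * M\<^sup>2 + 2"
proof -
  show VH: "V \<in> H2h b Z N" and lat: "lateral_neumann b Z N V"
    using V by (auto simp: closure_B_def)
  have approx: "\<exists>W. W \<in> H2h b Z N \<and> norm_H2h R b Z N W < M \<and> cauchy_data b Z N \<psi>0 \<psi>1 W \<and> discrete_neumann b Z N W
      \<and> norm_H2h R b Z N (sd_diff V W) < \<epsilon>" if "\<epsilon> > 0" for \<epsilon>
    using V that by (auto simp: closure_B_def B_set_def)
  define K where "K = sqrt ((1 + 1 / (2 * b)) / h\<^sup>2)"
  have K0: "K \<ge> 0" using b by (simp add: K_def)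
  have close: "\<exists>W. cauchy_data b Z N \<psi>0 \<psi>1 W \<and> discrete_neumann b Z N W \<and>
      (\<forall>c\<in>J. \<forall>z\<in>{-b..b}. cmod (jet b (flat V) z c - jet b (flat W) z c) \<le> K * \<epsilon>)" if \<epsilon>: "\<epsilon> > 0" for \<epsilon>
  proof -
    obtain W where W: "W \<in> H2h b Z N" "cauchy_data b Z N \<psi>0 \<psi>1 W" "discrete_neumann b Z N W"
      "norm_H2h R b Z N (sd_diff V W) < \<epsilon>"
      using approx[OF \<epsilon>] by blast
    have "cmod (jet b (flat V) z c - jet b (flat W) z c) \<le> K * \<epsilon>" if "c \<in> J" "z \<in> {-b..b}" for c z
    proof -
      have "cmod (jet b (flat V) z c - jet b (flat W) z c) \<le> K * norm_H2h R b Z N (sd_diff V W)"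
        using sobolev_grid[OF H2h_diff[OF VH W(1)] that] by (simp add: jet_flat_diff[OF VH W(1) that(2,1)] K_def)
      also have "\<dots> \<le> K * \<epsilon>" using W(4) K0 by (intro mult_left_mono) auto
      finally show ?thesis .
    qed
    then show ?thesis using W by blast
  qed
  have lim: "jet b (flat V) z c = x"
    if c: "c \<in> J" and z: "z \<in> {-b..b}"
      and x: "\<And>W. cauchy_data b Z N \<psi>0 \<psi>1 W \<Longrightarrow> discrete_neumann b Z N W \<Longrightarrow> jet b (flat W) z c = x" for c z x
  proof -
    have "cmod (jet b (flat V) z c - x) \<le> K * \<epsilon>" if "\<epsilon> > 0" for \<epsilon>
      using close[OF that] x c z by metis
    then have "jet b (flat V) z c - x = 0"
      by (rule eq_if_norm_arbitrarily_small[OF _ K0])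
    then show ?thesis by simp
  qed
  have bb: "b \<in> {-b..b}" "-b \<in> {-b..b}" using b by auto
  show "cauchy_data b Z N \<psi>0 \<psi>1 V"
    unfolding cauchy_data_def
  proof (intro allI impI ballI conjI)
    fix n p q assume n: "n < N" "p \<in> {1..Z-1}" "q \<in> {1..Z-1}"
    have "jet b (flat V) (-b) ((n, p, q), False) = \<psi>0 n p q"
      by (rule lim[OF jet_flat_values(1)[OF n] bb(2)], subst jet_flat_values[OF n]) (use n in \<open>simp add: cauchy_data_def\<close>)
    then show "V n p q (-b) = \<psi>0 n p q" by (simp only: jet_flat_values[OF n])
    have "jet b (flat V) (-b) ((n, p, q), True) = \<psi>1 n p q"
      by (rule lim[OF jet_flat_values(1)[OF n] bb(2)], subst jet_flat_values[OF n]) (use n in \<open>simp add: cauchy_data_def\<close>)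
    then show "dz b (V n p q) (-b) = \<psi>1 n p q" by (simp only: jet_flat_values[OF n])
  qed
  show "discrete_neumann b Z N V"
    unfolding discrete_neumann_def
  proof (intro allI impI ballI conjI lat)
    fix n p q assume n: "n < N" "p \<in> {1..Z-1}" "q \<in> {1..Z-1}"
    have "jet b (flat V) b ((n, p, q), True) = 0"
      by (rule lim[OF jet_flat_values(1)[OF n] bb(1)], subst jet_flat_values[OF n]) (use n in \<open>simp add: discrete_neumann_def\<close>)
    then show "dz b (V n p q) b = 0" by (simp only: jet_flat_values[OF n])
  qed
  obtain W where W: "W \<in> H2h b Z N" "norm_H2h R b Z N W < M" "norm_H2h R b Z N (sd_diff V W) < 1"
    using approx[of 1] by auto
  have D: "sd_diff V W \<in> H2h b Z N" by (rule H2h_diff[OF VH W(1)])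
  have "flat V = sd_plus (flat (sd_diff V W)) (flat W)"
    by (auto simp: flat_def sd_diff_def sd_plus_def fun_eq_iff)
  then have "h2_ip b I (flat V) (flat V) \<le> 2 * h2_ip b I (flat (sd_diff V W)) (flat (sd_diff V W)) + 2 * h2_ip b I (flat W) (flat W)"
    using h2_ip_plus_le D W(1) by (simp add: flat_h2_space_iff)
  then have "h\<^sup>2 * h2_ip b I (flat V) (flat V) \<le> h\<^sup>2 * (2 * h2_ip b I (flat (sd_diff V W)) (flat (sd_diff V W)) + 2 * h2_ip b I (flat W) (flat W))"
    by (rule mult_left_mono) simp
  then have "(norm_H2h R b Z N V)\<^sup>2 \<le> 2 * (norm_H2h R b Z N (sd_diff V W))\<^sup>2 + 2 * (norm_H2h R b Z N W)\<^sup>2"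
    unfolding norm_H2h_eq(1)[OF VH] norm_H2h_eq(1)[OF D] norm_H2h_eq(1)[OF W(1)] by (simp add: algebra_simps)
  also have "\<dots> \<le> 2 * 1\<^sup>2 + 2 * M\<^sup>2"
    using W norm_H2h_eq(2)[OF D] norm_H2h_eq(2)[OF W(1)] by (intro add_mono mult_left_mono power_mono) auto
  finally show "(norm_H2h R b Z N V)\<^sup>2 \<le> 2 * M\<^sup>2 + 2" by simp
qed

lemma remainder_lower_bound:
  assumes \<theta>: "\<theta> > b" and M: "M \<ge> 0"
  shows "\<exists>lam1>1. \<forall>lam\<ge>lam1. \<forall>V\<in>H2h b Z N. \<forall>r\<in>H2h_0 b Z N.
    (norm_H2h R b Z N V)\<^sup>2 \<le> M \<longrightarrow> (norm_H2h R b Z N (sd_add V r))\<^sup>2 \<le> M \<longrightarrow>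
    exp (2 * lam * (b - \<theta>)\<^sup>2) / 12 * (norm_H2h R b Z N r)\<^sup>2
      \<le> h\<^sup>2 * remainder (carleman_weight \<theta> lam) (flat V) (flat r)"
proof -
  obtain lam1 where lam1: "lam1 > 1" "\<And>lam V r. lam \<ge> lam1 \<Longrightarrow> V \<in> h2_space b I \<Longrightarrow> r \<in> h2_space b I \<Longrightarrow>
      zero_cauchy b I r \<Longrightarrow> h2_ip b I V V \<le> M / h\<^sup>2 \<Longrightarrow> h2_ip b I (sd_plus V r) (sd_plus V r) \<le> M / h\<^sup>2 \<Longrightarrow>
      exp (2 * lam * (b - \<theta>)\<^sup>2) / 12 * h2_ip b I r r \<le> remainder (carleman_weight \<theta> lam) V r"
    using remainder_coercive[OF \<theta>, of "M / h\<^sup>2"] M by auto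
  show ?thesis
  proof (intro exI[of _ lam1] conjI lam1(1) allI impI ballI)
    fix lam V r
    assume *: "lam \<ge> lam1" "V \<in> H2h b Z N" "r \<in> H2h_0 b Z N" "(norm_H2h R b Z N V)\<^sup>2 \<le> M"
      "(norm_H2h R b Z N (sd_add V r))\<^sup>2 \<le> M"
    note rH = H2h_0_subset[OF *(3)]
    have div: "x \<le> M / h\<^sup>2" if "h\<^sup>2 * x \<le> M" for x
      using that h by (simp add: field_simps)
    have "exp (2 * lam * (b - \<theta>)\<^sup>2) / 12 * h2_ip b I (flat r) (flat r) \<le> remainder (carleman_weight \<theta> lam) (flat V) (flat r)"
    proof (rule lam1(2)[OF *(1)])
      show "flat V \<in> h2_space b I" "flat r \<in> h2_space b I" using * rH by (simp_all add: flat_h2_space_iff)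
      show "zero_cauchy b I (flat r)" using *(3) by (simp add: H2h_0_def flat_zero_cauchy)
      show "h2_ip b I (flat V) (flat V) \<le> M / h\<^sup>2"
        using *(4) unfolding norm_H2h_eq(1)[OF *(2)] by (rule div)
      show "h2_ip b I (sd_plus (flat V) (flat r)) (sd_plus (flat V) (flat r)) \<le> M / h\<^sup>2"
        using *(5) unfolding norm_H2h_eq(1)[OF H2h_add[OF *(2) rH]] flat_sd_add by (rule div)
    qed
    from mult_left_mono[OF this, of "h\<^sup>2"]
    show "exp (2 * lam * (b - \<theta>)\<^sup>2) / 12 * (norm_H2h R b Z N r)\<^sup>2
      \<le> h\<^sup>2 * remainder (carleman_weight \<theta> lam) (flat V) (flat r)"
      unfolding norm_H2h_eq(1)[OF rH] by (simp add: algebra_simps)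
  qed
qed

text \<open>Expand about the point \<open>U\<close> of the segment: \<open>V = U - t w\<close> and \<open>W = U + (1 - t) w\<close> with \<open>w = W - V\<close>. In the convex combination the first
  variations cancel, and the two remainders are nonnegative, the first one strictly positive.\<close>

lemma cost_strictly_convex:
  assumes V: "V \<in> H2h b Z N" "lateral_neumann b Z N V" "(norm_H2h R b Z N V)\<^sup>2 \<le> M"
    and W: "W \<in> H2h b Z N" "lateral_neumann b Z N W" "(norm_H2h R b Z N W)\<^sup>2 \<le> M"
    and r: "sd_diff W V \<in> H2h_0 b Z N" "norm_H2h R b Z N (sd_diff W V) > 0"
    and t: "0 < t" "t < 1" and \<mu>: "continuous_on {-b..b} \<mu>"
    and k: "k > 0"
    and coercive: "\<And>V r. V \<in> H2h b Z N \<Longrightarrow> r \<in> H2h_0 b Z N \<Longrightarrow> (norm_H2h R b Z N V)\<^sup>2 \<le> M \<Longrightarrow>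
      (norm_H2h R b Z N (sd_add V r))\<^sup>2 \<le> M \<Longrightarrow>
      k * (norm_H2h R b Z N r)\<^sup>2 \<le> h\<^sup>2 * remainder \<mu> (flat V) (flat r)"
  shows "cost \<mu> (sd_segment V W t) < (1 - t) * cost \<mu> V + t * cost \<mu> W"
proof -
  define U where "U = sd_segment V W t"
  define w where "w = sd_diff W V"
  define r1 where "r1 = (\<lambda>n p q z. complex_of_real (- t) * w n p q z)"
  define r2 where "r2 = (\<lambda>n p q z. complex_of_real (1 - t) * w n p q z)"
  have r12: "r1 \<in> H2h_0 b Z N" "r2 \<in> H2h_0 b Z N"
    unfolding r1_def r2_def using r(1) by (auto intro!: H2h_0_cmult simp: w_def simp del: of_real_diff of_real_minus)
  have V_eq: "sd_add U r1 = V" and W_eq: "sd_add U r2 = W"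
    by (auto simp: U_def r1_def r2_def w_def sd_add_def sd_segment_def sd_diff_def scaleR_conv_of_real fun_eq_iff algebra_simps)
  have fU: "flat U = sd_plus (sd_cmult (of_real (1 - t)) (flat V)) (sd_cmult (of_real t) (flat W))"
    by (auto simp: U_def flat_def sd_segment_def sd_plus_def sd_cmult_def scaleR_conv_of_real fun_eq_iff)
  have div: "x \<le> M / h\<^sup>2" if "h\<^sup>2 * x \<le> M" for x
    using that h by (simp add: field_simps)
  have ipV: "h2_ip b I (flat V) (flat V) \<le> M / h\<^sup>2" using V(3) unfolding norm_H2h_eq(1)[OF V(1)] by (rule div)
  have ipW: "h2_ip b I (flat W) (flat W) \<le> M / h\<^sup>2" using W(3) unfolding norm_H2h_eq(1)[OF W(1)] by (rule div)
  have fV: "flat V \<in> h2_space b I" and fW: "flat W \<in> h2_space b I"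
    using V W by (simp_all add: flat_h2_space_iff)
  note seg = h2_ip_segment_le[OF fV fW less_imp_le[OF t(1)] less_imp_le[OF t(2)] ipV ipW, folded fU]
  have UH: "U \<in> H2h b Z N" using seg(1) by (simp add: flat_h2_space_iff)
  have UM: "(norm_H2h R b Z N U)\<^sup>2 \<le> M"
    unfolding norm_H2h_eq(1)[OF UH] using mult_left_mono[OF seg(2), of "h\<^sup>2"] h by simp
  have Ul: "lateral_neumann b Z N U"
    using V(2) W(2) by (simp add: lateral_neumann_def U_def sd_segment_def)
  have fw: "flat w \<in> h2_space b I"
    using H2h_0_subset[OF r(1)] by (simp add: w_def flat_h2_space_iff)
  define F where "F = h\<^sup>2 * first_variation \<mu> (flat U) (flat w)"
  have F1: "h\<^sup>2 * first_variation \<mu> (flat U) (flat r1) = - t * F"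
    unfolding r1_def flat_cmult using first_variation_cmult[OF seg(1) fw, of \<mu> "- t"] by (simp add: F_def)
  have F2: "h\<^sup>2 * first_variation \<mu> (flat U) (flat r2) = (1 - t) * F"
    unfolding r2_def flat_cmult using first_variation_cmult[OF seg(1) fw, of \<mu> "1 - t"] by (simp add: F_def)
  have e1: "cost \<mu> V - cost \<mu> U = - t * F + h\<^sup>2 * remainder \<mu> (flat U) (flat r1)"
    using cost_expansion[OF UH Ul H2h_0_subset[OF r12(1)] h2_bc_space_eq_H2h_0(2)[OF r12(1)] \<mu>] V_eq F1 by simp
  have e2: "cost \<mu> W - cost \<mu> U = (1 - t) * F + h\<^sup>2 * remainder \<mu> (flat U) (flat r2)"
    using cost_expansion[OF UH Ul H2h_0_subset[OF r12(2)] h2_bc_space_eq_H2h_0(2)[OF r12(2)] \<mu>] W_eq F2 by simp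
  have pos: "0 < h\<^sup>2 * remainder \<mu> (flat U) (flat r1)"
  proof -
    have "flat r1 = sd_cmult (of_real (- t)) (flat w)" unfolding r1_def by (rule flat_cmult)
    then have "(norm_H2h R b Z N r1)\<^sup>2 = t\<^sup>2 * (norm_H2h R b Z N w)\<^sup>2"
      using norm_H2h_eq(1)[OF H2h_0_subset[OF r12(1)]] norm_H2h_eq(1)[OF H2h_0_subset[OF r(1), folded w_def]]
        h2_ip_cmult_self[OF fw, of "- t"] by simp
    then have "0 < k * (norm_H2h R b Z N r1)\<^sup>2" using k t r(2) by (simp add: w_def)
    also have "\<dots> \<le> h\<^sup>2 * remainder \<mu> (flat U) (flat r1)"
      using coercive[OF UH r12(1) UM] V_eq V(3) by simp
    finally show ?thesis .
  qed
  have nonneg: "0 \<le> h\<^sup>2 * remainder \<mu> (flat U) (flat r2)"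
    using order_trans[OF _ coercive[OF UH r12(2) UM]] W_eq W(3) k by simp
  have "(1 - t) * cost \<mu> V + t * cost \<mu> W - cost \<mu> U = (1 - t) * (cost \<mu> V - cost \<mu> U) + t * (cost \<mu> W - cost \<mu> U)"
    by (simp add: algebra_simps)
  also have "\<dots> = (1 - t) * (h\<^sup>2 * remainder \<mu> (flat U) (flat r1)) + t * (h\<^sup>2 * remainder \<mu> (flat U) (flat r2))"
    unfolding e1 e2 by (simp add: algebra_simps)
  also have "\<dots> > 0"
    by (rule add_pos_nonneg[OF mult_pos_pos[OF _ pos] mult_nonneg_nonneg[OF _ nonneg]]) (use t in auto)
  finally show ?thesis by (simp add: U_def)
qed

end

section \<open>The Carleman estimate for the semi-discrete Laplacian\<close>

text \<open>The mesh size is \<open>2R/Z\<close>, so a lower bound for it is an upper bound for \<open>Z\<close>.\<close>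

lemma finite_admissible_grids:
  assumes "R > 0" "h0 > 0"
  shows "finite {Z. admissible_grid R h0 Z}" "admissible_grid R h0 Z \<Longrightarrow> real Z \<le> 2 * R / h0"
proof -
  show *: "real Z \<le> 2 * R / h0" if "admissible_grid R h0 Z" for Z
  proof -
    have "real Z > 0" "h0 \<le> 2 * R / real Z"
      using that by (auto simp: admissible_grid_def mesh_def)
    then have "h0 * real Z \<le> 2 * R"
      by (simp add: pos_le_divide_eq)
    then show ?thesis using assms by (simp add: pos_le_divide_eq mult.commute)
  qed
  have "{Z. admissible_grid R h0 Z} \<subseteq> {..nat \<lfloor>2 * R / h0\<rfloor>}"
    using * by (auto simp: le_nat_floor)
  then show "finite {Z. admissible_grid R h0 Z}" by (rule finite_subset) simp
qed

lemma uniform_threshold: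
  fixes P :: "'a \<Rightarrow> real \<Rightarrow> bool"
  assumes "finite S" "\<And>x. x \<in> S \<Longrightarrow> \<exists>l. \<forall>lam\<ge>l. P x lam"
  shows "\<exists>l>1. l \<ge> start \<and> (\<forall>x\<in>S. \<forall>lam\<ge>l. P x lam)"
  using assms
proof induction
  case empty
  show ?case by (rule exI[of _ "max 2 start"]) simp
next
  case (insert x S)
  then obtain l where l: "l > 1" "l \<ge> start" "\<forall>x\<in>S. \<forall>lam\<ge>l. P x lam" by auto
  obtain l' where "\<forall>lam\<ge>l'. P x lam" using insert.prems[of x] by auto
  then show ?case using l by (intro exI[of _ "max l l'"]) auto
qed

lemma grid_sum_swap:
  fixes N :: nat
  assumes "\<And>n p q. n < N \<Longrightarrow> p \<in> {1..Z-1} \<Longrightarrow> q \<in> {1..Z-1} \<Longrightarrow> (\<lambda>z. f n p q z * \<mu> z) integrable_on {-b..b}"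
  shows "grid_sum R Z (\<lambda>p q. integral {-b..b} (\<lambda>z. (\<Sum>n<N. f n p q z) * \<mu> z)) =
    (\<Sum>n<N. grid_sum R Z (\<lambda>p q. integral {-b..b} (\<lambda>z. f n p q z * \<mu> z)))"
proof -
  have "integral {-b..b} (\<lambda>z. (\<Sum>n<N. f n p q z) * \<mu> z) = (\<Sum>n<N. integral {-b..b} (\<lambda>z. f n p q z * \<mu> z))"
    if "p \<in> {1..Z-1}" "q \<in> {1..Z-1}" for p q
    unfolding sum_distrib_right by (rule integral_sum) (use assms that in auto)
  then have "grid_sum R Z (\<lambda>p q. integral {-b..b} (\<lambda>z. (\<Sum>n<N. f n p q z) * \<mu> z)) =
    (\<Sum>p\<in>{1..Z-1}. \<Sum>q\<in>{1..Z-1}. \<Sum>n<N. (mesh R Z)\<^sup>2 * integral {-b..b} (\<lambda>z. f n p q z * \<mu> z))"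
    unfolding grid_sum_def by (intro sum.cong refl) (simp add: sum_distrib_left)
  also have "\<dots> = (\<Sum>p\<in>{1..Z-1}. \<Sum>n<N. \<Sum>q\<in>{1..Z-1}. (mesh R Z)\<^sup>2 * integral {-b..b} (\<lambda>z. f n p q z * \<mu> z))"
    by (intro sum.cong refl sum.swap)
  also have "\<dots> = (\<Sum>n<N. \<Sum>p\<in>{1..Z-1}. \<Sum>q\<in>{1..Z-1}. (mesh R Z)\<^sup>2 * integral {-b..b} (\<lambda>z. f n p q z * \<mu> z))"
    by (rule sum.swap)
  finally show ?thesis by (simp add: grid_sum_def)
qed

lemma square_norm_difference_quotient_le:
  assumes "c > 0"
  shows "(cmod ((x - y) / of_real (2 * c)))\<^sup>2 \<le> ((cmod x)\<^sup>2 + (cmod y)\<^sup>2) / (2 * c\<^sup>2)"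
proof -
  have "(cmod (x - y))\<^sup>2 \<le> (cmod x + cmod y)\<^sup>2"
    by (simp add: norm_triangle_ineq4 power_mono)
  also have "\<dots> \<le> 2 * ((cmod x)\<^sup>2 + (cmod y)\<^sup>2)"
    using sum_squares_bound[of "cmod x" "cmod y"] by (simp add: power2_sum)
  finally have le: "(cmod (x - y))\<^sup>2 \<le> 2 * ((cmod x)\<^sup>2 + (cmod y)\<^sup>2)" .
  have "(cmod ((x - y) / of_real (2 * c)))\<^sup>2 = (cmod (x - y))\<^sup>2 / (4 * c\<^sup>2)"
    using assms by (simp add: norm_divide power_divide norm_mult power_mult_distrib)
  also have "\<dots> \<le> 2 * ((cmod x)\<^sup>2 + (cmod y)\<^sup>2) / (4 * c\<^sup>2)"
    using le by (rule divide_right_mono) simp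
  also have "\<dots> = ((cmod x)\<^sup>2 + (cmod y)\<^sup>2) / (2 * c\<^sup>2)"
    using assms by (simp add: divide_simps)
  finally show ?thesis .
qed

text \<open>The integrand on the right-hand side of the Carleman estimate, for one component.\<close>

definition carleman_rhs :: "real \<Rightarrow> real \<Rightarrow> nat \<Rightarrow> real \<Rightarrow> sdf \<Rightarrow> nat \<Rightarrow> nat \<Rightarrow> real \<Rightarrow> real" where
  "carleman_rhs R b Z lam w p q z = (cmod (dzz b (w p q) z))\<^sup>2 + lam * (cmod (dz b (w p q) z))\<^sup>2
     + lam^3 * ((cmod (dxh R Z w p q z))\<^sup>2 + (cmod (dyh R Z w p q z))\<^sup>2 + (cmod (w p q z))\<^sup>2)"

context grid_operator
begin

lemma H2h_node_continuous:
  assumes V: "V \<in> H2h b Z N" "lateral_neumann b Z N V" and n: "n < N" and p: "p \<le> Z" and q: "q \<in> {1..Z-1}"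
  shows "continuous_on {-b..b} (V n p q)" "continuous_on {-b..b} (V n q p)"
proof -
  have int: "continuous_on {-b..b} (V n p' q')" if "p' \<in> {1..Z-1}" "q' \<in> {1..Z-1}" for p' q'
    by (rule H2_interval_continuous[OF b]) (use V(1) n that in \<open>auto simp: H2h_def\<close>)
  have one: "1 \<in> {1..Z-1}" "Z - 1 \<in> {1..Z-1}" using Z by auto
  have eq: "V n 0 q z = V n 1 q z" "V n Z q z = V n (Z - 1) q z" "V n q 0 z = V n q 1 z" "V n q Z z = V n q (Z - 1) z"
    if "z \<in> {-b..b}" for z
    using V(2) n q that by (simp_all add: lateral_neumann_def)
  consider "p = 0" | "p = Z" | "p \<in> {1..Z-1}" using p by fastforce
  then show "continuous_on {-b..b} (V n p q)"
    using continuous_on_eq[OF int[OF one(1) q]] continuous_on_eq[OF int[OF one(2) q]] int[OF _ q] eq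
    by cases auto
  consider "p = 0" | "p = Z" | "p \<in> {1..Z-1}" using p by fastforce
  then show "continuous_on {-b..b} (V n q p)"
    using continuous_on_eq[OF int[OF q one(1)]] continuous_on_eq[OF int[OF q one(2)]] int[OF q] eq
    by cases auto
qed

lemma carleman_rhs_integrable:
  assumes V: "V \<in> H2h b Z N" "lateral_neumann b Z N V" and n: "n < N"
    and pq: "p \<in> {1..Z-1}" "q \<in> {1..Z-1}" and \<mu>: "continuous_on {-b..b} \<mu>"
  shows "(\<lambda>z. carleman_rhs R b Z lam (V n) p q z * \<mu> z) integrable_on {-b..b}"
proof -
  have i: "(n, p, q) \<in> I" using n pq by (simp add: grid_index_def)
  have fV: "flat V \<in> h2_space b I" using V by (simp add: flat_h2_space_iff)
  have H: "H2_interval b (V n p q)" using h2_spaceD[OF fV i] by (simp add: flat_def)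
  have *: "p + 1 \<le> Z" "p - 1 \<le> Z" "q + 1 \<le> Z" "q - 1 \<le> Z" using pq Z by auto
  note c = H2h_node_continuous(1)[OF V n _ pq(2)] H2h_node_continuous(2)[OF V n _ pq(1)]
  have "continuous_on {-b..b} (dxh R Z (V n) p q)" "continuous_on {-b..b} (dyh R Z (V n) p q)"
    unfolding dxh_def[abs_def] dyh_def[abs_def] divide_inverse
    by (intro continuous_intros c *)+
  moreover have "continuous_on {-b..b} (V n p q)" "continuous_on {-b..b} (dz b (V n p q))"
    using H2_interval_continuous[OF b H] H2_interval_continuous_dz[OF b H] .
  ultimately have "(\<lambda>z. (lam * (cmod (dz b (V n p q) z))\<^sup>2
     + lam^3 * ((cmod (dxh R Z (V n) p q z))\<^sup>2 + (cmod (dyh R Z (V n) p q z))\<^sup>2 + (cmod (V n p q z))\<^sup>2)) * \<mu> z) integrable_on {-b..b}"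
    by (intro integrable_continuous_real continuous_intros \<mu>)
  moreover have "(\<lambda>z. (cmod (dzz b (V n p q) z))\<^sup>2 * \<mu> z) integrable_on {-b..b}"
    using sq_integrable_weighted_square[OF sq_integrable_dzz[OF fV i] \<mu>] by (simp add: flat_def)
  ultimately have "(\<lambda>z. (cmod (dzz b (V n p q) z))\<^sup>2 * \<mu> z + (lam * (cmod (dz b (V n p q) z))\<^sup>2
     + lam^3 * ((cmod (dxh R Z (V n) p q z))\<^sup>2 + (cmod (dyh R Z (V n) p q z))\<^sup>2 + (cmod (V n p q z))\<^sup>2)) * \<mu> z) integrable_on {-b..b}"
    by (intro integrable_add)
  then show ?thesis by (simp add: carleman_rhs_def algebra_simps)
qed

text \<open>The powers \<open>\<lambda>\<close> and \<open>\<lambda>\<^sup>3\<close> are compensated exactly by the gains \<open>1/\<kappa>\<close> and \<open>1/\<kappa>\<^sup>3\<close> in \<open>weighted_bounds\<close>. Difference quotients are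
  bounded by values at neighbouring nodes divided by the mesh size; a lateral neighbour carries the value of an interior node.\<close>

lemma carleman_rhs_le_energy:
  fixes \<theta> lam :: real
  assumes V: "V \<in> H2h_0 b Z N" and n: "n < N" and pq: "p \<in> {1..Z-1}" "q \<in> {1..Z-1}"
    and \<theta>: "\<theta> > b" and lam: "lam > 0"
  defines "\<mu> \<equiv> carleman_weight \<theta> lam"
  shows "integral {-b..b} (\<lambda>z. carleman_rhs R b Z lam (V n) p q z * \<mu> z)
     \<le> weighted_sq b \<mu> (dzz b (V n p q)) * (1 + b / (\<theta> - b)) + energy \<mu> (flat V) * (b * (2 / h\<^sup>2 + 1) / (4 * (\<theta> - b) ^ 3))"
proof -
  define \<kappa> where "\<kappa> = lam * (\<theta> - b)"
  have \<delta>: "\<theta> - b > 0" and \<kappa>: "\<kappa> > 0" using \<theta> lam by (auto simp: \<kappa>_def)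
  note VH = H2h_0_subset[OF V] and lat = h2_bc_space_eq_H2h_0(2)[OF V]
  have fV: "flat V \<in> h2_space b I" using VH by (simp add: flat_h2_space_iff)
  have z0: "zero_cauchy b I (flat V)" using V by (simp add: H2h_0_def flat_zero_cauchy)
  have \<mu>: "continuous_on {-b..b} \<mu>" "\<And>z. \<mu> z > 0" unfolding \<mu>_def by (simp_all add: continuous_on_carleman_weight)
  define E where "E = energy \<mu> (flat V)"
  define B where "B = E / (8 * \<kappa> ^ 3)"
  define Y where "Y = weighted_sq b \<mu> (dzz b (V n p q))"
  have inner: "(cmod (V n p q z))\<^sup>2 * \<mu> z \<le> B" if "p \<in> {1..Z-1}" "q \<in> {1..Z-1}" "z \<in> {-b..b}" for p q z
  proof -
    have i: "(n, p, q) \<in> I" using n that by (simp add: grid_index_def)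
    have "(cmod (V n p q z))\<^sup>2 * \<mu> z \<le> weighted_sq b \<mu> (dzz b (V n p q)) / (8 * \<kappa> ^ 3)"
      using weighted_bounds(2)[OF fV z0 i \<theta> lam that(3)] by (simp add: \<mu>_def \<kappa>_def flat_def)
    also have "\<dots> \<le> B"
      unfolding B_def E_def using energy_single_le[OF fV i \<mu>(1) less_imp_le[OF \<mu>(2)]] \<kappa>
      by (intro divide_right_mono) (auto simp: flat_def)
    finally show ?thesis .
  qed
  have one: "1 \<in> {1..Z-1}" "Z - 1 \<in> {1..Z-1}" using Z by auto
  have outer: "(cmod (V n p q z))\<^sup>2 * \<mu> z \<le> B \<and> (cmod (V n q p z))\<^sup>2 * \<mu> z \<le> B"
    if "p \<le> Z" "q \<in> {1..Z-1}" "z \<in> {-b..b}" for p q z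
  proof -
    have "V n 0 q z = V n 1 q z" "V n Z q z = V n (Z - 1) q z" "V n q 0 z = V n q 1 z" "V n q Z z = V n q (Z - 1) z"
      using lat n that by (simp_all add: lateral_neumann_def)
    then have bd: "(cmod (V n 0 q z))\<^sup>2 * \<mu> z \<le> B" "(cmod (V n Z q z))\<^sup>2 * \<mu> z \<le> B"
      "(cmod (V n q 0 z))\<^sup>2 * \<mu> z \<le> B" "(cmod (V n q Z z))\<^sup>2 * \<mu> z \<le> B"
      using inner[OF one(1) that(2,3)] inner[OF one(2) that(2,3)] inner[OF that(2) one(1) that(3)] inner[OF that(2) one(2) that(3)]
      by simp_all
    have "p = 0 \<or> p = Z \<or> p \<in> {1..Z-1}" using that(1) by auto
    then show ?thesis
      using bd inner[of p q z] inner[of q p z] that(2,3) by blast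
  qed
  have le: "p + 1 \<le> Z" "p - 1 \<le> Z" "q + 1 \<le> Z" "q - 1 \<le> Z" using pq Z by auto
  have i: "(n, p, q) \<in> I" using n pq by (simp add: grid_index_def)
  have quot: "(cmod ((x - y) / of_real (2 * h)))\<^sup>2 * \<mu> z \<le> B / h\<^sup>2"
    if "(cmod x)\<^sup>2 * \<mu> z \<le> B" "(cmod y)\<^sup>2 * \<mu> z \<le> B" for x y z
  proof -
    have "(cmod ((x - y) / of_real (2 * h)))\<^sup>2 * \<mu> z \<le> ((cmod x)\<^sup>2 + (cmod y)\<^sup>2) / (2 * h\<^sup>2) * \<mu> z"
      by (intro mult_right_mono square_norm_difference_quotient_le h) (simp add: \<mu>(2) less_imp_le)
    also have "\<dots> = ((cmod x)\<^sup>2 * \<mu> z + (cmod y)\<^sup>2 * \<mu> z) / (2 * h\<^sup>2)"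
      by (simp add: algebra_simps)
    also have "\<dots> \<le> (B + B) / (2 * h\<^sup>2)" using that by (intro divide_right_mono add_mono) auto
    finally show ?thesis by simp
  qed
  define c where "c = lam * (Y / (2 * \<kappa>)) + lam ^ 3 * (B * (2 / h\<^sup>2 + 1))"
  have iY: "(\<lambda>z. (cmod (dzz b (V n p q) z))\<^sup>2 * \<mu> z) integrable_on {-b..b}"
    using sq_integrable_weighted_square[OF sq_integrable_dzz[OF fV i] \<mu>(1)] by (simp add: flat_def)
  have "((\<lambda>z. c) has_integral 2 * b * c) {-b..b}"
    using has_integral_const_real[of c "-b" b] b by simp
  then have hi: "((\<lambda>z. (cmod (dzz b (V n p q) z))\<^sup>2 * \<mu> z + c) has_integral Y + 2 * b * c) {-b..b}"
    unfolding Y_def by (intro has_integral_add integrable_integral iY)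
  have "integral {-b..b} (\<lambda>z. carleman_rhs R b Z lam (V n) p q z * \<mu> z) \<le> Y + 2 * b * c"
  proof (rule has_integral_le[OF integrable_integral[OF carleman_rhs_integrable[OF VH lat n pq \<mu>(1)]] hi])
    fix z assume z: "z \<in> {-b..b}"
    have 1: "(cmod (dz b (V n p q) z))\<^sup>2 * \<mu> z \<le> Y / (2 * \<kappa>)"
      using weighted_bounds(1)[OF fV z0 i \<theta> lam z] by (simp add: \<mu>_def \<kappa>_def Y_def flat_def)
    have "(cmod (dxh R Z (V n) p q z))\<^sup>2 * \<mu> z \<le> B / h\<^sup>2"
      unfolding dxh_def by (rule quot) (use outer[OF le(1) pq(2) z] outer[OF le(2) pq(2) z] in auto)
    moreover have "(cmod (dyh R Z (V n) p q z))\<^sup>2 * \<mu> z \<le> B / h\<^sup>2"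
      unfolding dyh_def by (rule quot) (use outer[OF le(3) pq(1) z] outer[OF le(4) pq(1) z] in auto)
    ultimately have "((cmod (dxh R Z (V n) p q z))\<^sup>2 + (cmod (dyh R Z (V n) p q z))\<^sup>2 + (cmod (V n p q z))\<^sup>2) * \<mu> z
        \<le> B / h\<^sup>2 + B / h\<^sup>2 + B"
      using inner[OF pq z] unfolding distrib_right by linarith
    also have "\<dots> = B * (2 / h\<^sup>2 + 1)" by (simp add: algebra_simps)
    finally have 2: "((cmod (dxh R Z (V n) p q z))\<^sup>2 + (cmod (dyh R Z (V n) p q z))\<^sup>2 + (cmod (V n p q z))\<^sup>2) * \<mu> z
        \<le> B * (2 / h\<^sup>2 + 1)" .
    have "carleman_rhs R b Z lam (V n) p q z * \<mu> z = (cmod (dzz b (V n p q) z))\<^sup>2 * \<mu> z + (lam * ((cmod (dz b (V n p q) z))\<^sup>2 * \<mu> z)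
        + lam ^ 3 * (((cmod (dxh R Z (V n) p q z))\<^sup>2 + (cmod (dyh R Z (V n) p q z))\<^sup>2 + (cmod (V n p q z))\<^sup>2) * \<mu> z))"
      by (simp add: carleman_rhs_def algebra_simps)
    also have "\<dots> \<le> (cmod (dzz b (V n p q) z))\<^sup>2 * \<mu> z + c"
      unfolding c_def using lam by (intro add_left_mono add_mono mult_left_mono 1 2) auto
    finally show "carleman_rhs R b Z lam (V n) p q z * \<mu> z \<le> (cmod (dzz b (V n p q) z))\<^sup>2 * \<mu> z + c" .
  qed
  also have "Y + 2 * b * c = Y * (1 + b / (\<theta> - b)) + E * (b * (2 / h\<^sup>2 + 1) / (4 * (\<theta> - b) ^ 3))"
  proof -
    have "lam * (Y / (2 * \<kappa>)) = Y / (2 * (\<theta> - b))" using lam by (simp add: \<kappa>_def)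
    moreover have "lam ^ 3 * (B * (2 / h\<^sup>2 + 1)) = E * (2 / h\<^sup>2 + 1) / (8 * (\<theta> - b) ^ 3)"
      using lam by (simp add: B_def \<kappa>_def power_mult_distrib)
    ultimately have c_eq: "c = Y / (2 * (\<theta> - b)) + E * (2 / h\<^sup>2 + 1) / (8 * (\<theta> - b) ^ 3)" by (simp add: c_def)
    have "2 * b * (Y / (2 * t) + E * x / (8 * w)) = Y * (b / t) + E * (b * x / (4 * w))" for t w x
      by (simp add: distrib_left mult_ac)
    then have "2 * b * c = Y * (b / (\<theta> - b)) + E * (b * (2 / h\<^sup>2 + 1) / (4 * (\<theta> - b) ^ 3))"
      unfolding c_eq .
    then show ?thesis by (simp only: distrib_left mult_1_right add.assoc)
  qed
  finally show ?thesis by (simp add: E_def Y_def)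
qed

end

text \<open>Treating one component at a time makes the threshold independent of the number \<open>N\<close> of components. The constant
  \<open>D\<close> is uniform over the admissible grids, as the mesh size is at least \<open>h0\<close> and there are at most \<open>(2R/h0)\<^sup>2\<close> interior nodes.\<close>

lemma carleman_estimate_single_component:
  assumes R: "R > 0" and b: "b > 0" and h0: "h0 > 0" and \<theta>: "\<theta> > b" and Z: "admissible_grid R h0 Z"
  defines "D \<equiv> 1 + b / (\<theta> - b) + (2 * R / h0)\<^sup>2 * (b * (2 / h0\<^sup>2 + 1) / (4 * (\<theta> - b) ^ 3))"
  shows "\<exists>l. \<forall>lam\<ge>l. \<forall>V\<in>H2h_0 b Z 1.
    (\<forall>p\<in>{1..Z-1}. \<forall>q\<in>{1..Z-1}.
      (\<lambda>z. (cmod (laplace_h R b Z (V 0) p q z))\<^sup>2 * carleman_weight \<theta> lam z) integrable_on {-b..b} \<and>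
      (\<lambda>z. carleman_rhs R b Z lam (V 0) p q z * carleman_weight \<theta> lam z) integrable_on {-b..b}) \<and>
    1 / (4 * D) * grid_sum R Z (\<lambda>p q. integral {-b..b} (\<lambda>z. carleman_rhs R b Z lam (V 0) p q z * carleman_weight \<theta> lam z))
     \<le> grid_sum R Z (\<lambda>p q. integral {-b..b} (\<lambda>z. (cmod (laplace_h R b Z (V 0) p q z))\<^sup>2 * carleman_weight \<theta> lam z))"
proof -
  have Z2: "Z \<ge> 2" and hh0: "mesh R Z \<ge> h0" using Z by (auto simp: admissible_grid_def)
  obtain A where A: "quadratic_operator b (grid_index Z 1) A (\<lambda>i c e z. 0)"
    "\<And>V n p q z. lateral_neumann b Z 1 V \<Longrightarrow> (n, p, q) \<in> grid_index Z 1 \<Longrightarrow> z \<in> {-b..b} \<Longrightarrow>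
       laplace_h R b Z (V n) p q z = quadratic_operator.op b (grid_index Z 1) A (\<lambda>i c e z. 0) (flat V) (n, p, q) z"
    using laplace_h_linear_operator[OF b Z2, of 1 R] by metis
  interpret Q: quadratic_operator b "grid_index Z 1" A "\<lambda>i c e z. 0" by (rule A(1))
  interpret G: grid_operator b Z 1 A "\<lambda>i c e z. 0" R "\<lambda>V n p q z. laplace_h R b Z (V n) p q z"
    by unfold_locales (use R Z2 A(2) in auto)
  obtain l where l: "l > 1" "\<And>lam r. lam \<ge> l \<Longrightarrow> r \<in> h2_space b (grid_index Z 1) \<Longrightarrow> zero_cauchy b (grid_index Z 1) r \<Longrightarrow>
      Q.energy (carleman_weight \<theta> lam) r / 4 \<le> Q.functional (carleman_weight \<theta> lam) r"
    using Q.functional_coercive_of_linear[OF \<theta>] by auto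
  show ?thesis
  proof (intro exI[of _ l] allI impI ballI)
    fix lam V assume lam: "lam \<ge> l" and V: "V \<in> H2h_0 b Z 1"
    define \<mu> where "\<mu> = carleman_weight \<theta> lam"
    have \<mu>: "continuous_on {-b..b} \<mu>" "\<And>z. \<mu> z > 0" unfolding \<mu>_def by (simp_all add: continuous_on_carleman_weight)
    note VH = G.H2h_0_subset[OF V] and lat = G.h2_bc_space_eq_H2h_0(2)[OF V]
    have fV: "flat V \<in> h2_space b (grid_index Z 1)" using VH by (simp add: flat_h2_space_iff)
    define E where "E = Q.energy \<mu> (flat V)"
    have E0: "E \<ge> 0" unfolding E_def using Q.energy_nonneg[OF fV \<mu>(1)] \<mu>(2) less_imp_le by blast
    define h where "h = mesh R Z"
    have h: "h \<ge> h0" "h > 0" using hh0 h0 by (auto simp: h_def)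
    have int: "(\<lambda>z. (cmod (laplace_h R b Z (V 0) p q z))\<^sup>2 * \<mu> z) integrable_on {-b..b}"
      "(\<lambda>z. carleman_rhs R b Z lam (V 0) p q z * \<mu> z) integrable_on {-b..b}"
      if "p \<in> {1..Z-1}" "q \<in> {1..Z-1}" for p q
      using G.cost_integrable[OF VH lat _ \<mu>(1), of 0 p q] G.carleman_rhs_integrable[OF VH lat _ that \<mu>(1), of 0 lam] that
      by (auto simp: grid_index_def)
    have lhs: "h\<^sup>2 * (E / 4) \<le> grid_sum R Z (\<lambda>p q. weighted_sq b \<mu> (laplace_h R b Z (V 0) p q))"
    proof -
      have "E / 4 \<le> Q.functional \<mu> (flat V)"
        unfolding E_def \<mu>_def using V by (intro l(2) lam fV) (simp add: H2h_0_def flat_zero_cauchy)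
      then have "h\<^sup>2 * (E / 4) \<le> h\<^sup>2 * Q.functional \<mu> (flat V)" by (rule mult_left_mono) simp
      also have "\<dots> = G.cost \<mu> V" unfolding h_def by (rule G.cost_eq[OF VH lat \<mu>(1), symmetric])
      finally show ?thesis unfolding G.cost_def by simp
    qed
    define \<alpha> where "\<alpha> = 1 + b / (\<theta> - b)"
    define \<beta> where "\<beta> = b * (2 / h\<^sup>2 + 1) / (4 * (\<theta> - b) ^ 3)"
    define Y where "Y = (\<lambda>p q. weighted_sq b \<mu> (dzz b (V 0 p q)))"
    have E_eq: "E = (\<Sum>p\<in>{1..Z-1}. \<Sum>q\<in>{1..Z-1}. Y p q)"
      unfolding E_def Q.energy_def sum_grid_index by (simp add: flat_def Y_def)
    have "grid_sum R Z (\<lambda>p q. integral {-b..b} (\<lambda>z. carleman_rhs R b Z lam (V 0) p q z * \<mu> z))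
        \<le> (\<Sum>p\<in>{1..Z-1}. \<Sum>q\<in>{1..Z-1}. h\<^sup>2 * (Y p q * \<alpha> + E * \<beta>))"
      unfolding grid_sum_def h_def[symmetric]
    proof (intro sum_mono mult_left_mono)
      fix p q assume pq: "p \<in> {1..Z-1}" "q \<in> {1..Z-1}"
      show "integral {-b..b} (\<lambda>z. carleman_rhs R b Z lam (V 0) p q z * \<mu> z) \<le> Y p q * \<alpha> + E * \<beta>"
        unfolding Y_def \<alpha>_def E_def \<beta>_def h_def \<mu>_def
        by (rule G.carleman_rhs_le_energy[OF V _ pq \<theta>]) (use lam l(1) in auto)
    qed simp
    also have "\<dots> = h\<^sup>2 * (E * \<alpha> + real (Z - 1) * (real (Z - 1) * (E * \<beta>)))"
      by (simp add: sum_distrib_left[symmetric] sum.distrib sum_distrib_right[symmetric] E_eq[symmetric] del: One_nat_def)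
    also have "\<dots> \<le> h\<^sup>2 * (E * D)"
    proof (rule mult_left_mono)
      have "real (Z - 1) \<le> 2 * R / h0" using finite_admissible_grids(2)[OF R h0 Z] by simp
      then have "real (Z - 1) * real (Z - 1) \<le> (2 * R / h0)\<^sup>2"
        unfolding power2_eq_square by (intro mult_mono) auto
      moreover have "\<beta> \<le> b * (2 / h0\<^sup>2 + 1) / (4 * (\<theta> - b) ^ 3)"
        unfolding \<beta>_def using h h0 b \<theta> by (intro divide_right_mono mult_left_mono add_right_mono divide_left_mono power_mono) auto
      moreover have "\<beta> \<ge> 0" using b \<theta> by (simp add: \<beta>_def)
      ultimately have "real (Z - 1) * real (Z - 1) * \<beta> \<le> (2 * R / h0)\<^sup>2 * (b * (2 / h0\<^sup>2 + 1) / (4 * (\<theta> - b) ^ 3))"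
        by (intro mult_mono) auto
      then have "\<alpha> + real (Z - 1) * real (Z - 1) * \<beta> \<le> D" by (simp add: D_def \<alpha>_def)
      then have "E * (\<alpha> + real (Z - 1) * real (Z - 1) * \<beta>) \<le> E * D" using E0 by (rule mult_left_mono)
      then show "E * \<alpha> + real (Z - 1) * (real (Z - 1) * (E * \<beta>)) \<le> E * D" by (simp add: algebra_simps)
    qed simp
    finally have rhs: "grid_sum R Z (\<lambda>p q. integral {-b..b} (\<lambda>z. carleman_rhs R b Z lam (V 0) p q z * \<mu> z)) \<le> h\<^sup>2 * (E * D)" .
    have D0: "D > 0" unfolding D_def using b \<theta> by (intro add_pos_nonneg) auto
    have "1 / (4 * D) * grid_sum R Z (\<lambda>p q. integral {-b..b} (\<lambda>z. carleman_rhs R b Z lam (V 0) p q z * \<mu> z)) \<le> 1 / (4 * D) * (h\<^sup>2 * (E * D))"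
      using rhs D0 by (intro mult_left_mono) auto
    also have "\<dots> = h\<^sup>2 * (E / 4)" using D0 by simp
    also note lhs
    finally show "(\<forall>p\<in>{1..Z-1}. \<forall>q\<in>{1..Z-1}.
      (\<lambda>z. (cmod (laplace_h R b Z (V 0) p q z))\<^sup>2 * carleman_weight \<theta> lam z) integrable_on {-b..b} \<and>
      (\<lambda>z. carleman_rhs R b Z lam (V 0) p q z * carleman_weight \<theta> lam z) integrable_on {-b..b}) \<and>
    1 / (4 * D) * grid_sum R Z (\<lambda>p q. integral {-b..b} (\<lambda>z. carleman_rhs R b Z lam (V 0) p q z * carleman_weight \<theta> lam z))
     \<le> grid_sum R Z (\<lambda>p q. integral {-b..b} (\<lambda>z. (cmod (laplace_h R b Z (V 0) p q z))\<^sup>2 * carleman_weight \<theta> lam z))"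
      using int unfolding \<mu>_def by blast
  qed
qed

text \<open>Both sides are sums over the components, and finitely many grids have a common threshold.\<close>

lemma carleman_threshold_exists:
  assumes R: "R > 0" and b: "b > 0" and h0: "h0 > 0" and \<theta>: "\<theta> > b"
  shows "\<exists>lam0. carleman_threshold R b h0 \<theta> lam0"
proof -
  define D where "D = 1 + b / (\<theta> - b) + (2 * R / h0)\<^sup>2 * (b * (2 / h0\<^sup>2 + 1) / (4 * (\<theta> - b) ^ 3))"
  have D0: "D > 0" unfolding D_def using b \<theta> by (intro add_pos_nonneg) auto
  define P where "P = (\<lambda>Z lam. \<forall>V\<in>H2h_0 b Z 1.
    (\<forall>p\<in>{1..Z-1}. \<forall>q\<in>{1..Z-1}.
      (\<lambda>z. (cmod (laplace_h R b Z (V 0) p q z))\<^sup>2 * carleman_weight \<theta> lam z) integrable_on {-b..b} \<and>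
      (\<lambda>z. carleman_rhs R b Z lam (V 0) p q z * carleman_weight \<theta> lam z) integrable_on {-b..b}) \<and>
    1 / (4 * D) * grid_sum R Z (\<lambda>p q. integral {-b..b} (\<lambda>z. carleman_rhs R b Z lam (V 0) p q z * carleman_weight \<theta> lam z))
     \<le> grid_sum R Z (\<lambda>p q. integral {-b..b} (\<lambda>z. (cmod (laplace_h R b Z (V 0) p q z))\<^sup>2 * carleman_weight \<theta> lam z)))"
  have ex: "\<exists>l. \<forall>lam\<ge>l. P Z lam" if "Z \<in> {Z. admissible_grid R h0 Z}" for Z
    unfolding P_def D_def using carleman_estimate_single_component[OF R b h0 \<theta>] that by blast
  have "\<exists>l>1. l \<ge> 2 \<and> (\<forall>Z\<in>{Z. admissible_grid R h0 Z}. \<forall>lam\<ge>l. P Z lam)"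
    by (rule uniform_threshold[OF finite_admissible_grids(1)[OF R h0] ex])
  then obtain l where l: "l > 1" "\<And>Z lam. admissible_grid R h0 Z \<Longrightarrow> lam \<ge> l \<Longrightarrow> P Z lam" by auto
  have "carleman_threshold R b h0 \<theta> l"
    unfolding carleman_threshold_def
  proof (intro conjI l(1) exI[of _ "1 / (4 * D)"] allI impI ballI)
    show "0 < 1 / (4 * D)" using D0 by simp
    fix Z N lam u assume *: "admissible_grid R h0 Z \<and> N \<ge> 1" "lam \<ge> l" "u \<in> H2h_0 b Z N"
    have u1: "(\<lambda>_. u n) \<in> H2h_0 b Z 1" if "n < N" for n
      using *(3) that by (simp add: H2h_0_def H2h_def discrete_neumann_def cauchy_data_def lateral_neumann_def)
    have PZ: "P Z lam" using l(2) * by blast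
    note p = PZ[unfolded P_def, rule_format, OF u1]
    have "1 / (4 * D) * grid_sum R Z (\<lambda>p q. integral {-b..b} (\<lambda>z.
         (\<Sum>n<N. carleman_rhs R b Z lam (u n) p q z) * carleman_weight \<theta> lam z))
       = (\<Sum>n<N. 1 / (4 * D) * grid_sum R Z (\<lambda>p q. integral {-b..b} (\<lambda>z. carleman_rhs R b Z lam (u n) p q z * carleman_weight \<theta> lam z)))"
      by (subst grid_sum_swap) (use p in \<open>auto simp: sum_distrib_left\<close>)
    also have "\<dots> \<le> (\<Sum>n<N. grid_sum R Z (\<lambda>p q. integral {-b..b} (\<lambda>z. (cmod (laplace_h R b Z (u n) p q z))\<^sup>2 * carleman_weight \<theta> lam z)))"
      by (rule sum_mono) (use p in auto)
    also have "\<dots> = grid_sum R Z (\<lambda>p q. integral {-b..b} (\<lambda>z.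
         (\<Sum>n<N. (cmod (laplace_h R b Z (u n) p q z))\<^sup>2) * carleman_weight \<theta> lam z))"
      by (subst grid_sum_swap) (use p in auto)
    finally show "1 / (4 * D) * grid_sum R Z (\<lambda>p q. integral {-b..b} (\<lambda>z.
            (\<Sum>n<N. (cmod (dzz b (u n p q) z))\<^sup>2 + lam * (cmod (dz b (u n p q) z))\<^sup>2
               + lam^3 * ((cmod (dxh R Z (u n) p q z))\<^sup>2 + (cmod (dyh R Z (u n) p q z))\<^sup>2
                          + (cmod (u n p q z))\<^sup>2)) * carleman_weight \<theta> lam z))
        \<le> grid_sum R Z (\<lambda>p q. integral {-b..b} (\<lambda>z.
            (\<Sum>n<N. (cmod (laplace_h R b Z (u n) p q z))\<^sup>2) * carleman_weight \<theta> lam z))"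
      unfolding carleman_rhs_def .
  qed
  then show ?thesis ..
qed

section \<open>Strict convexity of the weighted functional\<close>

lemma L_h_grid_operator:
  assumes "R > 0" "b > 0" "d > b" "Z \<ge> 2"
  obtains A Q where "grid_operator b Z N A Q R (L_h R b d a1 a2 k Z N)"
proof -
  obtain A Q where AQ: "quadratic_operator b (grid_index Z N) A Q"
    "\<And>V n p q z. lateral_neumann b Z N V \<Longrightarrow> (n, p, q) \<in> grid_index Z N \<Longrightarrow> z \<in> {-b..b} \<Longrightarrow>
       L_h R b d a1 a2 k Z N V n p q z = quadratic_operator.op b (grid_index Z N) A Q (flat V) (n, p, q) z"
    using L_h_quadratic_operator[OF assms(2-4), of N R a1 a2 k] by metis
  interpret quadratic_operator b "grid_index Z N" A Q by (rule AQ(1))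
  have "grid_operator b Z N A Q R (L_h R b d a1 a2 k Z N)"
    by unfold_locales (use assms AQ(2) in auto)
  then show ?thesis by (rule that)
qed

context grid_operator
begin

text \<open>The two assertions of the convexity statement for a fixed grid and fixed \<open>\<lambda>\<close>, with the constant \<open>1/12\<close>, which combines the
  factor \<open>1/4\<close> of \<open>quarter_energy_le_sum\<close> with the factor \<open>3\<close> of \<open>h2_ip_le_energy\<close>.\<close>

definition convexity_estimates :: "real \<Rightarrow> real \<Rightarrow> real \<Rightarrow> bool" where
  "convexity_estimates \<theta> M lam \<longleftrightarrow> (\<forall>\<psi>0 \<psi>1.
     (\<forall>V\<in>closure_B R b Z N \<psi>0 \<psi>1 M. \<forall>W\<in>closure_B R b Z N \<psi>0 \<psi>1 M. \<forall>t.
        norm_H2h R b Z N (sd_diff W V) > 0 \<and> 0 < t \<and> t < 1 \<longrightarrow>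
        cost (carleman_weight \<theta> lam) (sd_segment V W t)
          < (1 - t) * cost (carleman_weight \<theta> lam) V + t * cost (carleman_weight \<theta> lam) W) \<and>
     (\<forall>V r g. V \<in> closure_B R b Z N \<psi>0 \<psi>1 M \<and> sd_add V r \<in> closure_B R b Z N \<psi>0 \<psi>1 M \<and>
        has_frechet_deriv R b Z N (cost (carleman_weight \<theta> lam)) V g \<longrightarrow>
        cost (carleman_weight \<theta> lam) (sd_add V r) - cost (carleman_weight \<theta> lam) V - ip_H2h R b Z N g r
          \<ge> 1 / 12 * exp (2 * lam * (b - \<theta>)^2) * (norm_H2h R b Z N r)^2))"

lemma convexity_threshold:
  assumes \<theta>: "\<theta> > b" and M: "M > 0"
  shows "\<exists>l. \<forall>lam\<ge>l. convexity_estimates \<theta> M lam"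
proof -
  define M' where "M' = 2 * M\<^sup>2 + 2"
  obtain l where l: "\<And>lam V r. lam \<ge> l \<Longrightarrow> V \<in> H2h b Z N \<Longrightarrow> r \<in> H2h_0 b Z N \<Longrightarrow>
    (norm_H2h R b Z N V)\<^sup>2 \<le> M' \<Longrightarrow> (norm_H2h R b Z N (sd_add V r))\<^sup>2 \<le> M' \<Longrightarrow>
    exp (2 * lam * (b - \<theta>)\<^sup>2) / 12 * (norm_H2h R b Z N r)\<^sup>2
      \<le> h\<^sup>2 * remainder (carleman_weight \<theta> lam) (flat V) (flat r)"
    using remainder_lower_bound[OF \<theta>, of M'] by (auto simp: M'_def)
  show ?thesis
  proof (intro exI[of _ l] allI impI)
    fix lam assume lam: "lam \<ge> l"
    define \<mu> where "\<mu> = carleman_weight \<theta> lam"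
    have \<mu>: "continuous_on {-b..b} \<mu>" unfolding \<mu>_def by (rule continuous_on_carleman_weight)
    note coercive = l[OF lam, folded \<mu>_def]
    show "convexity_estimates \<theta> M lam"
      unfolding convexity_estimates_def \<mu>_def[symmetric]
    proof (intro allI conjI ballI impI)
      fix \<psi>0 \<psi>1 V W and t :: real
      assume V: "V \<in> closure_B R b Z N \<psi>0 \<psi>1 M" and W: "W \<in> closure_B R b Z N \<psi>0 \<psi>1 M"
        and t: "norm_H2h R b Z N (sd_diff W V) > 0 \<and> 0 < t \<and> t < 1"
      note v = closure_B_properties[OF V M, folded M'_def] and w = closure_B_properties[OF W M, folded M'_def]
      show "cost \<mu> (sd_segment V W t) < (1 - t) * cost \<mu> V + t * cost \<mu> W"
        by (rule cost_strictly_convex[OF v(1,2,5) w(1,2,5) diff_in_H2h_0[OF v(1,3,4) w(1,3,4)] _ _ _ \<mu> _ coercive])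
           (use t in auto)
    next
      fix \<psi>0 \<psi>1 V r g
      assume *: "V \<in> closure_B R b Z N \<psi>0 \<psi>1 M \<and> sd_add V r \<in> closure_B R b Z N \<psi>0 \<psi>1 M \<and>
        has_frechet_deriv R b Z N (cost \<mu>) V g"
      note v = closure_B_properties[of V \<psi>0 \<psi>1 M, OF _ M, folded M'_def]
        and w = closure_B_properties[of "sd_add V r" \<psi>0 \<psi>1 M, OF _ M, folded M'_def]
      have "sd_diff (sd_add V r) V = r" by (auto simp: sd_diff_def sd_add_def fun_eq_iff)
      then have r: "r \<in> H2h_0 b Z N"
        using diff_in_H2h_0[OF v(1,3,4) w(1,3,4)] * by simp
      have "cost \<mu> (sd_add V r) - cost \<mu> V - ip_H2h R b Z N g r = h\<^sup>2 * remainder \<mu> (flat V) (flat r)"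
        using cost_expansion[OF v(1,2) H2h_0_subset[OF r] h2_bc_space_eq_H2h_0(2)[OF r] \<mu>]
          frechet_deriv_eq_first_variation[OF v(1,2) \<mu> _ r, of g] * by simp
      moreover have "exp (2 * lam * (b - \<theta>)\<^sup>2) / 12 * (norm_H2h R b Z N r)\<^sup>2 \<le> h\<^sup>2 * remainder \<mu> (flat V) (flat r)"
        using coercive[OF v(1) r v(5) w(5)] * by blast
      ultimately show "1 / 12 * exp (2 * lam * (b - \<theta>)\<^sup>2) * (norm_H2h R b Z N r)\<^sup>2
          \<le> cost \<mu> (sd_add V r) - cost \<mu> V - ip_H2h R b Z N g r" by simp
    qed
  qed
qed

end

theorem theorem2:
  fixes R b d a1 a2 k h0 \<theta> :: real
  assumes "R > 0" and "b > 0" and "d > b" and "a1 < a2" and "k > 0" and "h0 > 0" and "\<theta> > b"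
  shows
    "(\<forall>N\<ge>1. \<forall>Z. admissible_grid R h0 Z \<longrightarrow> (\<forall>\<psi>0 \<psi>1. \<forall>lam>0. \<forall>M>0.
        \<forall>V\<in>closure_B R b Z N \<psi>0 \<psi>1 M.
          \<exists>g. has_frechet_deriv R b Z N (J_functional R b d a1 a2 k \<theta> Z N lam) V g))
   \<and> (\<exists>lam0. carleman_threshold R b h0 \<theta> lam0)
   \<and> (\<forall>lam0. carleman_threshold R b h0 \<theta> lam0 \<longrightarrow>
        (\<forall>N\<ge>1. \<forall>M>0. \<exists>lam1>1. lam1 \<ge> lam0 \<and>
          (\<forall>Z. admissible_grid R h0 Z \<longrightarrow> (\<exists>C2>0. \<forall>\<psi>0 \<psi>1. \<forall>lam\<ge>lam1.
            (\<forall>V\<in>closure_B R b Z N \<psi>0 \<psi>1 M. \<forall>W\<in>closure_B R b Z N \<psi>0 \<psi>1 M. \<forall>t.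
               norm_H2h R b Z N (sd_diff W V) > 0 \<and> 0 < t \<and> t < 1 \<longrightarrow>
               J_functional R b d a1 a2 k \<theta> Z N lam (sd_segment V W t)
                 < (1 - t) * J_functional R b d a1 a2 k \<theta> Z N lam V
                   + t * J_functional R b d a1 a2 k \<theta> Z N lam W)
          \<and> (\<forall>V r g. V \<in> closure_B R b Z N \<psi>0 \<psi>1 M \<and> sd_add V r \<in> closure_B R b Z N \<psi>0 \<psi>1 M \<and>
               has_frechet_deriv R b Z N (J_functional R b d a1 a2 k \<theta> Z N lam) V g \<longrightarrow>
               J_functional R b d a1 a2 k \<theta> Z N lam (sd_add V r)
                 - J_functional R b d a1 a2 k \<theta> Z N lam V - ip_H2h R b Z N g r
                 \<ge> C2 * exp (2 * lam * (b - \<theta>)^2) * (norm_H2h R b Z N r)^2)))))"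
proof (intro conjI allI impI ballI)
  fix N Z :: nat and \<psi>0 \<psi>1 :: "nat \<Rightarrow> nat \<Rightarrow> nat \<Rightarrow> complex" and lam M :: real and V :: sdvec
  assume "admissible_grid R h0 Z" and M: "M > 0" and V: "V \<in> closure_B R b Z N \<psi>0 \<psi>1 M"
  then have Z: "Z \<ge> 2" by (simp add: admissible_grid_def)
  obtain A Q where "grid_operator b Z N A Q R (L_h R b d a1 a2 k Z N)"
    using L_h_grid_operator[OF assms(1-3) Z] by blast
  then interpret grid_operator b Z N A Q R "L_h R b d a1 a2 k Z N" .
  have "J_functional R b d a1 a2 k \<theta> Z N lam = cost (carleman_weight \<theta> lam)"
    by (simp add: J_functional_def cost_def fun_eq_iff)
  then show "\<exists>g. has_frechet_deriv R b Z N (J_functional R b d a1 a2 k \<theta> Z N lam) V g"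
    using cost_has_frechet_deriv[OF closure_B_properties(1,2)[OF V M] continuous_on_carleman_weight] by simp
next
  show "\<exists>lam0. carleman_threshold R b h0 \<theta> lam0"
    by (rule carleman_threshold_exists) fact+
next
  fix lam0 M :: real and N :: nat
  assume M: "M > 0"
  define E where "E = (\<lambda>Z lam C2 \<psi>0 \<psi>1.
            (\<forall>V\<in>closure_B R b Z N \<psi>0 \<psi>1 M. \<forall>W\<in>closure_B R b Z N \<psi>0 \<psi>1 M. \<forall>t.
               norm_H2h R b Z N (sd_diff W V) > 0 \<and> 0 < t \<and> t < 1 \<longrightarrow>
               J_functional R b d a1 a2 k \<theta> Z N lam (sd_segment V W t)
                 < (1 - t) * J_functional R b d a1 a2 k \<theta> Z N lam V
                   + t * J_functional R b d a1 a2 k \<theta> Z N lam W)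
          \<and> (\<forall>V r g. V \<in> closure_B R b Z N \<psi>0 \<psi>1 M \<and> sd_add V r \<in> closure_B R b Z N \<psi>0 \<psi>1 M \<and>
               has_frechet_deriv R b Z N (J_functional R b d a1 a2 k \<theta> Z N lam) V g \<longrightarrow>
               J_functional R b d a1 a2 k \<theta> Z N lam (sd_add V r)
                 - J_functional R b d a1 a2 k \<theta> Z N lam V - ip_H2h R b Z N g r
                 \<ge> C2 * exp (2 * lam * (b - \<theta>)^2) * (norm_H2h R b Z N r)^2))"
  define P where "P = (\<lambda>Z lam. \<forall>\<psi>0 \<psi>1. E Z lam (1 / 12) \<psi>0 \<psi>1)"
  have ex: "\<exists>l. \<forall>lam\<ge>l. P Z lam" if "Z \<in> {Z. admissible_grid R h0 Z}" for Z
  proof -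
    have Z: "Z \<ge> 2" using that by (simp add: admissible_grid_def)
    obtain A Q where "grid_operator b Z N A Q R (L_h R b d a1 a2 k Z N)"
      using L_h_grid_operator[OF assms(1-3) Z] by blast
    then interpret grid_operator b Z N A Q R "L_h R b d a1 a2 k Z N" .
    have J: "J_functional R b d a1 a2 k \<theta> Z N lam = cost (carleman_weight \<theta> lam)" for lam
      by (simp add: J_functional_def cost_def fun_eq_iff)
    show ?thesis
      unfolding P_def E_def J using convexity_threshold[OF assms(7) M] unfolding convexity_estimates_def .
  qed
  have "\<exists>l>1. l \<ge> lam0 \<and> (\<forall>Z\<in>{Z. admissible_grid R h0 Z}. \<forall>lam\<ge>l. P Z lam)"
    by (rule uniform_threshold[OF finite_admissible_grids(1)[OF assms(1,6)] ex])
  then obtain l where l: "l > 1" "l \<ge> lam0" "\<And>Z lam. admissible_grid R h0 Z \<Longrightarrow> lam \<ge> l \<Longrightarrow> P Z lam" by auto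
  show "\<exists>lam1>1. lam1 \<ge> lam0 \<and>
          (\<forall>Z. admissible_grid R h0 Z \<longrightarrow> (\<exists>C2>0. \<forall>\<psi>0 \<psi>1. \<forall>lam\<ge>lam1.
            (\<forall>V\<in>closure_B R b Z N \<psi>0 \<psi>1 M. \<forall>W\<in>closure_B R b Z N \<psi>0 \<psi>1 M. \<forall>t.
               norm_H2h R b Z N (sd_diff W V) > 0 \<and> 0 < t \<and> t < 1 \<longrightarrow>
               J_functional R b d a1 a2 k \<theta> Z N lam (sd_segment V W t)
                 < (1 - t) * J_functional R b d a1 a2 k \<theta> Z N lam V
                   + t * J_functional R b d a1 a2 k \<theta> Z N lam W)
          \<and> (\<forall>V r g. V \<in> closure_B R b Z N \<psi>0 \<psi>1 M \<and> sd_add V r \<in> closure_B R b Z N \<psi>0 \<psi>1 M \<and>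
               has_frechet_deriv R b Z N (J_functional R b d a1 a2 k \<theta> Z N lam) V g \<longrightarrow>
               J_functional R b d a1 a2 k \<theta> Z N lam (sd_add V r)
                 - J_functional R b d a1 a2 k \<theta> Z N lam V - ip_H2h R b Z N g r
                 \<ge> C2 * exp (2 * lam * (b - \<theta>)^2) * (norm_H2h R b Z N r)^2)))"
  proof (rule exI[of _ l], intro conjI l(1,2) allI impI)
    fix Z assume "admissible_grid R h0 Z"
    then have "\<exists>C2>0. \<forall>\<psi>0 \<psi>1. \<forall>lam\<ge>l. E Z lam C2 \<psi>0 \<psi>1"
      using l(3) by (intro exI[of _ "1 / 12"]) (simp add: P_def)
    then show "\<exists>C2>0. \<forall>\<psi>0 \<psi>1. \<forall>lam\<ge>l.
            (\<forall>V\<in>closure_B R b Z N \<psi>0 \<psi>1 M. \<forall>W\<in>closure_B R b Z N \<psi>0 \<psi>1 M. \<forall>t.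
               norm_H2h R b Z N (sd_diff W V) > 0 \<and> 0 < t \<and> t < 1 \<longrightarrow>
               J_functional R b d a1 a2 k \<theta> Z N lam (sd_segment V W t)
                 < (1 - t) * J_functional R b d a1 a2 k \<theta> Z N lam V
                   + t * J_functional R b d a1 a2 k \<theta> Z N lam W)
          \<and> (\<forall>V r g. V \<in> closure_B R b Z N \<psi>0 \<psi>1 M \<and> sd_add V r \<in> closure_B R b Z N \<psi>0 \<psi>1 M \<and>
               has_frechet_deriv R b Z N (J_functional R b d a1 a2 k \<theta> Z N lam) V g \<longrightarrow>
               J_functional R b d a1 a2 k \<theta> Z N lam (sd_add V r)
                 - J_functional R b d a1 a2 k \<theta> Z N lam V - ip_H2h R b Z N g r
                 \<ge> C2 * exp (2 * lam * (b - \<theta>)^2) * (norm_H2h R b Z N r)^2)"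
      unfolding E_def .
  qed
qed

end
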